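(* Let $(M^{2n+s},\varphi,\eta^i,\xi_i,g)$ be a generalized Kenmotsu manifold. Then $M$ is locally a warped product $L^s\times_f V^{2n}$, where $V$ is a Kähler manifold with local coordinates $(x_1,\dots,x_{2n})$, $L$ is a flat manifold with local coordinates $(t_1,\dots,t_s)$, and $f(t)=ke^{\sum_{i=1}^s t_i}$ with $k$ a nonzero positive constant; that is, every point of $M$ has an open neighbourhood isometric to such a warped product.
   Context: Here $n,s\ge 1$. The warped product $L\times_f V$ of a flat manifold $L$ with flat coordinates $(t_1,\dots,t_s)$ and a Kähler manifold $(V,J,G)$ is $L\times V$ with metric $g_f=\sum_{i=1}^s dt^i\otimes dt^i+f^2G$. A metric $f$-manifold is a $(2n+s)$-dimensional smooth manifold $M$ with a $(1,1)$-tensor field $\varphi$, vector fields $\xi_1,\dots,\xi_s$, $1$-forms $\eta^1,\dots,\eta^s$ and a Riemannian metric $g$ such that $\varphi^2=-I+\sum_{i=1}^s\eta^i\otimes\xi_i$, $\eta^i(\xi_j)=\delta_{ij}$ and $g(\varphi X,\varphi Y)=g(X,Y)-\sum_{i=1}^s\eta^i(X)\eta^i(Y)$. The fundamental $2$-form is $\Phi(X,Y)=g(X,\varphi Y)$. A metric $f$-manifold is an almost $s$-contact metric manifold if $\eta^1\wedge\dots\wedge\eta^s\wedge\Phi^n\neq 0$ everywhere on $M$. It is normal if $[\varphi,\varphi]+2\sum_{i=1}^s d\eta^i\otimes\xi_i=0$, where $[\varphi,\varphi](X,Y)=\varphi^2[X,Y]+[\varphi X,\varphi Y]-\varphi[\varphi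 X,Y]-\varphi[X,\varphi Y]$ and $2d\eta(X,Y)=X\eta(Y)-Y\eta(X)-\eta([X,Y])$. An almost $s$-contact metric manifold is a generalized almost Kenmotsu manifold if all the $1$-forms $\eta^i$ are closed and $d\Phi=2\sum_{i=1}^s\eta^i\wedge\Phi$; a normal generalized almost Kenmotsu manifold is called a generalized Kenmotsu manifold. *)

theory Defs
  imports "HOL-Analysis.Analysis" "HOL-Combinatorics.Permutations"
begin

section \<open>Smooth manifolds\<close>

primrec Ck_on :: "nat \<Rightarrow> 'e::euclidean_space set \<Rightarrow> ('e \<Rightarrow> 'b::real_normed_vector) \<Rightarrow> bool" where
  "Ck_on 0 S f \<longleftrightarrow> continuous_on S f"
| "Ck_on (Suc k) S f \<longleftrightarrow>
     (\<forall>x\<in>S. f differentiable (at x)) \<and> (\<forall>v. Ck_on k S (\<lambda>x. frechet_derivative f (at x) v))"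

text \<open>Smoothness on an open set \<open>S\<close>; it is only ever used for open \<open>S\<close>.\<close>

definition smooth_on :: "'e::euclidean_space set \<Rightarrow> ('e \<Rightarrow> 'b::real_normed_vector) \<Rightarrow> bool" where
  "smooth_on S f \<longleftrightarrow> (\<forall>k. Ck_on k S f)"

text \<open>A topological space on a subset of \<open>'a\<close> with an atlas given as a family of charts
  \<open>cmap i : cdom i \<rightarrow> 'e\<close>, indexed by \<open>i \<in> ind\<close>. The dimension is \<open>DIM('e)\<close>.\<close>

record ('i, 'a, 'e) manifold =
  mtop :: "'a topology"
  ind  :: "'i set"
  cdom :: "'i \<Rightarrow> 'a set"
  cmap :: "'i \<Rightarrow> 'a \<Rightarrow> 'e"

definition cimg :: "('i, 'a, 'e) manifold \<Rightarrow> 'i \<Rightarrow> 'e set" where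
  "cimg M i = cmap M i ` cdom M i"

definition cinv :: "('i, 'a, 'e) manifold \<Rightarrow> 'i \<Rightarrow> 'e \<Rightarrow> 'a" where
  "cinv M i = inv_into (cdom M i) (cmap M i)"

definition smooth_manifold :: "('i, 'a, 'e::euclidean_space) manifold \<Rightarrow> bool" where
  "smooth_manifold M \<longleftrightarrow>
     Hausdorff_space (mtop M) \<and> second_countable (mtop M) \<and>
     (\<Union>i\<in>ind M. cdom M i) = topspace (mtop M) \<and>
     (\<forall>i\<in>ind M. openin (mtop M) (cdom M i) \<and> open (cimg M i) \<and>
        homeomorphic_map (subtopology (mtop M) (cdom M i)) (top_of_set (cimg M i)) (cmap M i)) \<and>
     (\<forall>i\<in>ind M. \<forall>j\<in>ind M.
        smooth_on (cmap M i ` (cdom M i \<inter> cdom M j)) (cmap M j \<circ> cinv M i))"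

definition open_submanifold :: "('i, 'a, 'e) manifold \<Rightarrow> 'a set \<Rightarrow> ('i, 'a, 'e) manifold" where
  "open_submanifold M U =
     \<lparr> mtop = subtopology (mtop M) U, ind = ind M,
       cdom = (\<lambda>i. cdom M i \<inter> U), cmap = cmap M \<rparr>"

definition euclidean_manifold :: "(unit, 'e, 'e::euclidean_space) manifold" where
  "euclidean_manifold = \<lparr> mtop = euclidean, ind = UNIV, cdom = (\<lambda>_. UNIV), cmap = (\<lambda>_ x. x) \<rparr>"

definition product_manifold ::
  "('i, 'a, 'e) manifold \<Rightarrow> ('j, 'b, 'f) manifold \<Rightarrow> ('i \<times> 'j, 'a \<times> 'b, 'e \<times> 'f) manifold" where
  "product_manifold M N =
     \<lparr> mtop = prod_topology (mtop M) (mtop N), ind = ind M \<times> ind N,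
       cdom = (\<lambda>(i, j). cdom M i \<times> cdom N j),
       cmap = (\<lambda>(i, j). map_prod (cmap M i) (cmap N j)) \<rparr>"

definition smooth_map ::
  "('i, 'a, 'e::euclidean_space) manifold \<Rightarrow> ('j, 'b, 'f::euclidean_space) manifold \<Rightarrow>
    ('a \<Rightarrow> 'b) \<Rightarrow> bool" where
  "smooth_map M N F \<longleftrightarrow> continuous_map (mtop M) (mtop N) F \<and>
     (\<forall>i\<in>ind M. \<forall>j\<in>ind N.
        smooth_on (cmap M i ` (cdom M i \<inter> F -` cdom N j)) (cmap N j \<circ> F \<circ> cinv M i))"

definition diffeomorphism ::
  "('i, 'a, 'e::euclidean_space) manifold \<Rightarrow> ('j, 'b, 'f::euclidean_space) manifold \<Rightarrow>
    ('a \<Rightarrow> 'b) \<Rightarrow> bool" where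
  "diffeomorphism M N F \<longleftrightarrow>
     (\<exists>F'. homeomorphic_maps (mtop M) (mtop N) F F' \<and> smooth_map M N F \<and> smooth_map N M F')"


section \<open>Tensor fields\<close>

text \<open>A tensor field \<open>T\<close> is a family of local representatives: \<open>T i x\<close> is the value at the point
  with coordinates \<open>x\<close> in the chart \<open>i\<close>, expressed in the coordinate frame of that chart, and the
  representatives are related by the usual transformation law. Tangent vectors in a chart are thus
  elements of the model space \<open>'e\<close>, and \<open>tchange M i j p\<close> is the coordinate change of tangent
  vectors at \<open>p\<close> from chart \<open>i\<close> to chart \<open>j\<close>.\<close>

definition tchange :: "('i, 'a, 'e::euclidean_space) manifold \<Rightarrow> 'i \<Rightarrow> 'i \<Rightarrow> 'a \<Rightarrow> 'e \<Rightarrow> 'e" where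
  "tchange M i j p = frechet_derivative (cmap M j \<circ> cinv M i) (at (cmap M i p))"

type_synonym ('i, 'e) scal = "'i \<Rightarrow> 'e \<Rightarrow> real"
type_synonym ('i, 'e) vfield = "'i \<Rightarrow> 'e \<Rightarrow> 'e"
type_synonym ('i, 'e) form1 = "'i \<Rightarrow> 'e \<Rightarrow> 'e \<Rightarrow> real"
type_synonym ('i, 'e) cov2 = "'i \<Rightarrow> 'e \<Rightarrow> 'e \<Rightarrow> 'e \<Rightarrow> real"
type_synonym ('i, 'e) endo = "'i \<Rightarrow> 'e \<Rightarrow> 'e \<Rightarrow> 'e"

definition vector_field ::
  "('i, 'a, 'e::euclidean_space) manifold \<Rightarrow> ('i, 'e) vfield \<Rightarrow> bool" where
  "vector_field M X \<longleftrightarrow>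
     (\<forall>i\<in>ind M. smooth_on (cimg M i) (X i)) \<and>
     (\<forall>i\<in>ind M. \<forall>j\<in>ind M. \<forall>p \<in> cdom M i \<inter> cdom M j.
        X j (cmap M j p) = tchange M i j p (X i (cmap M i p)))"

definition one_form ::
  "('i, 'a, 'e::euclidean_space) manifold \<Rightarrow> ('i, 'e) form1 \<Rightarrow> bool" where
  "one_form M \<alpha> \<longleftrightarrow>
     (\<forall>i\<in>ind M. (\<forall>x\<in>cimg M i. linear (\<alpha> i x)) \<and> (\<forall>v. smooth_on (cimg M i) (\<lambda>x. \<alpha> i x v))) \<and>
     (\<forall>i\<in>ind M. \<forall>j\<in>ind M. \<forall>p \<in> cdom M i \<inter> cdom M j. \<forall>v.
        \<alpha> j (cmap M j p) (tchange M i j p v) = \<alpha> i (cmap M i p) v)"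

definition endo_field ::
  "('i, 'a, 'e::euclidean_space) manifold \<Rightarrow> ('i, 'e) endo \<Rightarrow> bool" where
  "endo_field M \<phi> \<longleftrightarrow>
     (\<forall>i\<in>ind M. (\<forall>x\<in>cimg M i. linear (\<phi> i x)) \<and> (\<forall>v. smooth_on (cimg M i) (\<lambda>x. \<phi> i x v))) \<and>
     (\<forall>i\<in>ind M. \<forall>j\<in>ind M. \<forall>p \<in> cdom M i \<inter> cdom M j. \<forall>v.
        \<phi> j (cmap M j p) (tchange M i j p v) = tchange M i j p (\<phi> i (cmap M i p) v))"

definition covariant2 ::
  "('i, 'a, 'e::euclidean_space) manifold \<Rightarrow> ('i, 'e) cov2 \<Rightarrow> bool" where
  "covariant2 M \<omega> \<longleftrightarrow>
     (\<forall>i\<in>ind M. (\<forall>x\<in>cimg M i. bilinear (\<omega> i x)) \<and>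
        (\<forall>u v. smooth_on (cimg M i) (\<lambda>x. \<omega> i x u v))) \<and>
     (\<forall>i\<in>ind M. \<forall>j\<in>ind M. \<forall>p \<in> cdom M i \<inter> cdom M j. \<forall>u v.
        \<omega> j (cmap M j p) (tchange M i j p u) (tchange M i j p v) = \<omega> i (cmap M i p) u v)"

definition two_form ::
  "('i, 'a, 'e::euclidean_space) manifold \<Rightarrow> ('i, 'e) cov2 \<Rightarrow> bool" where
  "two_form M \<omega> \<longleftrightarrow> covariant2 M \<omega> \<and>
     (\<forall>i\<in>ind M. \<forall>x\<in>cimg M i. \<forall>u v. \<omega> i x v u = - \<omega> i x u v)"

definition riemannian_metric ::
  "('i, 'a, 'e::euclidean_space) manifold \<Rightarrow> ('i, 'e) cov2 \<Rightarrow> bool" where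
  "riemannian_metric M g \<longleftrightarrow> covariant2 M g \<and>
     (\<forall>i\<in>ind M. \<forall>x\<in>cimg M i. (\<forall>u v. g i x v u = g i x u v) \<and> (\<forall>u. u \<noteq> 0 \<longrightarrow> g i x u u > 0))"

definition isometry ::
  "('i, 'a, 'e::euclidean_space) manifold \<Rightarrow> ('i, 'e) cov2 \<Rightarrow>
   ('j, 'b, 'f::euclidean_space) manifold \<Rightarrow> ('j, 'f) cov2 \<Rightarrow> ('a \<Rightarrow> 'b) \<Rightarrow> bool" where
  "isometry M g N h F \<longleftrightarrow> diffeomorphism M N F \<and>
     (\<forall>i\<in>ind M. \<forall>j\<in>ind N. \<forall>p \<in> cdom M i \<inter> F -` cdom N j. \<forall>u v.
        let D = frechet_derivative (cmap N j \<circ> F \<circ> cinv M i) (at (cmap M i p))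
        in h j (cmap N j (F p)) (D u) (D v) = g i (cmap M i p) u v)"


section \<open>Calculus of vector fields and forms\<close>

definition vdir :: "('i, 'e::euclidean_space) vfield \<Rightarrow> ('i, 'e) scal \<Rightarrow> ('i, 'e) scal" where
  "vdir X h = (\<lambda>i x. frechet_derivative (h i) (at x) (X i x))"

definition bracket ::
  "('i, 'e::euclidean_space) vfield \<Rightarrow> ('i, 'e) vfield \<Rightarrow> ('i, 'e) vfield" where
  "bracket X Y = (\<lambda>i x. frechet_derivative (Y i) (at x) (X i x)
                       - frechet_derivative (X i) (at x) (Y i x))"

definition ev1 :: "('i, 'e) form1 \<Rightarrow> ('i, 'e) vfield \<Rightarrow> ('i, 'e) scal" where
  "ev1 \<alpha> X = (\<lambda>i x. \<alpha> i x (X i x))"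

definition ev2 :: "('i, 'e) cov2 \<Rightarrow> ('i, 'e) vfield \<Rightarrow> ('i, 'e) vfield \<Rightarrow> ('i, 'e) scal" where
  "ev2 \<omega> X Y = (\<lambda>i x. \<omega> i x (X i x) (Y i x))"

definition app :: "('i, 'e) endo \<Rightarrow> ('i, 'e) vfield \<Rightarrow> ('i, 'e) vfield" where
  "app \<phi> X = (\<lambda>i x. \<phi> i x (X i x))"

text \<open>Exterior derivative, with the normalisation
  \<open>2 d\<alpha>(X,Y) = X \<alpha>(Y) - Y \<alpha>(X) - \<alpha>([X,Y])\<close>, that is
  \<open>(r+1) d\<omega>(X\<^sub>0,\<dots>,X\<^sub>r) = \<dots>\<close> in degree \<open>r\<close>. The exterior product below is normalised
  by \<open>1/(p+q)!\<close>, so that \<open>d\<close> is an antiderivation for it.\<close>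

definition ext_d1 ::
  "('i, 'e::euclidean_space) form1 \<Rightarrow> ('i, 'e) vfield \<Rightarrow> ('i, 'e) vfield \<Rightarrow> ('i, 'e) scal" where
  "ext_d1 \<alpha> X Y = (\<lambda>i x.
     (vdir X (ev1 \<alpha> Y) i x - vdir Y (ev1 \<alpha> X) i x - ev1 \<alpha> (bracket X Y) i x) / 2)"

definition ext_d2 ::
  "('i, 'e::euclidean_space) cov2 \<Rightarrow> ('i, 'e) vfield \<Rightarrow> ('i, 'e) vfield \<Rightarrow> ('i, 'e) vfield \<Rightarrow>
    ('i, 'e) scal" where
  "ext_d2 \<omega> X Y Z = (\<lambda>i x.
     (vdir X (ev2 \<omega> Y Z) i x + vdir Y (ev2 \<omega> Z X) i x + vdir Z (ev2 \<omega> X Y) i x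
      - ev2 \<omega> (bracket X Y) Z i x - ev2 \<omega> (bracket Y Z) X i x - ev2 \<omega> (bracket Z X) Y i x) / 3)"

definition nijenhuis ::
  "('i, 'e::euclidean_space) endo \<Rightarrow> ('i, 'e) vfield \<Rightarrow> ('i, 'e) vfield \<Rightarrow> ('i, 'e) vfield" where
  "nijenhuis \<phi> X Y = (\<lambda>i x.
     app \<phi> (app \<phi> (bracket X Y)) i x + bracket (app \<phi> X) (app \<phi> Y) i x
     - app \<phi> (bracket (app \<phi> X) Y) i x - app \<phi> (bracket X (app \<phi> Y)) i x)"

text \<open>Alternating \<open>k\<close>-linear forms on a vector space, as functions of sequences of vectors of which
  only the entries \<open>0, \<dots>, k - 1\<close> matter.\<close>

type_synonym 'e kform = "(nat \<Rightarrow> 'e) \<Rightarrow> real"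

definition wedge :: "nat \<Rightarrow> nat \<Rightarrow> 'e kform \<Rightarrow> 'e kform \<Rightarrow> 'e kform" where
  "wedge p q \<alpha> \<beta> = (\<lambda>v.
     (\<Sum>\<sigma> | \<sigma> permutes {..<p + q}.
        of_int (sign \<sigma>) * \<alpha> (\<lambda>k. v (\<sigma> k)) * \<beta> (\<lambda>k. v (\<sigma> (p + k)))) / fact (p + q))"

primrec wedge_list1 :: "'e kform list \<Rightarrow> 'e kform" where
  "wedge_list1 [] = (\<lambda>_. 1)"
| "wedge_list1 (\<alpha> # \<alpha>s) = wedge 1 (length \<alpha>s) \<alpha> (wedge_list1 \<alpha>s)"

primrec wedge_pow2 :: "'e kform \<Rightarrow> nat \<Rightarrow> 'e kform" where
  "wedge_pow2 \<omega> 0 = (\<lambda>_. 1)"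
| "wedge_pow2 \<omega> (Suc n) = wedge 2 (2 * n) \<omega> (wedge_pow2 \<omega> n)"

definition kform1 :: "('e \<Rightarrow> real) \<Rightarrow> 'e kform" where
  "kform1 \<alpha> = (\<lambda>v. \<alpha> (v 0))"

definition kform2 :: "('e \<Rightarrow> 'e \<Rightarrow> real) \<Rightarrow> 'e kform" where
  "kform2 \<omega> = (\<lambda>v. \<omega> (v 0) (v 1))"

definition wedge12 ::
  "('i, 'e) form1 \<Rightarrow> ('i, 'e) cov2 \<Rightarrow> ('i, 'e) vfield \<Rightarrow> ('i, 'e) vfield \<Rightarrow> ('i, 'e) vfield \<Rightarrow>
    ('i, 'e) scal" where
  "wedge12 \<alpha> \<omega> X Y Z = (\<lambda>i x.
     wedge 1 2 (kform1 (\<alpha> i x)) (kform2 (\<omega> i x)) (\<lambda>k. [X i x, Y i x, Z i x] ! k))"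

text \<open>Tensor identities are required for vector fields defined on arbitrary open subsets \<open>U\<close>, at all
  points of \<open>U\<close>.\<close>

definition closed_1form ::
  "('i, 'a, 'e::euclidean_space) manifold \<Rightarrow> ('i, 'e) form1 \<Rightarrow> bool" where
  "closed_1form M \<alpha> \<longleftrightarrow>
     (\<forall>U X Y. openin (mtop M) U \<longrightarrow>
        vector_field (open_submanifold M U) X \<longrightarrow> vector_field (open_submanifold M U) Y \<longrightarrow>
        (\<forall>i\<in>ind M. \<forall>x\<in>cimg (open_submanifold M U) i. ext_d1 \<alpha> X Y i x = 0))"

definition closed_2form ::
  "('i, 'a, 'e::euclidean_space) manifold \<Rightarrow> ('i, 'e) cov2 \<Rightarrow> bool" where
  "closed_2form M \<omega> \<longleftrightarrow>
     (\<forall>U X Y Z. openin (mtop M) U \<longrightarrow>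
        vector_field (open_submanifold M U) X \<longrightarrow> vector_field (open_submanifold M U) Y \<longrightarrow>
        vector_field (open_submanifold M U) Z \<longrightarrow>
        (\<forall>i\<in>ind M. \<forall>x\<in>cimg (open_submanifold M U) i. ext_d2 \<omega> X Y Z i x = 0))"


section \<open>Generalized Kenmotsu manifolds\<close>

definition fundamental_form :: "('i, 'e) endo \<Rightarrow> ('i, 'e) cov2 \<Rightarrow> ('i, 'e) cov2" where
  "fundamental_form \<phi> g = (\<lambda>i x u v. g i x u (\<phi> i x v))"

text \<open>The finite index type \<open>'s\<close> plays the role of \<open>{1,\<dots>,s}\<close>. The last conjunct records that the
  fundamental \<open>2\<close>-form is a \<open>2\<close>-form. For \<open>s \<ge> 2\<close> its skew-symmetry does not follow from the three
  algebraic identities: they admit \<open>\<phi> \<xi>\<^sub>1 = 0\<close>, \<open>\<phi> \<xi>\<^sub>2 = a \<xi>\<^sub>1\<close> with \<open>\<xi>\<^sub>1, \<xi>\<^sub>2\<close>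
  orthogonal, \<open>g(\<xi>\<^sub>1, \<xi>\<^sub>1) = 1\<close> and \<open>g(\<xi>\<^sub>2, \<xi>\<^sub>2) = 1 + a\<^sup>2\<close>.\<close>

definition metric_f_manifold ::
  "nat \<Rightarrow> ('i, 'a, 'e::euclidean_space) manifold \<Rightarrow> ('i, 'e) endo \<Rightarrow>
   ('s::finite \<Rightarrow> ('i, 'e) form1) \<Rightarrow> ('s \<Rightarrow> ('i, 'e) vfield) \<Rightarrow> ('i, 'e) cov2 \<Rightarrow> bool" where
  "metric_f_manifold n M \<phi> \<eta> \<xi> g \<longleftrightarrow>
     smooth_manifold M \<and> DIM('e) = 2 * n + CARD('s) \<and>
     endo_field M \<phi> \<and> (\<forall>a. one_form M (\<eta> a)) \<and> (\<forall>a. vector_field M (\<xi> a)) \<and>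
     riemannian_metric M g \<and>
     (\<forall>i\<in>ind M. \<forall>x\<in>cimg M i.
        (\<forall>u. \<phi> i x (\<phi> i x u) = - u + (\<Sum>a\<in>UNIV. \<eta> a i x u *\<^sub>R \<xi> a i x)) \<and>
        (\<forall>a b. \<eta> a i x (\<xi> b i x) = (if a = b then 1 else 0)) \<and>
        (\<forall>u v. g i x (\<phi> i x u) (\<phi> i x v) = g i x u v - (\<Sum>a\<in>UNIV. \<eta> a i x u * \<eta> a i x v))) \<and>
     two_form M (fundamental_form \<phi> g)"

text \<open>The list \<open>as\<close> enumerates \<open>'s\<close>; its order affects the product only by a sign.\<close>

definition almost_s_contact_metric_manifold ::
  "nat \<Rightarrow> ('i, 'a, 'e::euclidean_space) manifold \<Rightarrow> ('i, 'e) endo \<Rightarrow>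
   ('s::finite \<Rightarrow> ('i, 'e) form1) \<Rightarrow> ('s \<Rightarrow> ('i, 'e) vfield) \<Rightarrow> ('i, 'e) cov2 \<Rightarrow> bool" where
  "almost_s_contact_metric_manifold n M \<phi> \<eta> \<xi> g \<longleftrightarrow>
     metric_f_manifold n M \<phi> \<eta> \<xi> g \<and>
     (\<forall>as. distinct as \<and> set as = (UNIV :: 's set) \<longrightarrow>
       (\<forall>i\<in>ind M. \<forall>x\<in>cimg M i.
          wedge CARD('s) (2 * n) (wedge_list1 (map (\<lambda>a. kform1 (\<eta> a i x)) as))
            (wedge_pow2 (kform2 (fundamental_form \<phi> g i x)) n) \<noteq> (\<lambda>_. 0)))"

definition normal_f_structure ::
  "('i, 'a, 'e::euclidean_space) manifold \<Rightarrow> ('i, 'e) endo \<Rightarrow>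
   ('s::finite \<Rightarrow> ('i, 'e) form1) \<Rightarrow> ('s \<Rightarrow> ('i, 'e) vfield) \<Rightarrow> bool" where
  "normal_f_structure M \<phi> \<eta> \<xi> \<longleftrightarrow>
     (\<forall>U X Y. openin (mtop M) U \<longrightarrow>
        vector_field (open_submanifold M U) X \<longrightarrow> vector_field (open_submanifold M U) Y \<longrightarrow>
        (\<forall>i\<in>ind M. \<forall>x\<in>cimg (open_submanifold M U) i.
           nijenhuis \<phi> X Y i x + 2 *\<^sub>R (\<Sum>a\<in>UNIV. ext_d1 (\<eta> a) X Y i x *\<^sub>R \<xi> a i x) = 0))"

definition generalized_almost_Kenmotsu ::
  "nat \<Rightarrow> ('i, 'a, 'e::euclidean_space) manifold \<Rightarrow> ('i, 'e) endo \<Rightarrow>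
   ('s::finite \<Rightarrow> ('i, 'e) form1) \<Rightarrow> ('s \<Rightarrow> ('i, 'e) vfield) \<Rightarrow> ('i, 'e) cov2 \<Rightarrow> bool" where
  "generalized_almost_Kenmotsu n M \<phi> \<eta> \<xi> g \<longleftrightarrow>
     almost_s_contact_metric_manifold n M \<phi> \<eta> \<xi> g \<and>
     (\<forall>a. closed_1form M (\<eta> a)) \<and>
     (\<forall>U X Y Z. openin (mtop M) U \<longrightarrow>
        vector_field (open_submanifold M U) X \<longrightarrow> vector_field (open_submanifold M U) Y \<longrightarrow>
        vector_field (open_submanifold M U) Z \<longrightarrow>
        (\<forall>i\<in>ind M. \<forall>x\<in>cimg (open_submanifold M U) i.
           ext_d2 (fundamental_form \<phi> g) X Y Z i x
           = 2 * (\<Sum>a\<in>UNIV. wedge12 (\<eta> a) (fundamental_form \<phi> g) X Y Z i x)))"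

definition generalized_Kenmotsu ::
  "nat \<Rightarrow> ('i, 'a, 'e::euclidean_space) manifold \<Rightarrow> ('i, 'e) endo \<Rightarrow>
   ('s::finite \<Rightarrow> ('i, 'e) form1) \<Rightarrow> ('s \<Rightarrow> ('i, 'e) vfield) \<Rightarrow> ('i, 'e) cov2 \<Rightarrow> bool" where
  "generalized_Kenmotsu n M \<phi> \<eta> \<xi> g \<longleftrightarrow>
     generalized_almost_Kenmotsu n M \<phi> \<eta> \<xi> g \<and> normal_f_structure M \<phi> \<eta> \<xi>"


section \<open>Warped products of flat and Kaehler manifolds\<close>

definition kaehler_manifold ::
  "('i, 'a, 'e::euclidean_space) manifold \<Rightarrow> ('i, 'e) endo \<Rightarrow> ('i, 'e) cov2 \<Rightarrow> bool" where
  "kaehler_manifold V J G \<longleftrightarrow>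
     smooth_manifold V \<and> endo_field V J \<and> riemannian_metric V G \<and>
     (\<forall>i\<in>ind V. \<forall>x\<in>cimg V i.
        (\<forall>u. J i x (J i x u) = - u) \<and> (\<forall>u v. G i x (J i x u) (J i x v) = G i x u v)) \<and>
     (\<forall>U X Y. openin (mtop V) U \<longrightarrow>
        vector_field (open_submanifold V U) X \<longrightarrow> vector_field (open_submanifold V U) Y \<longrightarrow>
        (\<forall>i\<in>ind V. \<forall>x\<in>cimg (open_submanifold V U) i. nijenhuis J X Y i x = 0)) \<and>
     closed_2form V (fundamental_form J G)"

definition differential ::
  "('i, 'a, 'e::euclidean_space) manifold \<Rightarrow> ('a \<Rightarrow> real) \<Rightarrow> ('i, 'e) form1" where
  "differential M h = (\<lambda>i x. frechet_derivative (h \<circ> cinv M i) (at x))"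

text \<open>The metric of \<open>L\<close> is \<open>\<Sum>\<^sub>a dt\<^sup>a \<otimes> dt\<^sup>a\<close> for coordinates
  \<open>t = (t\<^sub>1,\<dots>,t\<^sub>s)\<close> on \<open>L\<close>.\<close>

definition coordinates_on ::
  "('i, 'a, 'e::euclidean_space) manifold \<Rightarrow> ('a \<Rightarrow> real ^ 's) \<Rightarrow> bool" where
  "coordinates_on L t \<longleftrightarrow>
     (\<exists>W. open W \<and> diffeomorphism L (open_submanifold euclidean_manifold W) t)"

definition flat_metric ::
  "('i, 'a, 'e::euclidean_space) manifold \<Rightarrow> ('a \<Rightarrow> real ^ 's) \<Rightarrow> ('i, 'e) cov2" where
  "flat_metric L t = (\<lambda>i x u v.
     \<Sum>a\<in>UNIV. differential L (\<lambda>p. t p $ a) i x u * differential L (\<lambda>p. t p $ a) i x v)"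

definition flat_manifold ::
  "('i, 'a, 'e::euclidean_space) manifold \<Rightarrow> ('a \<Rightarrow> real ^ 's) \<Rightarrow> ('i, 'e) cov2 \<Rightarrow> bool" where
  "flat_manifold L t h \<longleftrightarrow>
     smooth_manifold L \<and> riemannian_metric L h \<and> coordinates_on L t \<and>
     (\<forall>i\<in>ind L. \<forall>x\<in>cimg L i. h i x = flat_metric L t i x)"

definition warped_metric ::
  "('i, 'a, 'e) manifold \<Rightarrow> ('i, 'e) cov2 \<Rightarrow> ('a \<Rightarrow> real) \<Rightarrow> ('j, 'f) cov2 \<Rightarrow>
    ('i \<times> 'j, 'e \<times> 'f) cov2" where
  "warped_metric L h f G = (\<lambda>(i, j) (x, y) (u, u') (v, v').
     h i x u v + (f (cinv L i x))\<^sup>2 * G j y u' v')"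

end

theory Submission
  imports Defs
begin

text \<open>Everything happens in one chart. Since \<open>\<Phi>\<close> is skew, \<open>\<phi> \<xi>\<^sub>a = 0\<close> and \<open>\<eta>\<^sup>a = g(\<cdot>, \<xi>\<^sub>a)\<close>. Normality together with
  \<open>d\<eta>\<^sup>a = 0\<close> gives \<open>[\<xi>\<^sub>a, \<xi>\<^sub>b] = 0\<close> and \<open>L\<phi> = 0\<close> for the Lie derivative \<open>L\<close> along any \<open>\<xi>\<^sub>a\<close>, and
  \<open>d\<Phi> = 2 \<Sum> \<eta>\<^sup>a \<and> \<Phi>\<close> gives \<open>L\<Phi> = 2\<Phi>\<close>. Let \<open>t\<close> be a primitive of \<open>(\<eta>\<^sup>1, \<dots>, \<eta>\<^sup>s)\<close> and let \<open>\<Psi>(x, \<tau>)\<close> be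
  the flow of \<open>\<Sum> \<tau>\<^sub>a \<xi>\<^sub>a\<close> at time one. The map that sends \<open>x\<close> to \<open>t(x)\<close> and to a linear projection of
  \<open>\<Psi>(x, - t(x))\<close> is a chart in which \<open>\<xi>\<^sub>a = \<partial>/\<partial>t\<^sub>a\<close> and \<open>\<eta>\<^sup>a = dt\<^sub>a\<close>. In it \<open>\<phi>\<close> does not depend on \<open>t\<close>
  and \<open>\<Phi>\<close> scales by \<open>exp(2 \<Sum> t\<^sub>a)\<close>, so that the metric is the warped one, with \<open>k = 1\<close> and \<open>V\<close> the slice
  \<open>t = 0\<close>. Because every \<open>\<eta>\<^sup>a\<close> vanishes on the slice, the induced structure is integrable with closed
  fundamental form. The flow and the inverse of the chart are both fixed points of \<open>u = K(F \<circ> u)\<close> for a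
  contraction \<open>F\<close> and an averaging operator \<open>K\<close>, and one induction shows that both are smooth.\<close>

subsection \<open>Families of C^k maps with a compact parameter\<close>

text \<open>No connection enters. On the common kernel of the forms \<eta> the metric is recovered
  as \<open>g u v = - \<Phi> u (\<phi> v)\<close>, and the frame \<xi> is orthonormal and orthogonal
  to that kernel, so the two Lie derivatives along the frame already determine how the metric
  varies. The burden is analytic: a chart that is smooth to all orders on a full box. The group law
  of the flow is avoided. The only fact about \<Psi> besides smoothness and \<Psi>(x, 0) = x is
  infinitesimal: moving x along \<xi> a while lowering the a-th time at the same rate does not
  change \<Psi> to first order. Substituting the time - t(x) then gives a map that is constant along
  the frame, and commutation of the frame is needed for this one identity alone. Smoothness rests on
  stability under differentiation: the derivative of a fixed point in a parameter direction solves
  an equation of the same shape, with the same averaging operator and the same contraction constant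
  1/2. The operator never increases a uniform bound, so one absorption argument on [0,1] serves for
  continuity, uniqueness and differentiability alike.\<close>

abbreviation fder :: "('e::real_normed_vector \<Rightarrow> 'b::real_normed_vector) \<Rightarrow> 'e \<Rightarrow> 'e \<Rightarrow> 'b" where
  "fder f x \<equiv> frechet_derivative f (at x)"

lemma has_derivative_fder:
  "f differentiable (at x) \<Longrightarrow> (f has_derivative fder f x) (at x)"
  using frechet_derivative_works by blast

lemma fder_eqI: "(f has_derivative f') (at x) \<Longrightarrow> fder f x = f'"
  by (metis frechet_derivative_at)

lemma fder_cong_open:
  assumes "open S" "x \<in> S" "\<And>y. y \<in> S \<Longrightarrow> f y = g y"
  shows "fder f x = fder g x"
proof -
  have "(f has_derivative f') (at x) \<longleftrightarrow> (g has_derivative f') (at x)" for f'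
    using assms has_derivative_transform_within_open[of _ _ x UNIV S] by metis
  then show ?thesis by (simp add: frechet_derivative_def)
qed

lemma differentiable_cong_open:
  assumes "open S" "x \<in> S" "\<And>y. y \<in> S \<Longrightarrow> f y = g y" "f differentiable (at x)"
  shows "g differentiable (at x)"
  using assms has_derivative_transform_within_open[of _ _ x UNIV S] unfolding differentiable_def by metis

lemma linear_basis_sum:
  fixes f :: "'e::euclidean_space \<Rightarrow> 'b::real_vector"
  assumes "linear f" shows "f v = (\<Sum>b\<in>Basis. (v \<bullet> b) *\<^sub>R f b)"
proof -
  have "f v = f (\<Sum>b\<in>Basis. (v \<bullet> b) *\<^sub>R b)" by (simp add: euclidean_representation)
  also have "\<dots> = (\<Sum>b\<in>Basis. (v \<bullet> b) *\<^sub>R f b)" using assms by (simp add: linear_sum linear_scale)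
  finally show ?thesis .
qed

text \<open>The parameter \<open>s\<close> stands for the time of a flow: joint continuity in
  \<open>(s, x)\<close> is required, derivatives are taken in \<open>x\<close> only. Derivatives are
  recorded one fixed direction \<open>v\<close> at a time, so the target remains \<open>'b\<close>
  and no space of linear maps is needed.\<close>

primrec pCk :: "nat \<Rightarrow> real set \<Rightarrow> 'e::euclidean_space set \<Rightarrow> (real \<Rightarrow> 'e \<Rightarrow> 'b::real_normed_vector) \<Rightarrow> bool" where
  "pCk 0 I S f \<longleftrightarrow> continuous_on (I \<times> S) (\<lambda>(s, x). f s x)"
| "pCk (Suc k) I S f \<longleftrightarrow> continuous_on (I \<times> S) (\<lambda>(s, x). f s x) \<and>
     (\<forall>s\<in>I. \<forall>x\<in>S. f s differentiable (at x)) \<and> (\<forall>v. pCk k I S (\<lambda>s x. fder (f s) x v))"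

lemma pCk_continuous: "pCk k I S f \<Longrightarrow> continuous_on (I \<times> S) (\<lambda>(s, x). f s x)"
  by (cases k) auto

lemma pCk_SucD: "pCk (Suc k) I S f \<Longrightarrow> pCk k I S f"
  by (induction k arbitrary: f) auto

lemma pCk_le: "j \<le> k \<Longrightarrow> pCk k I S f \<Longrightarrow> pCk j I S f"
proof (induction rule: dec_induct)
  case (step n)
  then show ?case using pCk_SucD by blast
qed

lemma pCk_subset: "pCk k I S f \<Longrightarrow> T \<subseteq> S \<Longrightarrow> J \<subseteq> I \<Longrightarrow> pCk k J T f"
proof (induction k arbitrary: f)
  case 0
  then show ?case by (auto elim!: continuous_on_subset)
next
  case (Suc k)
  then show ?case by (auto elim!: continuous_on_subset) (meson subsetD)+
qed

lemma pCk_cong: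
  assumes "open S" "\<And>s x. s \<in> I \<Longrightarrow> x \<in> S \<Longrightarrow> f s x = g s x" "pCk k I S f"
  shows "pCk k I S g"
  using assms(2,3)
proof (induction k arbitrary: f g)
  case 0
  have "continuous_on (I \<times> S) (\<lambda>(s, x). f s x) = continuous_on (I \<times> S) (\<lambda>(s, x). g s x)"
    by (rule continuous_on_cong) (auto simp: 0)
  with 0 show ?case by simp
next
  case (Suc k)
  have "continuous_on (I \<times> S) (\<lambda>(s, x). f s x) = continuous_on (I \<times> S) (\<lambda>(s, x). g s x)"
    by (rule continuous_on_cong) (auto simp: Suc.prems)
  moreover have "g s differentiable (at x)" if "s \<in> I" "x \<in> S" for s x
    using differentiable_cong_open[OF \<open>open S\<close> that(2), of "f s" "g s"] Suc.prems that by auto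
  moreover have "pCk k I S (\<lambda>s x. fder (g s) x v)" for v
  proof (rule Suc.IH[of "\<lambda>s x. fder (f s) x v"])
    show "fder (f s) x v = fder (g s) x v" if "s \<in> I" "x \<in> S" for s x
      using fder_cong_open[OF \<open>open S\<close> that(2), of "f s" "g s"] Suc.prems that by auto
    show "pCk k I S (\<lambda>s x. fder (f s) x v)" using Suc.prems by simp
  qed
  ultimately show ?case using Suc.prems by simp
qed

lemma pCk_SucI:
  assumes "open S" "continuous_on (I \<times> S) (\<lambda>(s, x). f s x)"
    and "\<And>s x. s \<in> I \<Longrightarrow> x \<in> S \<Longrightarrow> (f s has_derivative (\<lambda>v. f' v s x)) (at x)"
    and "\<And>v. pCk k I S (f' v)"
  shows "pCk (Suc k) I S f"
proof -
  have "pCk k I S (\<lambda>s x. fder (f s) x v)" for v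
  proof (rule pCk_cong[OF assms(1) _ assms(4)])
    show "f' v s x = fder (f s) x v" if "s \<in> I" "x \<in> S" for s x
      using fder_eqI[OF assms(3)[OF that]] by simp
  qed
  with assms show ?thesis by (auto intro: differentiableI)
qed

lemma pCk_const_vec: "open S \<Longrightarrow> continuous_on I c \<Longrightarrow> pCk k I S (\<lambda>s _. c s)"
proof (induction k arbitrary: c)
  case 0
  have "continuous_on (I \<times> S) (\<lambda>p. c (fst p))"
    by (rule continuous_on_compose2[OF 0(2)]) (auto intro: continuous_intros)
  then show ?case by (simp add: case_prod_beta)
next
  case (Suc k)
  have "continuous_on (I \<times> S) (\<lambda>p. c (fst p))"
    by (rule continuous_on_compose2[OF Suc(3)]) (auto intro: continuous_intros)
  with Suc show ?case by (simp add: case_prod_beta)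
qed

lemma pCk_const: "open S \<Longrightarrow> pCk k I S (\<lambda>_ _. c)"
  by (rule pCk_const_vec) auto

lemma pCk_add: "open S \<Longrightarrow> pCk k I S f \<Longrightarrow> pCk k I S g \<Longrightarrow> pCk k I S (\<lambda>s x. f s x + g s x)"
proof (induction k arbitrary: f g)
  case 0
  then show ?case by (auto simp: case_prod_beta intro!: continuous_intros)
next
  case (Suc k)
  show ?case
  proof (rule pCk_SucI[OF \<open>open S\<close>, where f' = "\<lambda>v s x. fder (f s) x v + fder (g s) x v"])
    show "continuous_on (I \<times> S) (\<lambda>(s, x). f s x + g s x)"
      using Suc.prems by (auto simp: case_prod_beta intro!: continuous_intros)
  next
    fix s x assume "s \<in> I" "x \<in> S"
    with Suc.prems have "f s differentiable (at x)" "g s differentiable (at x)" by auto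
    then show "((\<lambda>x. f s x + g s x) has_derivative (\<lambda>v. fder (f s) x v + fder (g s) x v)) (at x)"
      by (intro has_derivative_add has_derivative_fder)
  next
    show "pCk k I S (\<lambda>s x. fder (f s) x v + fder (g s) x v)" for v
      using Suc by auto
  qed
qed

lemma pCk_scaleR:
  "open S \<Longrightarrow> pCk k I S f \<Longrightarrow> pCk k I S g \<Longrightarrow> pCk k I S (\<lambda>s x. (f s x :: real) *\<^sub>R g s x)"
proof (induction k arbitrary: f g)
  case 0
  then show ?case by (auto simp: case_prod_beta intro!: continuous_intros)
next
  case (Suc k)
  show ?case
  proof (rule pCk_SucI[OF \<open>open S\<close>, where f' = "\<lambda>v s x. f s x *\<^sub>R fder (g s) x v + fder (f s) x v *\<^sub>R g s x"])
    show "continuous_on (I \<times> S) (\<lambda>(s, x). f s x *\<^sub>R g s x)"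
      using Suc.prems by (auto simp: case_prod_beta intro!: continuous_intros)
  next
    fix s x assume "s \<in> I" "x \<in> S"
    with Suc.prems have "f s differentiable (at x)" "g s differentiable (at x)" by auto
    then show "((\<lambda>x. f s x *\<^sub>R g s x) has_derivative (\<lambda>v. f s x *\<^sub>R fder (g s) x v + fder (f s) x v *\<^sub>R g s x)) (at x)"
      by (intro has_derivative_scaleR has_derivative_fder)
  next
    show "pCk k I S (\<lambda>s x. f s x *\<^sub>R fder (g s) x v + fder (f s) x v *\<^sub>R g s x)" for v
      using Suc.prems pCk_SucD[OF Suc.prems(2)] pCk_SucD[OF Suc.prems(3)]
      by (intro pCk_add Suc.IH) (auto simp del: pCk.simps(2) simp: pCk.simps(2)[of k I S f] pCk.simps(2)[of k I S g])
  qed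
qed

lemma pCk_sum: "open S \<Longrightarrow> (\<And>i. i \<in> A \<Longrightarrow> pCk k I S (f i)) \<Longrightarrow> pCk k I S (\<lambda>s x. \<Sum>i\<in>A. f i s x)"
proof (induction A rule: infinite_finite_induct)
  case (insert a A)
  then show ?case by (simp add: pCk_add)
qed (auto simp: pCk_const)

lemma pCk_bounded_linear:
  assumes "bounded_linear l" "open S" "pCk k I S f" shows "pCk k I S (\<lambda>s x. l (f s x))"
  using assms(3)
proof (induction k arbitrary: f)
  case 0
  then show ?case using bounded_linear.continuous_on[OF assms(1)] by (auto simp: case_prod_beta)
next
  case (Suc k)
  show ?case
  proof (rule pCk_SucI[OF \<open>open S\<close>, where f' = "\<lambda>v s x. l (fder (f s) x v)"])
    show "continuous_on (I \<times> S) (\<lambda>(s, x). l (f s x))"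
      using Suc.prems bounded_linear.continuous_on[OF assms(1)] by (auto simp: case_prod_beta)
  next
    fix s x assume "s \<in> I" "x \<in> S"
    with Suc.prems have "f s differentiable (at x)" by auto
    then show "((\<lambda>x. l (f s x)) has_derivative (\<lambda>v. l (fder (f s) x v))) (at x)"
      by (intro bounded_linear.has_derivative[OF assms(1)] has_derivative_fder)
  next
    show "pCk k I S (\<lambda>s x. l (fder (f s) x v))" for v
      using Suc by auto
  qed
qed

text \<open>In the chain rule the outer derivative is expanded in the basis. Each partial derivative
  of \<open>f\<close>, composed with the unchanged \<open>y\<close>, then falls under the induction
  hypothesis, which is why only \<open>f\<close> is generalized.\<close>

lemma pCk_compose:
  fixes f :: "real \<Rightarrow> 'f::euclidean_space \<Rightarrow> 'b::real_normed_vector"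
    and y :: "real \<Rightarrow> 'e::euclidean_space \<Rightarrow> 'f"
  assumes "open S" "open T" "pCk k I T f" "pCk k I S y" "\<And>s x. s \<in> I \<Longrightarrow> x \<in> S \<Longrightarrow> y s x \<in> T"
  shows "pCk k I S (\<lambda>s x. f s (y s x))"
  using assms(3,4)
proof (induction k arbitrary: f)
  case 0
  have "continuous_on (I \<times> S) (\<lambda>p. (\<lambda>(s, z). f s z) (fst p, y (fst p) (snd p)))"
    by (rule continuous_on_compose2[of "I \<times> T"])
      (use 0 assms(5) in \<open>auto simp: case_prod_beta intro!: continuous_intros\<close>)
  then show ?case by (simp add: case_prod_beta)
next
  case (Suc k)
  have c: "continuous_on (I \<times> S) (\<lambda>p. (\<lambda>(s, z). f s z) (fst p, y (fst p) (snd p)))"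
    by (rule continuous_on_compose2[of "I \<times> T"])
      (use Suc.prems assms(5) in \<open>auto simp: case_prod_beta intro!: continuous_intros\<close>)
  show ?case
  proof (rule pCk_SucI[OF \<open>open S\<close>,
        where f' = "\<lambda>v s x. \<Sum>b\<in>Basis. (fder (y s) x v \<bullet> b) *\<^sub>R fder (f s) (y s x) b"])
    show "continuous_on (I \<times> S) (\<lambda>(s, x). f s (y s x))"
      using c by (simp add: case_prod_beta)
  next
    fix s x assume s: "s \<in> I" "x \<in> S"
    with Suc.prems assms(5) have *: "y s differentiable (at x)" "f s differentiable (at (y s x))" by auto
    have "((\<lambda>x. f s (y s x)) has_derivative (\<lambda>v. fder (f s) (y s x) (fder (y s) x v))) (at x)"
      by (rule has_derivative_compose[OF has_derivative_fder[OF *(1)] has_derivative_fder[OF *(2)]])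
    then show "((\<lambda>x. f s (y s x)) has_derivative
        (\<lambda>v. \<Sum>b\<in>Basis. (fder (y s) x v \<bullet> b) *\<^sub>R fder (f s) (y s x) b)) (at x)"
      by (simp only: linear_basis_sum[OF linear_frechet_derivative[OF *(2)], symmetric])
  next
    fix v
    show "pCk k I S (\<lambda>s x. \<Sum>b\<in>Basis. (fder (y s) x v \<bullet> b) *\<^sub>R fder (f s) (y s x) b)"
    proof (intro pCk_sum pCk_scaleR assms(1))
      fix b :: 'f
      show "pCk k I S (\<lambda>s x. fder (y s) x v \<bullet> b)"
        using Suc.prems by (intro pCk_bounded_linear[OF bounded_linear_inner_left assms(1)]) auto
      show "pCk k I S (\<lambda>s x. fder (f s) (y s x) b)"
        using Suc.prems pCk_SucD[OF Suc.prems(2)] by (intro Suc.IH) auto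
    qed
  qed
qed

lemma pCk_id: "open S \<Longrightarrow> pCk k I S (\<lambda>_ x. x)"
proof (induction k)
  case 0
  then show ?case by (auto simp: case_prod_beta intro!: continuous_intros)
next
  case (Suc k)
  show ?case
    by (rule pCk_SucI[OF \<open>open S\<close>, where f' = "\<lambda>v s x. v"])
      (use Suc in \<open>auto simp: case_prod_beta pCk_const intro!: continuous_intros derivative_intros\<close>)
qed

lemma pCk_Pair: 
  fixes f :: "real \<Rightarrow> 'e::euclidean_space \<Rightarrow> 'b::real_normed_vector" and g :: "real \<Rightarrow> 'e \<Rightarrow> 'c::real_normed_vector"
  assumes "open S" "pCk k I S f" "pCk k I S g" shows "pCk k I S (\<lambda>s x. (f s x, g s x))"
proof -
  have "pCk k I S (\<lambda>s x. (f s x, 0 :: 'c) + (0 :: 'b, g s x))"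
    using assms
    by (intro pCk_add) (auto intro!: pCk_bounded_linear[of "\<lambda>x. (x, 0)"] pCk_bounded_linear[of "\<lambda>x. (0, x)"]
        bounded_linear_Pair bounded_linear_ident bounded_linear_zero)
  then show ?thesis by simp
qed

lemma continuous_on_slice:
  assumes "continuous_on (I \<times> S) (\<lambda>(s, x). f s x)" "s \<in> I" shows "continuous_on S (f s)"
proof -
  have "continuous_on S (\<lambda>x. (\<lambda>(s, x). f s x) (s, x))"
    by (rule continuous_on_compose2[OF assms(1)]) (use assms(2) in \<open>auto intro!: continuous_intros\<close>)
  then show ?thesis by simp
qed

lemma continuous_on_constant_family:
  assumes "continuous_on S h" shows "continuous_on (I \<times> S) (\<lambda>(s, x). h x)"
  by (auto simp: case_prod_beta intro!: continuous_on_compose2[OF assms] continuous_intros)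

subsection \<open>Smooth maps on open sets\<close>

text \<open>Over a single parameter value joint continuity is plain continuity, so the closure
  properties of \<open>pCk\<close> carry over. The continuity clause that \<open>pCk\<close> has at
  successor levels follows from differentiability.\<close>

lemma Ck_on_iff_pCk: "Ck_on k S f \<longleftrightarrow> pCk k {0} S (\<lambda>_. f)"
proof -
  have *: "continuous_on ({0} \<times> S) (\<lambda>(s::real, x). h x) \<longleftrightarrow> continuous_on S h" for h :: "'a \<Rightarrow> 'b"
    using continuous_on_slice[of "{0}" S "\<lambda>_. h" 0] continuous_on_constant_family[of S h "{0}"] by auto
  show ?thesis
  proof (induction k arbitrary: f)
    case (Suc k)
    have "continuous_on S f" if "\<forall>x\<in>S. f differentiable (at x)"
      using that by (meson continuous_at_imp_continuous_on differentiable_imp_continuous_within)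
    with Suc show ?case by (auto simp: *)
  qed (simp add: *)
qed

lemma smooth_on_iff_pCk: "smooth_on S f \<longleftrightarrow> (\<forall>k. pCk k {0} S (\<lambda>_. f))"
  by (simp add: smooth_on_def Ck_on_iff_pCk)

lemma pCk_imp_smooth_on: "(\<And>k. pCk k I S f) \<Longrightarrow> s \<in> I \<Longrightarrow> smooth_on S (f s)"
proof -
  assume *: "\<And>k. pCk k I S f" and s: "s \<in> I"
  have **: "Ck_on k S (f s)" if "pCk k I S f" for k f
    using that
  proof (induction k arbitrary: f)
    case 0
    then show ?case 
      using s continuous_on_slice by auto
  next
    case (Suc k)
    then show ?case using s by auto
  qed
  show ?thesis unfolding smooth_on_def by (intro allI ** *)
qed

lemma smooth_on_imp_pCk: "smooth_on S f \<Longrightarrow> pCk k I S (\<lambda>_. f)"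
proof -
  assume f: "smooth_on S f"
  have "pCk k I S (\<lambda>_. f)" if "Ck_on k S f" "Ck_on 0 S f" for f :: "'a \<Rightarrow> 'b"
    using that
  proof (induction k arbitrary: f)
    case 0
    then show ?case by (auto intro!: continuous_on_constant_family)
  next
    case (Suc k)
    have "Ck_on 0 S (\<lambda>x. fder f x v)" for v
      using Suc.prems by (cases k) (auto intro!: continuous_at_imp_continuous_on differentiable_imp_continuous_within)
    with Suc show ?case by (auto intro!: continuous_on_constant_family)
  qed
  with f show ?thesis unfolding smooth_on_def by blast
qed

lemma smooth_on_differentiable: "smooth_on S f \<Longrightarrow> x \<in> S \<Longrightarrow> f differentiable (at x)"
  unfolding smooth_on_def using Ck_on.simps(2) by blast

lemma smooth_on_has_derivative: "smooth_on S f \<Longrightarrow> x \<in> S \<Longrightarrow> (f has_derivative fder f x) (at x)"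
  by (simp add: has_derivative_fder smooth_on_differentiable)

lemma smooth_on_continuous: "smooth_on S f \<Longrightarrow> continuous_on S f"
  unfolding smooth_on_def using Ck_on.simps(1) by blast

lemma smooth_on_subset: "smooth_on S f \<Longrightarrow> T \<subseteq> S \<Longrightarrow> smooth_on T f"
  unfolding smooth_on_iff_pCk using pCk_subset by blast

lemma smooth_on_cong: "open S \<Longrightarrow> (\<And>x. x \<in> S \<Longrightarrow> f x = g x) \<Longrightarrow> smooth_on S f \<Longrightarrow> smooth_on S g"
  unfolding smooth_on_iff_pCk using pCk_cong[of S "{0}" "\<lambda>_. f" "\<lambda>_. g"] by blast

lemma smooth_on_fder: "smooth_on S f \<Longrightarrow> smooth_on S (\<lambda>x. fder f x v)"
  unfolding smooth_on_def using Ck_on.simps(2) by blast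

lemma smooth_onI_derivative:
  assumes "\<And>x. x \<in> S \<Longrightarrow> (f has_derivative f' x) (at x)" "open S" "\<And>v. smooth_on S (\<lambda>x. f' x v)"
  shows "smooth_on S f"
proof -
  have "pCk (Suc k) {0} S (\<lambda>_. f)" for k
  proof (rule pCk_SucI[OF assms(2), where f' = "\<lambda>v s x. f' x v"])
    have "continuous_on S f"
      using assms(1) by (meson has_derivative_continuous continuous_at_imp_continuous_on)
    then show "continuous_on ({0::real} \<times> S) (\<lambda>(s, x). f x)"
      by (auto intro!: continuous_on_constant_family)
  qed (use assms in \<open>auto simp: smooth_on_iff_pCk\<close>)
  then show ?thesis unfolding smooth_on_iff_pCk using pCk_SucD by blast
qed

lemma smooth_on_const: "open S \<Longrightarrow> smooth_on S (\<lambda>_. c)"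
  by (simp add: smooth_on_iff_pCk pCk_const)

lemma smooth_on_id: "open S \<Longrightarrow> smooth_on S (\<lambda>x. x)"
  by (simp add: smooth_on_iff_pCk pCk_id)

lemma smooth_on_add: "open S \<Longrightarrow> smooth_on S f \<Longrightarrow> smooth_on S g \<Longrightarrow> smooth_on S (\<lambda>x. f x + g x)"
  by (simp add: smooth_on_iff_pCk pCk_add)

lemma smooth_on_scaleR: "open S \<Longrightarrow> smooth_on S f \<Longrightarrow> smooth_on S g \<Longrightarrow> smooth_on S (\<lambda>x. (f x :: real) *\<^sub>R g x)"
  by (simp add: smooth_on_iff_pCk pCk_scaleR)

lemma smooth_on_sum: "open S \<Longrightarrow> (\<And>i. i \<in> A \<Longrightarrow> smooth_on S (f i)) \<Longrightarrow> smooth_on S (\<lambda>x. \<Sum>i\<in>A. f i x)"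
  by (simp add: smooth_on_iff_pCk pCk_sum)

lemma smooth_on_bounded_linear: "bounded_linear l \<Longrightarrow> open S \<Longrightarrow> smooth_on S f \<Longrightarrow> smooth_on S (\<lambda>x. l (f x))"
  unfolding smooth_on_iff_pCk by (rule allI, rule pCk_bounded_linear[where f = "\<lambda>_. f"]) auto

lemma smooth_on_Pair: "open S \<Longrightarrow> smooth_on S f \<Longrightarrow> smooth_on S g \<Longrightarrow> smooth_on S (\<lambda>x. (f x, g x))"
  unfolding smooth_on_iff_pCk by (rule allI, rule pCk_Pair[where f = "\<lambda>_. f" and g = "\<lambda>_. g"]) auto

lemma smooth_on_compose:
  "open S \<Longrightarrow> open T \<Longrightarrow> smooth_on T f \<Longrightarrow> smooth_on S y \<Longrightarrow> (\<And>x. x \<in> S \<Longrightarrow> y x \<in> T) \<Longrightarrow> smooth_on S (\<lambda>x. f (y x))"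
  unfolding smooth_on_iff_pCk by (rule allI, rule pCk_compose[where y = "\<lambda>_. y" and f = "\<lambda>_. f"]) auto

lemma smooth_on_apply:
  fixes T :: "'e::euclidean_space \<Rightarrow> 'f::euclidean_space \<Rightarrow> 'b::real_normed_vector"
  assumes "open S" "\<And>x. x \<in> S \<Longrightarrow> linear (T x)" "\<And>v. smooth_on S (\<lambda>x. T x v)" "smooth_on S X"
  shows "smooth_on S (\<lambda>x. T x (X x))"
proof (rule smooth_on_cong[OF assms(1)])
  show "(\<Sum>b\<in>Basis. (X x \<bullet> b) *\<^sub>R T x b) = T x (X x)" if "x \<in> S" for x
    by (rule linear_basis_sum[OF assms(2)[OF that], symmetric])
  show "smooth_on S (\<lambda>x. \<Sum>b\<in>Basis. (X x \<bullet> b) *\<^sub>R T x b)"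
    using assms by (intro smooth_on_sum smooth_on_scaleR smooth_on_bounded_linear[OF bounded_linear_inner_left])
qed

lemma fder_linear2:
  fixes T :: "'e::euclidean_space \<Rightarrow> 'f::euclidean_space \<Rightarrow> 'b::real_normed_vector"
  assumes "open S" "x \<in> S" "\<And>x. x \<in> S \<Longrightarrow> linear (T x)" "\<And>v. (\<lambda>x. T x v) differentiable (at x)"
  shows "linear (\<lambda>v. fder (\<lambda>x. T x v) x w)"
proof
  fix u v c
  have "((\<lambda>x. T x u + T x v) has_derivative (\<lambda>w. fder (\<lambda>x. T x u) x w + fder (\<lambda>x. T x v) x w)) (at x)"
    using assms(4) by (intro has_derivative_add has_derivative_fder)
  moreover have "fder (\<lambda>x. T x (u + v)) x = fder (\<lambda>x. T x u + T x v) x"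
    by (rule fder_cong_open[OF assms(1,2)]) (use assms(3) in \<open>auto simp: linear_add\<close>)
  ultimately show "fder (\<lambda>x. T x (u + v)) x w = fder (\<lambda>x. T x u) x w + fder (\<lambda>x. T x v) x w"
    by (simp add: fder_eqI)
  have "((\<lambda>x. c *\<^sub>R T x u) has_derivative (\<lambda>w. c *\<^sub>R fder (\<lambda>x. T x u) x w)) (at x)"
    using assms(4) by (intro has_derivative_scaleR_right has_derivative_fder)
  moreover have "fder (\<lambda>x. T x (c *\<^sub>R u)) x = fder (\<lambda>x. c *\<^sub>R T x u) x"
    by (rule fder_cong_open[OF assms(1,2)]) (use assms(3) in \<open>auto simp: linear_scale\<close>)
  ultimately show "fder (\<lambda>x. T x (c *\<^sub>R u)) x w = c *\<^sub>R fder (\<lambda>x. T x u) x w"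
    by (simp add: fder_eqI)
qed

text \<open>The Leibniz rule for a tensor evaluated on a field: one term differentiates the tensor
  with the vector frozen at its value at \<open>x\<close>, the other differentiates the field.
  Coordinate formulas for brackets and Lie derivatives are obtained from it.\<close>

lemma has_derivative_apply:
  fixes T :: "'e::euclidean_space \<Rightarrow> 'f::euclidean_space \<Rightarrow> 'b::real_normed_vector"
  assumes "open S" "x \<in> S" "\<And>x. x \<in> S \<Longrightarrow> linear (T x)" "\<And>v. (\<lambda>x. T x v) differentiable (at x)"
    and X: "(X has_derivative X') (at x)"
  shows "((\<lambda>x. T x (X x)) has_derivative (\<lambda>w. fder (\<lambda>y. T y (X x)) x w + T x (X' w))) (at x)"
proof -
  have "((\<lambda>x. \<Sum>b\<in>Basis. (X x \<bullet> b) *\<^sub>R T x b) has_derivative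
      (\<lambda>w. \<Sum>b\<in>Basis. (X x \<bullet> b) *\<^sub>R fder (\<lambda>x. T x b) x w + (X' w \<bullet> b) *\<^sub>R T x b)) (at x)"
    using assms(4) X by (intro has_derivative_sum has_derivative_scaleR has_derivative_fder has_derivative_inner_left)
  moreover have "(\<Sum>b\<in>Basis. (X x \<bullet> b) *\<^sub>R fder (\<lambda>x. T x b) x w + (X' w \<bullet> b) *\<^sub>R T x b)
      = fder (\<lambda>y. T y (X x)) x w + T x (X' w)" for w
    by (simp add: sum.distrib linear_basis_sum[OF fder_linear2[OF assms(1-4)], of "X x" w, symmetric]
        linear_basis_sum[OF assms(3)[OF assms(2)], of "X' w", symmetric])
  ultimately have "((\<lambda>x. \<Sum>b\<in>Basis. (X x \<bullet> b) *\<^sub>R T x b) has_derivative (\<lambda>w. fder (\<lambda>y. T y (X x)) x w + T x (X' w))) (at x)"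
    by simp
  then show ?thesis
    by (rule has_derivative_transform_within_open[OF _ assms(1,2)])
      (rule linear_basis_sum[OF assms(3), symmetric])
qed

subsection \<open>Fixed points of averaged contractions\<close>

text \<open>With \<open>K f = f\<close> fixed points of \<open>u = K (F \<circ> u)\<close> are implicit functions, with \<open>K\<close> the
  indefinite integral they are solutions of differential equations.\<close>

definition averaging :: "((real \<Rightarrow> 'f::euclidean_space) \<Rightarrow> real \<Rightarrow> 'f) \<Rightarrow> bool" where
  "averaging K \<longleftrightarrow>
     (\<forall>f. continuous_on {0..1} f \<longrightarrow> continuous_on {0..1} (K f)) \<and>
     (\<forall>f g. continuous_on {0..1} f \<longrightarrow> continuous_on {0..1} g \<longrightarrow>
        (\<forall>s\<in>{0..1}. K (\<lambda>r. f r + g r) s = K f s + K g s)) \<and>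
     (\<forall>f c. continuous_on {0..1} f \<longrightarrow> (\<forall>s\<in>{0..1}. K (\<lambda>r. c *\<^sub>R f r) s = c *\<^sub>R K f s)) \<and>
     (\<forall>f M. continuous_on {0..1} f \<longrightarrow> (\<forall>r\<in>{0..1}. norm (f r) \<le> M) \<longrightarrow>
        (\<forall>s\<in>{0..1}. norm (K f s) \<le> M))"

lemma averaging_ident: "averaging (\<lambda>f. f)"
  by (simp add: averaging_def)

lemma averaging_integral: "averaging (\<lambda>f s. integral {0..s} f)"
  unfolding averaging_def
proof (intro conjI allI impI ballI)
  fix f :: "real \<Rightarrow> 'a" assume f: "continuous_on {0..1} f"
  then show "continuous_on {0..1} (\<lambda>s. integral {0..s} f)"
    by (intro indefinite_integral_continuous_1 integrable_continuous_interval)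
  have *: "f integrable_on {0..s}" if "s \<in> {0..1}" for s
    using that by (intro integrable_continuous_interval continuous_on_subset[OF f]) auto
  show "integral {0..s} (\<lambda>r. c *\<^sub>R f r) = c *\<^sub>R integral {0..s} f" for s c
    by simp
  show "norm (integral {0..s} f) \<le> M" if M: "\<forall>r\<in>{0..1}. norm (f r) \<le> M" and s: "s \<in> {0..1}" for M s
  proof -
    have "norm (integral {0..s} f) \<le> M * (s - 0)"
      using s M by (intro integral_bound continuous_on_subset[OF f]) auto
    also have "\<dots> \<le> M * 1"
      using s order_trans[OF norm_ge_zero, of "f 0" M] M by (intro mult_left_mono) auto
    finally show ?thesis by simp
  qed
  fix g :: "real \<Rightarrow> 'a" assume g: "continuous_on {0..1} g"
  fix s :: real assume s: "s \<in> {0..1}"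
  have "g integrable_on {0..s}"
    using s by (intro integrable_continuous_interval continuous_on_subset[OF g]) auto
  with * s show "integral {0..s} (\<lambda>r. f r + g r) = integral {0..s} f + integral {0..s} g"
    by (intro integral_add) auto
qed

lemma averaging_continuous: "averaging K \<Longrightarrow> continuous_on {0..1} f \<Longrightarrow> continuous_on {0..1} (K f)"
  and averaging_add: "averaging K \<Longrightarrow> continuous_on {0..1} f \<Longrightarrow> continuous_on {0..1} g \<Longrightarrow> s \<in> {0..1} \<Longrightarrow>
    K (\<lambda>r. f r + g r) s = K f s + K g s"
  and averaging_scaleR: "averaging K \<Longrightarrow> continuous_on {0..1} f \<Longrightarrow> s \<in> {0..1} \<Longrightarrow>
    K (\<lambda>r. c *\<^sub>R f r) s = c *\<^sub>R K f s"
  and averaging_norm_le: "averaging K \<Longrightarrow> continuous_on {0..1} f \<Longrightarrow> (\<And>r. r \<in> {0..1} \<Longrightarrow> norm (f r) \<le> M) \<Longrightarrow>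
    s \<in> {0..1} \<Longrightarrow> norm (K f s) \<le> M"
  unfolding averaging_def by blast+

lemma averaging_diff:
  assumes "averaging K" "continuous_on {0..1} f" "continuous_on {0..1} g" "s \<in> {0..1}"
  shows "K (\<lambda>r. f r - g r) s = K f s - K g s"
proof -
  have "K (\<lambda>r. f r + (-1) *\<^sub>R g r) s = K f s + K (\<lambda>r. (-1) *\<^sub>R g r) s"
    using assms by (intro averaging_add) (auto intro!: continuous_intros)
  also have "K (\<lambda>r. (-1) *\<^sub>R g r) s = (-1) *\<^sub>R K g s"
    using assms by (intro averaging_scaleR)
  finally show ?thesis by simp
qed

lemma averaging_diff_le:
  assumes "averaging K" "continuous_on {0..1} f" "continuous_on {0..1} g" "s \<in> {0..1}"
    "\<And>r. r \<in> {0..1} \<Longrightarrow> norm (f r - g r) \<le> M"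
  shows "norm (K f s - K g s) \<le> M"
  using averaging_norm_le[OF assms(1), of "\<lambda>r. f r - g r" M s] averaging_diff[OF assms(1-4)] assms
  by (auto intro!: continuous_intros)

lemma averaging_cong:
  assumes "averaging K" "continuous_on {0..1} f" "s \<in> {0..1}" "\<And>r. r \<in> {0..1} \<Longrightarrow> f r = g r"
  shows "K f s = K g s"
proof -
  have "continuous_on {0..1} g" using assms(2,4) continuous_on_cong by metis
  from averaging_diff_le[OF assms(1,2) this assms(3), of 0] assms(4) show ?thesis by simp
qed

text \<open>The norm of \<open>e\<close> attains its maximum on the compact interval. Taking this
  maximum for \<open>M\<close> and evaluating there lets the term \<open>c * M\<close> be absorbed
  on the left. This plays the part of a Gronwall estimate.\<close>

lemma contraction_bound:
  fixes e :: "real \<Rightarrow> 'f::euclidean_space"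
  assumes "continuous_on {0..1} e" "c < 1"
    and "\<And>M s. (\<And>r. r \<in> {0..1} \<Longrightarrow> norm (e r) \<le> M) \<Longrightarrow> s \<in> {0..1} \<Longrightarrow> norm (e s) \<le> a + c * M"
    and "s \<in> {0..1}"
  shows "norm (e s) \<le> a / (1 - c)"
proof -
  have "continuous_on {0..1} (\<lambda>r. norm (e r))" using assms(1) by (intro continuous_intros)
  then obtain t where t: "t \<in> {0..1}" "\<And>r. r \<in> {0..1} \<Longrightarrow> norm (e r) \<le> norm (e t)"
    using continuous_attains_sup[of "{0..1::real}" "\<lambda>r. norm (e r)"] by auto
  have "norm (e t) \<le> a / (1 - c)"
    using assms(3)[OF t(2) t(1)] \<open>c < 1\<close> by (simp add: field_simps)
  with t(2)[OF assms(4)] show ?thesis by simp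
qed

text \<open>Since \<open>K\<close> does not increase uniform bounds, the constant 1/2 of
  \<open>G\<close> passes to the operator on curves, and Banach's theorem applies in the space of
  bounded continuous functions.\<close>

lemma averaging_fixed_point:
  fixes G :: "real \<Rightarrow> 'f::euclidean_space \<Rightarrow> 'f"
  assumes K: "averaging K" and G: "continuous_on ({0..1} \<times> UNIV) (\<lambda>(r, x). G r x)"
    and L: "\<And>r x y. r \<in> {0..1} \<Longrightarrow> norm (G r x - G r y) \<le> norm (x - y) / 2"
  obtains u where "continuous_on {0..1} u" "\<And>s. s \<in> {0..1} \<Longrightarrow> u s = K (\<lambda>r. G r (u r)) s"
proof -
  \<comment> \<open>Clamping the time to [0,1] extends curves on the interval to bounded continuous
    functions on the whole line, the space in which the contraction acts.\<close>
  define cl :: "real \<Rightarrow> real" where "cl = (\<lambda>s. max 0 (min 1 s))"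
  have cl: "cl s \<in> {0..1}" "s \<in> {0..1} \<Longrightarrow> cl s = s" for s by (auto simp: cl_def)
  have ccl: "continuous_on UNIV cl" unfolding cl_def by (intro continuous_intros)
  have cG: "continuous_on {0..1} (\<lambda>r. G r (v r))" if "continuous_on {0..1} v" for v
  proof -
    have "continuous_on {0..1} (\<lambda>r. (\<lambda>(r, x). G r x) (r, v r))"
      by (rule continuous_on_compose2[OF G]) (auto intro!: continuous_intros that)
    then show ?thesis by simp
  qed
  define T :: "(real \<Rightarrow>\<^sub>C 'f) \<Rightarrow> (real \<Rightarrow>\<^sub>C 'f)"
    where "T v = Bcontfun (\<lambda>s. K (\<lambda>r. G r (apply_bcontfun v r)) (cl s))" for v
  have T: "apply_bcontfun (T v) s = K (\<lambda>r. G r (apply_bcontfun v r)) (cl s)" for v s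
  proof -
    let ?f = "K (\<lambda>r. G r (apply_bcontfun v r))"
    have f: "continuous_on {0..1} ?f"
      by (rule averaging_continuous[OF K cG]) auto
    then have "continuous_on UNIV (\<lambda>s. ?f (cl s))"
      by (rule continuous_on_compose2[OF _ ccl]) (use cl in auto)
    moreover have "range (\<lambda>s. ?f (cl s)) \<subseteq> ?f ` {0..1}" using cl by auto
    then have "bounded (range (\<lambda>s. ?f (cl s)))"
      using compact_continuous_image[OF f] compact_imp_bounded bounded_subset by blast
    ultimately have "(\<lambda>s. ?f (cl s)) \<in> bcontfun" by (simp add: bcontfun_def)
    then show ?thesis unfolding T_def by (simp add: Bcontfun_inverse)
  qed
  have "dist (T v) (T w) \<le> 1/2 * dist v w" for v w
  proof (rule dist_bound)
    fix s
    have "norm (K (\<lambda>r. G r (apply_bcontfun v r)) (cl s) - K (\<lambda>r. G r (apply_bcontfun w r)) (cl s)) \<le> dist v w / 2"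
    proof (rule averaging_diff_le[OF K])
      fix r :: real assume "r \<in> {0..1}"
      then have "norm (G r (apply_bcontfun v r) - G r (apply_bcontfun w r)) \<le> dist (apply_bcontfun v r) (apply_bcontfun w r) / 2"
        using L by (simp add: dist_norm)
      also have "\<dots> \<le> dist v w / 2" using dist_bounded[of v r w] by simp
      finally show "norm (G r (apply_bcontfun v r) - G r (apply_bcontfun w r)) \<le> dist v w / 2" .
    qed (use cl in \<open>auto intro!: cG\<close>)
    then show "dist (apply_bcontfun (T v) s) (apply_bcontfun (T w) s) \<le> 1/2 * dist v w"
      by (simp add: T dist_norm)
  qed
  then obtain v where v: "T v = v"
    using banach_fix_type[of "1/2" T] by auto
  show ?thesis
  proof
    show "continuous_on {0..1} (apply_bcontfun v)" by auto
    show "apply_bcontfun v s = K (\<lambda>r. G r (apply_bcontfun v r)) s" if "s \<in> {0..1}" for s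
      using T[of v s] v cl(2)[OF that] by simp
  qed
qed

text \<open>Nearest-point projection onto the ball does not expand distances, so composing
  \<open>G\<close> with it gives a global contraction. The fixed point stays in the ball, because
  \<open>G\<close> maps into it and \<open>K\<close> keeps the bound, and there the projection is
  the identity.\<close>

lemma averaging_fixed_point_ball:
  fixes G :: "real \<Rightarrow> 'f::euclidean_space \<Rightarrow> 'f"
  assumes K: "averaging K" and G: "continuous_on ({0..1} \<times> cball 0 \<rho>) (\<lambda>(r, x). G r x)" and "\<rho> \<ge> 0"
    and L: "\<And>r x y. r \<in> {0..1} \<Longrightarrow> x \<in> cball 0 \<rho> \<Longrightarrow> y \<in> cball 0 \<rho> \<Longrightarrow> norm (G r x - G r y) \<le> norm (x - y) / 2"
    and B: "\<And>r x. r \<in> {0..1} \<Longrightarrow> x \<in> cball 0 \<rho> \<Longrightarrow> norm (G r x) \<le> \<rho>"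
  obtains u where "continuous_on {0..1} u" "\<And>s. s \<in> {0..1} \<Longrightarrow> u s = K (\<lambda>r. G r (u r)) s"
    "\<And>s. s \<in> {0..1} \<Longrightarrow> u s \<in> cball 0 \<rho>"
proof -
  define P where "P = closest_point (cball (0::'f) \<rho>)"
  have ne: "cball (0::'f) \<rho> \<noteq> {}" using \<open>\<rho> \<ge> 0\<close> by auto
  have P: "P x \<in> cball 0 \<rho>" "x \<in> cball 0 \<rho> \<Longrightarrow> P x = x" for x
    unfolding P_def using closest_point_in_set[OF closed_cball ne] closest_point_self by blast+
  have PL: "norm (P x - P y) \<le> norm (x - y)" for x y
    unfolding P_def using closest_point_lipschitz[OF convex_cball closed_cball ne, of x y] by (simp add: dist_norm)
  have Pc: "continuous_on UNIV P"
    unfolding P_def by (rule continuous_on_closest_point[OF convex_cball closed_cball ne])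
  have "continuous_on ({0..1} \<times> UNIV) (\<lambda>p. (\<lambda>(r, x). G r x) (fst p, P (snd p)))"
    by (rule continuous_on_compose2[OF G])
      (use P in \<open>auto intro!: continuous_intros continuous_on_compose2[OF Pc]\<close>)
  then have c: "continuous_on ({0..1} \<times> UNIV) (\<lambda>(r, x). G r (P x))" by (simp add: case_prod_beta)
  have "norm (G r (P x) - G r (P y)) \<le> norm (x - y) / 2" if "r \<in> {0..1}" for r x y
    using L[OF that P(1) P(1), of x y] PL[of x y] by simp
  then obtain u where u: "continuous_on {0..1} u" "\<And>s. s \<in> {0..1} \<Longrightarrow> u s = K (\<lambda>r. G r (P (u r))) s"
    using averaging_fixed_point[OF K c] by blast
  have "continuous_on {0..1} (\<lambda>r. (\<lambda>(r, x). G r (P x)) (r, u r))"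
    by (rule continuous_on_compose2[OF c]) (use u(1) in \<open>auto intro!: continuous_intros\<close>)
  then have cu: "continuous_on {0..1} (\<lambda>r. G r (P (u r)))" by simp
  have in_ball: "u s \<in> cball 0 \<rho>" if "s \<in> {0..1}" for s
    using averaging_norm_le[OF K cu _ that, of \<rho>] B P(1) u(2)[OF that] by simp
  show ?thesis
  proof
    show "u s = K (\<lambda>r. G r (u r)) s" if "s \<in> {0..1}" for s
      unfolding u(2)[OF that] using u(2) in_ball P(2) that by (intro averaging_cong[OF K cu]) auto
  qed (use u in_ball in auto)
qed


subsection \<open>Smooth dependence on parameters\<close>

text \<open>By compactness of [0,1] the derivatives of \<open>f s\<close> near \<open>x\<close> are
  close to those at \<open>x\<close> uniformly in \<open>s\<close>. The mean value inequality for
  \<open>f s\<close> minus its linear part at \<open>x\<close> turns this into a uniform remainder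
  estimate.\<close>

lemma uniform_derivative:
  fixes f :: "real \<Rightarrow> 'e::euclidean_space \<Rightarrow> 'b::real_normed_vector"
  assumes "open S" "x \<in> S" and f: "pCk (Suc 0) {0..1} S f" and "e > 0"
  obtains d where "d > 0" "ball x d \<subseteq> S"
    "\<forall>s\<in>{0..1}. \<forall>h. norm h < d \<longrightarrow> norm (f s (x + h) - f s x - fder (f s) x h) \<le> e * norm h"
proof -
  \<comment> \<open>A sum over basis vectors dominates the operator norm of the difference of
    derivatives and is visibly continuous in \<open>(y, s)\<close>.\<close>
  define \<psi> where "\<psi> = (\<lambda>(y, s). \<Sum>b\<in>Basis. norm (fder (f s) y b - fder (f s) x b))"
  have c: "continuous_on ({0..1} \<times> S) (\<lambda>(s, x). fder (f s) x b)" for b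
    using f by simp
  have c1: "continuous_on (S \<times> {0..1}) (\<lambda>p. fder (f (snd p)) (fst p) b)" for b
  proof -
    have "continuous_on (S \<times> {0..1}) (\<lambda>p. (\<lambda>(s, x). fder (f s) x b) (snd p, fst p))"
      by (rule continuous_on_compose2[OF c]) (auto intro!: continuous_intros)
    then show ?thesis by simp
  qed
  have c2: "continuous_on (S \<times> {0..1}) (\<lambda>p. fder (f (snd p)) x b)" for b
  proof -
    have "continuous_on (S \<times> {0..1}) (\<lambda>p. (\<lambda>(s, x). fder (f s) x b) (snd p, x))"
      by (rule continuous_on_compose2[OF c]) (use \<open>x \<in> S\<close> in \<open>auto intro!: continuous_intros\<close>)
    then show ?thesis by simp
  qed
  have "continuous_on (S \<times> {0..1}) \<psi>"
    unfolding \<psi>_def case_prod_beta by (intro continuous_intros c1 c2)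
  then obtain X where X: "x \<in> X" "open X" "\<forall>y\<in>X \<inter> S. \<forall>s\<in>{0..1}. dist (\<psi> (y, s)) (\<psi> (x, s)) \<le> e"
    using continuous_on_prod_compactE[OF _ compact_Icc \<open>x \<in> S\<close> \<open>e > 0\<close>] by blast
  then obtain d where d: "d > 0" "ball x d \<subseteq> X \<inter> S"
    using open_contains_ball[of "X \<inter> S"] \<open>open S\<close> \<open>x \<in> S\<close> by blast
  have "norm (f s (x + h) - f s x - fder (f s) x h) \<le> e * norm h" if s: "s \<in> {0..1}" and h: "norm h < d" for s h
  proof -
    have diff: "f s differentiable (at y)" if "y \<in> S" for y using f s that by simp
    have "norm ((\<lambda>y. f s y - fder (f s) x y) (x + h) - (\<lambda>y. f s y - fder (f s) x y) x) \<le> e * norm ((x + h) - x)"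
    proof (rule differentiable_bound[of "ball x d" _ "\<lambda>y v. fder (f s) y v - fder (f s) x v"])
      fix y assume y: "y \<in> ball x d"
      have lin: "linear (fder (f s) y)" "linear (fder (f s) x)"
        using d y \<open>x \<in> S\<close> by (auto intro!: linear_frechet_derivative diff)
      have "((\<lambda>y. f s y - fder (f s) x y) has_derivative (\<lambda>v. fder (f s) y v - fder (f s) x v)) (at y)"
        using d y lin(2)
        by (intro has_derivative_diff has_derivative_fder diff bounded_linear_imp_has_derivative)
          (auto simp: linear_conv_bounded_linear)
      then show "((\<lambda>y. f s y - fder (f s) x y) has_derivative (\<lambda>v. fder (f s) y v - fder (f s) x v)) (at y within ball x d)"
        by (rule has_derivative_at_withinI)
      show "onorm (\<lambda>v. fder (f s) y v - fder (f s) x v) \<le> e"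
      proof (rule onorm_le)
        fix v
        have "y \<in> X \<inter> S" using d y by blast
        then have "dist (\<psi> (y, s)) (\<psi> (x, s)) \<le> e" using X(3) s by blast
        moreover have "\<psi> (x, s) = 0" by (simp add: \<psi>_def)
        ultimately have \<psi>: "\<psi> (y, s) \<le> e" by (simp add: dist_real_def)
        have "fder (f s) y v - fder (f s) x v = (\<Sum>b\<in>Basis. (v \<bullet> b) *\<^sub>R (fder (f s) y b - fder (f s) x b))"
          by (simp add: linear_basis_sum[OF lin(1), of v] linear_basis_sum[OF lin(2), of v] sum_subtractf scaleR_diff_right)
        also have "norm \<dots> \<le> (\<Sum>b\<in>Basis. norm v * norm (fder (f s) y b - fder (f s) x b))"
          by (intro sum_norm_le) (auto intro!: mult_right_mono Basis_le_norm)
        also have "\<dots> = norm v * \<psi> (y, s)" by (simp add: \<psi>_def sum_distrib_left)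
        also have "\<dots> \<le> e * norm v" 
          using mult_left_mono[OF \<psi>, of "norm v"] by (simp add: mult.commute[of e "norm v"])
        finally show "norm (fder (f s) y v - fder (f s) x v) \<le> e * norm v" .
      qed
    qed (use d h in \<open>auto simp: dist_norm\<close>)
    moreover have "linear (fder (f s) x)" using \<open>x \<in> S\<close> by (intro linear_frechet_derivative diff)
    ultimately show ?thesis by (simp add: linear_add algebra_simps)
  qed
  with d show ?thesis using that by auto
qed

lemma continuous_on_prodI:
  fixes u :: "real \<Rightarrow> 'q::metric_space \<Rightarrow> 'f::metric_space"
  assumes "\<And>q. q \<in> B \<Longrightarrow> continuous_on I (\<lambda>s. u s q)"
    and "\<And>q e. q \<in> B \<Longrightarrow> e > 0 \<Longrightarrow> \<exists>X. open X \<and> q \<in> X \<and> (\<forall>q'\<in>X \<inter> B. \<forall>s\<in>I. dist (u s q') (u s q) \<le> e)"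
  shows "continuous_on (I \<times> B) (\<lambda>(s, q). u s q)"
  unfolding continuous_on_iff
proof (intro ballI allI impI)
  fix p and e :: real assume p: "p \<in> I \<times> B" and "e > 0"
  then obtain s q where sq: "p = (s, q)" "s \<in> I" "q \<in> B" by auto
  have e3: "e / 3 > 0" using \<open>e > 0\<close> by simp
  from assms(2)[OF sq(3) e3] obtain X where X: "open X" "q \<in> X" "\<And>q' s. q' \<in> X \<inter> B \<Longrightarrow> s \<in> I \<Longrightarrow> dist (u s q') (u s q) \<le> e / 3"
    by auto
  then obtain d1 where d1: "d1 > 0" "ball q d1 \<subseteq> X" using open_contains_ball by blast
  obtain d2 where d2: "d2 > 0" "\<And>s'. s' \<in> I \<Longrightarrow> dist s' s < d2 \<Longrightarrow> dist (u s' q) (u s q) < e / 3"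
    using assms(1)[OF sq(3)] sq(2) e3 unfolding continuous_on_iff by metis
  show "\<exists>d>0. \<forall>p'\<in>I \<times> B. dist p' p < d \<longrightarrow> dist (case p' of (s, q) \<Rightarrow> u s q) (case p of (s, q) \<Rightarrow> u s q) < e"
  proof (intro exI[of _ "min d1 d2"] conjI ballI impI)
    show "min d1 d2 > 0" using d1 d2 by simp
    fix p' assume p': "p' \<in> I \<times> B" "dist p' p < min d1 d2"
    then obtain s' q' where sq': "p' = (s', q')" "s' \<in> I" "q' \<in> B" by auto
    have "dist s' s < d2" "dist q' q < d1"
      using p'(2) dist_fst_le[of p' p] dist_snd_le[of p' p] by (auto simp: sq sq')
    then have "q' \<in> X" using d1(2) by (auto simp: dist_commute)
    then have "dist (u s' q') (u s' q) \<le> e / 3" "dist (u s' q) (u s q) < e / 3"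
      using X(3)[of q' s'] d2(2) \<open>dist s' s < d2\<close> sq' by auto
    then show "dist (case p' of (s, q) \<Rightarrow> u s q) (case p of (s, q) \<Rightarrow> u s q) < e"
      using dist_triangle[of "u s' q'" "u s q" "u s' q"] \<open>e > 0\<close> by (simp add: sq sq')
  qed
qed

text \<open>\<open>F\<close> may depend on the time \<open>r\<close> even though the flow equation
  and the implicit equation do not: the linearized equation has coefficients evaluated along the
  curve \<open>u r q\<close>, and it has to be an instance of the same locale.\<close>

locale averaged_fixed_point =
  fixes K :: "(real \<Rightarrow> 'f::euclidean_space) \<Rightarrow> real \<Rightarrow> 'f"
    and B :: "'q::euclidean_space set" and W :: "'f set"
    and F :: "real \<Rightarrow> 'q \<times> 'f \<Rightarrow> 'f" and u :: "real \<Rightarrow> 'q \<Rightarrow> 'f"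
  assumes K: "averaging K" and open_B: "open B" and open_W: "open W"
    and F_cont: "continuous_on ({0..1} \<times> (B \<times> W)) (\<lambda>(r, y). F r y)"
    and F_lip: "\<And>r q x y. r \<in> {0..1} \<Longrightarrow> q \<in> B \<Longrightarrow> x \<in> W \<Longrightarrow> y \<in> W \<Longrightarrow>
      norm (F r (q, x) - F r (q, y)) \<le> norm (x - y) / 2"
    and u_in: "\<And>r q. r \<in> {0..1} \<Longrightarrow> q \<in> B \<Longrightarrow> u r q \<in> W"
    and u_cont: "\<And>q. q \<in> B \<Longrightarrow> continuous_on {0..1} (\<lambda>r. u r q)"
    and u_eq: "\<And>s q. s \<in> {0..1} \<Longrightarrow> q \<in> B \<Longrightarrow> u s q = K (\<lambda>r. F r (q, u r q)) s"
begin

lemma F_curve_cont: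
  assumes "q \<in> B" "q' \<in> B"
  shows "continuous_on {0..1} (\<lambda>r. F r (q', u r q))"
proof -
  have "continuous_on {0..1} (\<lambda>r. (\<lambda>(r, y). F r y) (r, (q', u r q)))"
    by (rule continuous_on_compose2[OF F_cont]) (use assms u_in in \<open>auto intro!: continuous_intros u_cont\<close>)
  then show ?thesis by simp
qed

text \<open>Changing the parameter while the curve \<open>u r q\<close> is kept moves
  \<open>F\<close> by at most \<open>e / 2\<close>, uniformly in time by compactness. The
  contraction at most doubles this error.\<close>

lemma u_jointly_cont: "continuous_on ({0..1} \<times> B) (\<lambda>(s, q). u s q)"
proof (rule continuous_on_prodI)
  fix q and e :: real assume q: "q \<in> B" and "e > 0"
  have "continuous_on (B \<times> {0..1}) (\<lambda>p. (\<lambda>(r, y). F r y) (snd p, (fst p, u (snd p) q)))"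
    by (rule continuous_on_compose2[OF F_cont])
      (use q u_in in \<open>auto intro!: continuous_intros continuous_on_compose2[OF u_cont]\<close>)
  then have c: "continuous_on (B \<times> {0..1}) (\<lambda>p. F (snd p) (fst p, u (snd p) q))" by simp
  have "e / 2 > 0" using \<open>e > 0\<close> by simp
  then obtain X where X: "q \<in> X" "open X" and X': "\<forall>q'\<in>X \<inter> B. \<forall>r\<in>{0..1}.
      dist (F (snd (q', r)) (fst (q', r), u (snd (q', r)) q)) (F (snd (q, r)) (fst (q, r), u (snd (q, r)) q)) \<le> e / 2"
    by (rule continuous_on_prod_compactE[OF c compact_Icc q])
  have "dist (u s q') (u s q) \<le> e" if q': "q' \<in> X \<inter> B" and s: "s \<in> {0..1}" for q' s
  proof -
    have "norm (u s q' - u s q) \<le> (e / 2) / (1 - 1 / 2)"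
    proof (rule contraction_bound[where e = "\<lambda>s. u s q' - u s q", OF _ _ _ s])
      show "continuous_on {0..1} (\<lambda>s. u s q' - u s q)"
        using q q' by (intro continuous_intros u_cont) auto
      fix M s assume M: "\<And>r. r \<in> {0..1} \<Longrightarrow> norm (u r q' - u r q) \<le> M" and s: "s \<in> {0..1::real}"
      have "norm (K (\<lambda>r. F r (q', u r q')) s - K (\<lambda>r. F r (q, u r q)) s) \<le> e / 2 + 1 / 2 * M"
      proof (rule averaging_diff_le[OF K _ _ s])
        fix r :: real assume r: "r \<in> {0..1}"
        have "norm (F r (q', u r q') - F r (q', u r q)) \<le> norm (u r q' - u r q) / 2"
          using q q' r by (intro F_lip u_in) auto
        also have "\<dots> \<le> 1 / 2 * M" using M[OF r] by simp
        finally show "norm (F r (q', u r q') - F r (q, u r q)) \<le> e / 2 + 1 / 2 * M"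
          using X'[rule_format, OF q' r, simplified] norm_triangle_ineq[of "F r (q', u r q') - F r (q', u r q)" "F r (q', u r q) - F r (q, u r q)"]
          by (simp add: dist_norm)
      qed (use q q' in \<open>auto intro!: F_curve_cont\<close>)
      then show "norm (u s q' - u s q) \<le> e / 2 + 1 / 2 * M"
        using u_eq s q q' by auto
    qed simp
    then show ?thesis by (simp add: dist_norm)
  qed
  with X show "\<exists>X. open X \<and> q \<in> X \<and> (\<forall>q'\<in>X \<inter> B. \<forall>s\<in>{0..1}. dist (u s q') (u s q) \<le> e)" by blast
qed (rule u_cont)

end

text \<open>A Lipschitz estimate relative to the single point \<open>a\<close> bounds the derivative
  there. It hands the contraction constant of \<open>F\<close> down to its linearization.\<close>

lemma derivative_norm_le:
  fixes g :: "'a::real_normed_vector \<Rightarrow> 'b::real_normed_vector"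
  assumes g: "(g has_derivative g') (at a)" and X: "open X" "a \<in> X"
    and L: "\<And>y. y \<in> X \<Longrightarrow> norm (g y - g a) \<le> c * norm (y - a)"
  shows "norm (g' v) \<le> c * norm v"
proof (rule field_le_epsilon)
  fix e :: real assume "e > 0"
  define \<epsilon> where "\<epsilon> = e / (norm v + 1)"
  have v1: "norm v + 1 > 0" using norm_ge_zero[of v] by linarith
  have \<epsilon>: "\<epsilon> > 0" "\<epsilon> * norm v \<le> e"
    using \<open>e > 0\<close> v1 by (auto simp: \<epsilon>_def field_simps)
  from g \<epsilon>(1) obtain d where d: "d > 0" "\<And>y. norm (y - a) < d \<Longrightarrow> norm (g y - g a - g' (y - a)) \<le> \<epsilon> * norm (y - a)"
    unfolding has_derivative_at_alt by blast
  obtain d' where d': "d' > 0" "ball a d' \<subseteq> X" using X open_contains_ball by blast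
  \<comment> \<open>The scale brings \<open>t *\<^sub>R v\<close> into both neighbourhoods; adding 1
    to the norm keeps the quotient meaningful for \<open>v = 0\<close>.\<close>
  define t where "t = min d d' / (norm v + 1)"
  have t: "t > 0" using d(1) d'(1) v1 by (simp add: t_def)
  have "t * norm v < t * (norm v + 1)" using t by simp
  also have "\<dots> = min d d'" using v1 by (simp add: t_def)
  finally have tv: "norm (t *\<^sub>R v) < min d d'" using t by simp
  have "norm (g' (t *\<^sub>R v)) \<le> norm (g (a + t *\<^sub>R v) - g a - g' (t *\<^sub>R v)) + norm (g (a + t *\<^sub>R v) - g a)"
    using norm_triangle_ineq4[of "g (a + t *\<^sub>R v) - g a" "g (a + t *\<^sub>R v) - g a - g' (t *\<^sub>R v)"] by simp
  also have "\<dots> \<le> \<epsilon> * norm (t *\<^sub>R v) + c * norm (t *\<^sub>R v)"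
  proof (rule add_mono)
    show "norm (g (a + t *\<^sub>R v) - g a - g' (t *\<^sub>R v)) \<le> \<epsilon> * norm (t *\<^sub>R v)"
      using d(2)[of "a + t *\<^sub>R v"] tv by simp
    have "a + t *\<^sub>R v \<in> X" using d'(2) tv by (auto simp: dist_norm)
    from L[OF this] show "norm (g (a + t *\<^sub>R v) - g a) \<le> c * norm (t *\<^sub>R v)" by simp
  qed
  also have "g' (t *\<^sub>R v) = t *\<^sub>R g' v"
    using has_derivative_bounded_linear[OF g] by (simp add: linear_simps)
  finally have "t * norm (g' v) \<le> t * (\<epsilon> * norm v + c * norm v)"
    using t by (simp add: algebra_simps)
  then have "norm (g' v) \<le> \<epsilon> * norm v + c * norm v" using t by simp
  then show "norm (g' v) \<le> c * norm v + e" using \<epsilon>(2) by simp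
qed

section \<open>Differentiability of the fixed point in its parameter\<close>

context averaged_fixed_point
begin

abbreviation dF :: "'q \<Rightarrow> real \<Rightarrow> 'q \<times> 'f \<Rightarrow> 'f" where
  "dF q r \<equiv> fder (F r) (q, u r q)"

context
  assumes F1: "pCk (Suc 0) {0..1} (B \<times> W) F"
begin

lemma dF_linear: "r \<in> {0..1} \<Longrightarrow> q \<in> B \<Longrightarrow> linear (dF q r)"
  using F1 u_in by (intro linear_frechet_derivative) auto

lemma dF_has_derivative: "r \<in> {0..1} \<Longrightarrow> q \<in> B \<Longrightarrow> (F r has_derivative dF q r) (at (q, u r q))"
  using F1 u_in by (intro has_derivative_fder) auto

lemma fder_F_cont: "continuous_on ({0..1} \<times> (B \<times> W)) (\<lambda>(r, y). fder (F r) y b)"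
  using F1 unfolding pCk.simps by blast

lemma dF_cont:
  assumes q: "q \<in> B" and v: "continuous_on {0..1} v"
  shows "continuous_on {0..1} (\<lambda>r. dF q r (w, v r))"
proof -
  have "continuous_on {0..1} (\<lambda>r. (\<lambda>(r, y). fder (F r) y b) (r, (q, u r q)))" for b
    by (rule continuous_on_compose2[OF fder_F_cont])
      (use q u_in in \<open>auto intro!: continuous_intros u_cont\<close>)
  then have "continuous_on {0..1} (\<lambda>r. \<Sum>b\<in>Basis. ((w, v r) \<bullet> b) *\<^sub>R dF q r b)"
    by (intro continuous_intros v) simp
  moreover have "dF q r (w, v r) = (\<Sum>b\<in>Basis. ((w, v r) \<bullet> b) *\<^sub>R dF q r b)" if "r \<in> {0..1}" for r
    by (rule linear_basis_sum[OF dF_linear[OF that q]])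
  ultimately show ?thesis using continuous_on_cong by (metis (no_types, lifting))
qed

lemma dF_lip:
  assumes r: "r \<in> {0..1}" and q: "q \<in> B"
  shows "norm (dF q r (0, x)) \<le> norm x / 2"
proof -
  have "((\<lambda>x. F r (q, x)) has_derivative (\<lambda>v. dF q r (0, v))) (at (u r q))"
    by (rule has_derivative_compose[of "\<lambda>x. (q, x)", OF _ dF_has_derivative[OF r q]])
      (auto intro!: derivative_eq_intros)
  from derivative_norm_le[OF this open_W u_in[OF r q], of "1 / 2" x] F_lip[OF r q _ u_in[OF r q]]
  show ?thesis by simp
qed

text \<open>The difference of two solutions satisfies the homogeneous equation, a contraction with
  no inhomogeneous term, so its maximum is at most half of itself.\<close>

lemma linearized_unique:
  assumes q: "q \<in> B" and z: "continuous_on {0..1} z" and z': "continuous_on {0..1} z'"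
    and "\<And>s. s \<in> {0..1} \<Longrightarrow> z s - z' s = K (\<lambda>r. dF q r (0, z r - z' r)) s" and "s \<in> {0..1}"
  shows "z s = z' s"
proof -
  have c: "continuous_on {0..1} (\<lambda>r. z r - z' r)" by (intro continuous_intros z z')
  have "norm (z s - z' s) \<le> 0 / (1 - 1 / 2)"
  proof (rule contraction_bound[OF c _ _ assms(5)])
    fix M s assume M: "\<And>r. r \<in> {0..1} \<Longrightarrow> norm (z r - z' r) \<le> M" and s: "s \<in> {0..1::real}"
    have "norm (K (\<lambda>r. dF q r (0, z r - z' r)) s) \<le> 1 / 2 * M"
    proof (rule averaging_norm_le[OF K dF_cont[OF q c] _ s])
      fix r :: real assume r: "r \<in> {0..1}"
      show "norm (dF q r (0, z r - z' r)) \<le> 1 / 2 * M"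
        using dF_lip[OF r q, of "z r - z' r"] M[OF r] by simp
    qed
    then show "norm (z s - z' s) \<le> 0 + 1 / 2 * M" using assms(4)[OF s] by simp
  qed simp
  then show ?thesis by simp
qed

text \<open>The linearized right-hand side is affine in \<open>x\<close>, defined everywhere and a
  contraction with constant 1/2, so no ball has to be preserved.\<close>

lemma linearized_exists:
  assumes q: "q \<in> B"
  obtains z where "continuous_on {0..1} z" "\<And>s. s \<in> {0..1} \<Longrightarrow> z s = K (\<lambda>r. dF q r (w, z r)) s"
proof (rule averaging_fixed_point[OF K, of "\<lambda>r x. dF q r (w, x)"])
  have "continuous_on ({0..1} \<times> UNIV) (\<lambda>p. (\<lambda>(r, y). fder (F r) y b) (fst p, (q, u (fst p) q)))" for b
    by (rule continuous_on_compose2[OF fder_F_cont])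
      (use q u_in in \<open>auto intro!: continuous_intros continuous_on_compose2[OF u_cont]\<close>)
  then have "continuous_on ({0..1} \<times> UNIV) (\<lambda>p. \<Sum>b\<in>Basis. ((w, snd p) \<bullet> b) *\<^sub>R dF q (fst p) b)"
    by (intro continuous_intros) simp
  moreover have "(case p of (r, x) \<Rightarrow> dF q r (w, x)) = (\<Sum>b\<in>Basis. ((w, snd p) \<bullet> b) *\<^sub>R dF q (fst p) b)"
    if "p \<in> {0..1} \<times> UNIV" for p
    using linear_basis_sum[OF dF_linear[OF _ q], of "fst p"] that by (auto simp: case_prod_beta)
  ultimately show "continuous_on ({0..1} \<times> UNIV) (\<lambda>(r, x). dF q r (w, x))"
    using continuous_on_cong by (metis (no_types, lifting))
  fix r x y assume r: "r \<in> {0..1::real}"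
  show "norm (dF q r (w, x) - dF q r (w, y)) \<le> norm (x - y) / 2"
    using dF_lip[OF r q, of "x - y"] linear_diff[OF dF_linear[OF r q], of "(w, x)" "(w, y)"] by simp
qed (rule that)

text \<open>The error \<open>u r q' - u r q - z h r\<close> solves the linearized homogeneous
  equation up to the first-order remainder of \<open>F\<close>. That remainder is small compared
  with the displacement, so absorption bounds the error by a small multiple of
  \<open>norm h\<close>.\<close>

lemma has_derivative_u:
  assumes q: "q \<in> B" and zc: "\<And>w. continuous_on {0..1} (z w)"
    and z: "\<And>w s. s \<in> {0..1} \<Longrightarrow> z w s = K (\<lambda>r. dF q r (w, z w r)) s"
    and s: "s \<in> {0..1}"
  shows "(u s has_derivative (\<lambda>w. z w s)) (at q)"
proof -
  \<comment> \<open>Sums and multiples of solutions solve the equation for the corresponding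
    direction, so uniqueness makes the solution linear in \<open>w\<close>.\<close>
  have lin: "linear (\<lambda>w. z w s)" if s: "s \<in> {0..1}" for s
  proof
    fix v w and c :: real
    show "z (v + w) s = z v s + z w s"
    proof (rule linearized_unique[OF q zc _ _ s])
      fix s :: real assume s: "s \<in> {0..1}"
      have "z (v + w) s - (z v s + z w s) = K (\<lambda>r. dF q r (v + w, z (v + w) r) - (dF q r (v, z v r) + dF q r (w, z w r))) s"
        using z[OF s] by (simp add: averaging_diff[OF K _ _ s] averaging_add[OF K _ _ s] dF_cont[OF q] zc continuous_on_add)
      also have "\<dots> = K (\<lambda>r. dF q r (0, z (v + w) r - (z v r + z w r))) s"
      proof (rule averaging_cong[OF K _ s])
        fix r :: real assume "r \<in> {0..1}"
        from dF_linear[OF this q] show "dF q r (v + w, z (v + w) r) - (dF q r (v, z v r) + dF q r (w, z w r))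
          = dF q r (0, z (v + w) r - (z v r + z w r))"
          by (simp flip: linear_diff linear_add)
      qed (intro continuous_intros dF_cont[OF q] zc)
      finally show "z (v + w) s - (z v s + z w s) = K (\<lambda>r. dF q r (0, z (v + w) r - (z v r + z w r))) s" .
    qed (intro continuous_intros zc)
    show "z (c *\<^sub>R v) s = c *\<^sub>R z v s"
    proof (rule linearized_unique[OF q zc _ _ s])
      fix s :: real assume s: "s \<in> {0..1}"
      have "z (c *\<^sub>R v) s - c *\<^sub>R z v s = K (\<lambda>r. dF q r (c *\<^sub>R v, z (c *\<^sub>R v) r) - c *\<^sub>R dF q r (v, z v r)) s"
        using z[OF s] by (simp add: averaging_diff[OF K _ _ s] averaging_scaleR[OF K _ s] dF_cont[OF q] zc continuous_on_scaleR)
      also have "\<dots> = K (\<lambda>r. dF q r (0, z (c *\<^sub>R v) r - c *\<^sub>R z v r)) s"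
      proof (rule averaging_cong[OF K _ s])
        fix r :: real assume "r \<in> {0..1}"
        from dF_linear[OF this q] show "dF q r (c *\<^sub>R v, z (c *\<^sub>R v) r) - c *\<^sub>R dF q r (v, z v r)
          = dF q r (0, z (c *\<^sub>R v) r - c *\<^sub>R z v r)"
          by (simp flip: linear_diff linear_scale)
      qed (intro continuous_intros dF_cont[OF q] zc)
      finally show "z (c *\<^sub>R v) s - c *\<^sub>R z v s = K (\<lambda>r. dF q r (0, z (c *\<^sub>R v) r - c *\<^sub>R z v r)) s" .
    qed (intro continuous_intros zc)
  qed
  \<comment> \<open>The derivative splits as \<open>dF q r (w, 0) + dF q r (0, z w r)\<close>.
    Compactness bounds the first part uniformly in time, the second is at most half of
    \<open>z\<close>; absorption doubles the constant.\<close>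
  obtain C where C: "C \<ge> 0" "\<And>w s. s \<in> {0..1} \<Longrightarrow> norm (z w s) \<le> C * norm w"
  proof -
    have "continuous_on {0..1} (\<lambda>r. \<Sum>b\<in>Basis. norm (dF q r (b, 0)))"
      by (intro continuous_intros dF_cont[OF q])
    then have "bounded ((\<lambda>r. \<Sum>b\<in>Basis. norm (dF q r (b, 0))) ` {0..1})"
      using compact_continuous_image compact_imp_bounded by blast
    then obtain C where C: "\<And>r. r \<in> {0..1} \<Longrightarrow> norm (\<Sum>b\<in>Basis. norm (dF q r (b, 0))) \<le> C"
      unfolding bounded_iff by blast
    have Cb: "norm (dF q r (w, 0)) \<le> C * norm w" if r: "r \<in> {0..1}" for r w
    proof -
      have "linear (\<lambda>w. dF q r (w, 0))"
      proof
        show "dF q r (v + w, 0) = dF q r (v, 0) + dF q r (w, 0)" for v w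
          using linear_add[OF dF_linear[OF r q], of "(v, 0)" "(w, 0)"] by simp
        show "dF q r (c *\<^sub>R v, 0) = c *\<^sub>R dF q r (v, 0)" for c v
          using linear_scale[OF dF_linear[OF r q], of c "(v, 0)"] by simp
      qed
      then have "norm (dF q r (w, 0)) = norm (\<Sum>b\<in>Basis. (w \<bullet> b) *\<^sub>R dF q r (b, 0))"
        by (subst linear_basis_sum) auto
      also have "\<dots> \<le> (\<Sum>b\<in>Basis. norm w * norm (dF q r (b, 0)))"
        by (intro sum_norm_le) (auto intro!: mult_right_mono Basis_le_norm)
      also have "\<dots> = norm w * (\<Sum>b\<in>Basis. norm (dF q r (b, 0)))" by (simp add: sum_distrib_left)
      also have "\<dots> \<le> norm w * C" using C[OF r] by (intro mult_left_mono) auto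
      finally show ?thesis by (simp add: mult.commute)
    qed
    have "C \<ge> 0" using order_trans[OF norm_ge_zero C[of 0]] by simp
    have *: "norm (z w s) \<le> (C * norm w) / (1 - 1 / 2)" if s: "s \<in> {0..1}" for w s
    proof (rule contraction_bound[OF zc _ _ s])
      fix M s assume M: "\<And>r. r \<in> {0..1} \<Longrightarrow> norm (z w r) \<le> M" and s: "s \<in> {0..1::real}"
      have "norm (K (\<lambda>r. dF q r (w, z w r)) s) \<le> C * norm w + 1 / 2 * M"
      proof (rule averaging_norm_le[OF K dF_cont[OF q zc] _ s])
        fix r :: real assume r: "r \<in> {0..1}"
        have "dF q r (w, z w r) = dF q r (w, 0) + dF q r (0, z w r)"
          using linear_add[OF dF_linear[OF r q], of "(w, 0)" "(0, z w r)"] by simp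
        then have "norm (dF q r (w, z w r)) \<le> norm (dF q r (w, 0)) + norm (dF q r (0, z w r))"
          using norm_triangle_ineq by metis
        then show "norm (dF q r (w, z w r)) \<le> C * norm w + 1 / 2 * M"
          using Cb[OF r, of w] dF_lip[OF r q, of "z w r"] M[OF r] by simp
      qed
      then show "norm (z w s) \<le> C * norm w + 1 / 2 * M" using z[OF s] by simp
    qed simp
    have "norm (z w s) \<le> (2 * C) * norm w" if "s \<in> {0..1}" for w s
      using *[OF that, of w] by simp
    with \<open>C \<ge> 0\<close> show ?thesis by (intro that[of "2 * C"]) auto
  qed
  show ?thesis
    unfolding has_derivative_at_alt
  proof (intro conjI allI impI)
    show "bounded_linear (\<lambda>w. z w s)" using lin[OF s] by (simp add: linear_conv_bounded_linear)
    fix e :: real assume "e > 0"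
    \<comment> \<open>The bound 1/4 raises the contraction constant from 1/2 to no more than 3/4.
      Absorption then costs a factor 4, which the second entry compensates.\<close>
    define \<epsilon> where "\<epsilon> = min (1 / 4) (e / (4 * (1 + C)))"
    have \<epsilon>: "\<epsilon> > 0" "\<epsilon> \<le> 1 / 4" "4 * (\<epsilon> * (1 + C)) \<le> e"
    proof -
      have "\<epsilon> \<le> e / (4 * (1 + C))" by (simp add: \<epsilon>_def)
      then have "\<epsilon> * (4 * (1 + C)) \<le> e" using C(1) by (subst (asm) pos_le_divide_eq) auto
      then show "4 * (\<epsilon> * (1 + C)) \<le> e" by (simp add: algebra_simps)
      show "\<epsilon> \<le> 1 / 4" unfolding \<epsilon>_def by (rule min.cobounded1)
    qed (use \<open>e > 0\<close> C(1) in \<open>auto simp: \<epsilon>_def\<close>)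
    have "compact ((\<lambda>r. (q, u r q)) ` {0..1})"
      using u_cont[OF q] by (intro compact_continuous_image continuous_intros) auto
    moreover have "(\<lambda>r. (q, u r q)) ` {0..1} \<subseteq> B \<times> W" using q u_in by auto
    ultimately obtain \<delta> where \<delta>: "\<delta> > 0" "(\<Union>x\<in>(\<lambda>r. (q, u r q)) ` {0..1}. ball x \<delta>) \<subseteq> B \<times> W"
      using compact_subset_open_imp_ball_epsilon_subset open_Times[OF open_B open_W] by metis
    \<comment> \<open>Translation along the curve moves the varying base points
      \<open>(q, u r q)\<close> to the common point 0, where the uniform remainder estimate
      applies.\<close>
    define f where "f = (\<lambda>r y. F r ((q, u r q) + y))"
    have in_BW: "(q, u r q) + y \<in> B \<times> W" if "r \<in> {0..1}" "y \<in> ball 0 \<delta>" for r y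
    proof -
      have "(q, u r q) + y \<in> ball (q, u r q) \<delta>" using that(2) by (simp add: dist_norm)
      then show ?thesis using \<delta>(2) that(1) by blast
    qed
    have f: "pCk (Suc 0) {0..1} (ball 0 \<delta>) f"
      unfolding f_def
    proof (rule pCk_compose[OF _ _ F1])
      show "pCk (Suc 0) {0..1} (ball 0 \<delta>) (\<lambda>s x. (q, u s q) + x)"
        by (intro pCk_add pCk_const_vec pCk_id) (auto intro!: continuous_intros u_cont q)
    qed (use in_BW open_Times[OF open_B open_W] in auto)
    have df: "fder (f r) 0 = dF q r" if r: "r \<in> {0..1}" for r
    proof (rule fder_eqI)
      have "((\<lambda>y. (q, u r q) + y) has_derivative (\<lambda>y. y)) (at 0)"
        by (auto intro!: derivative_eq_intros)
      moreover have "(F r has_derivative dF q r) (at ((q, u r q) + 0))"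
        using dF_has_derivative[OF r q] by simp
      ultimately show "(f r has_derivative dF q r) (at 0)"
        unfolding f_def by (rule has_derivative_compose)
    qed
    have z0: "(0 :: 'q \<times> 'f) \<in> ball 0 \<delta>" using \<delta>(1) by simp
    obtain d where d: "d > 0" "ball 0 d \<subseteq> ball (0::'q \<times> 'f) \<delta>"
      "\<forall>s\<in>{0..1}. \<forall>h. norm h < d \<longrightarrow> norm (f s (0 + h) - f s 0 - fder (f s) 0 h) \<le> \<epsilon> * norm h"
      by (rule uniform_derivative[OF open_ball z0 f \<epsilon>(1)])
    have dR: "norm (F r ((q, u r q) + h) - F r (q, u r q) - dF q r h) \<le> \<epsilon> * norm h"
      if "r \<in> {0..1}" "norm h < d" for r h
      using d(3)[rule_format, OF that] df[OF that(1)] by (simp add: f_def)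
    have "continuous_on (B \<times> {0..1}) (\<lambda>p. (\<lambda>(s, q). u s q) (snd p, fst p))"
      by (rule continuous_on_compose2[OF u_jointly_cont]) (auto intro!: continuous_intros)
    then have c: "continuous_on (B \<times> {0..1}) (\<lambda>p. u (snd p) (fst p))" by simp
    have "d / 2 > 0" using d(1) by simp
    then obtain X where X: "q \<in> X" "open X" and X': "\<forall>q'\<in>X \<inter> B. \<forall>r\<in>{0..1}.
      dist (u (snd (q', r)) (fst (q', r))) (u (snd (q, r)) (fst (q, r))) \<le> d / 2"
      by (rule continuous_on_prod_compactE[OF c compact_Icc q])
    obtain d' where d': "d' > 0" "ball q d' \<subseteq> X \<inter> B"
      using open_contains_ball[of "X \<inter> B"] X q open_B by blast
    show "\<exists>d>0. \<forall>y. norm (y - q) < d \<longrightarrow> norm (u s y - u s q - z (y - q) s) \<le> e * norm (y - q)"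
    proof (intro exI[of _ "min (d / 2) d'"] conjI allI impI)
      show "min (d / 2) d' > 0" using d d' by simp
      fix q' assume q': "norm (q' - q) < min (d / 2) d'"
      then have q'X: "q' \<in> X \<inter> B" using d'(2) by (auto simp: dist_norm norm_minus_commute)
      then have q'B: "q' \<in> B" by simp
      define h where "h = q' - q"
      define E where "E = (\<lambda>r. u r q' - u r q - z h r)"
      have Ec: "continuous_on {0..1} E"
        unfolding E_def by (intro continuous_intros u_cont q q'B zc)
      have "norm (E s) \<le> (\<epsilon> * (1 + C) * norm h) / (1 - 3 / 4)"
      proof (rule contraction_bound[OF Ec _ _ s])
        fix M s assume M: "\<And>r. r \<in> {0..1} \<Longrightarrow> norm (E r) \<le> M" and s: "s \<in> {0..1::real}"
        have "norm (K (\<lambda>r. F r (q', u r q') - F r (q, u r q) - dF q r (h, z h r)) s) \<le> \<epsilon> * (1 + C) * norm h + 3 / 4 * M"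
        proof (rule averaging_norm_le[OF K _ _ s])
          show "continuous_on {0..1} (\<lambda>r. F r (q', u r q') - F r (q, u r q) - dF q r (h, z h r))"
            by (intro continuous_intros F_curve_cont q q'B dF_cont zc)
          fix r :: real assume r: "r \<in> {0..1}"
          define y where "y = (h, u r q' - u r q)"
          have "dist (u r q') (u r q) \<le> d / 2" using X' q'X r by fastforce
          moreover have "norm h < d / 2" using q' by (simp add: h_def)
          ultimately have "norm y < d"
            using norm_Pair_le[of h "u r q' - u r q"] by (simp add: y_def dist_norm)
          then have 1: "norm (F r ((q, u r q) + y) - F r (q, u r q) - dF q r y) \<le> \<epsilon> * norm y"
            by (rule dR[OF r])
          have 2: "(q, u r q) + y = (q', u r q')" by (simp add: y_def h_def)
          have 3: "dF q r y - dF q r (h, z h r) = dF q r (0, E r)"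
            using dF_linear[OF r q] by (simp add: y_def E_def flip: linear_diff)
          have "norm (u r q' - u r q) \<le> norm (E r) + norm (z h r)"
            using norm_triangle_ineq[of "E r" "z h r"] by (simp add: E_def)
          also have "\<dots> \<le> M + C * norm h" using M[OF r] C(2)[OF r, of h] by simp
          finally have "norm y \<le> norm h + (M + C * norm h)"
            using norm_Pair_le[of h "u r q' - u r q"] by (simp add: y_def)
          then have "\<epsilon> * norm y \<le> \<epsilon> * (norm h + (M + C * norm h))" using \<epsilon>(1) by (intro mult_left_mono) auto
          also have "\<dots> = \<epsilon> * (1 + C) * norm h + \<epsilon> * M" by (simp add: algebra_simps)
          also have "\<epsilon> * M \<le> 1 / 4 * M"
            using \<epsilon>(2) order_trans[OF norm_ge_zero M[OF r]] by (intro mult_right_mono) auto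
          finally have 4: "\<epsilon> * norm y \<le> \<epsilon> * (1 + C) * norm h + 1 / 4 * M" by simp
          have 5: "F r (q', u r q') - F r (q, u r q) - dF q r (h, z h r)
              = (F r ((q, u r q) + y) - F r (q, u r q) - dF q r y) + dF q r (0, E r)"
            unfolding 2 using 3 by (simp add: algebra_simps)
          have "norm (F r (q', u r q') - F r (q, u r q) - dF q r (h, z h r)) \<le> \<epsilon> * norm y + norm (E r) / 2"
            unfolding 5 using 1 dF_lip[OF r q, of "E r"]
              norm_triangle_ineq[of "F r ((q, u r q) + y) - F r (q, u r q) - dF q r y" "dF q r (0, E r)"]
            by linarith
          then show "norm (F r (q', u r q') - F r (q, u r q) - dF q r (h, z h r)) \<le> \<epsilon> * (1 + C) * norm h + 3 / 4 * M"
            using 4 M[OF r] by simp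
        qed
        moreover have "E s = K (\<lambda>r. F r (q', u r q') - F r (q, u r q) - dF q r (h, z h r)) s"
          unfolding E_def using s q q'B
          by (simp add: averaging_diff[OF K _ _ s] F_curve_cont dF_cont zc continuous_on_diff u_eq[symmetric] z[OF s, symmetric])
        ultimately show "norm (E s) \<le> \<epsilon> * (1 + C) * norm h + 3 / 4 * M" by simp
      qed simp
      also have "\<dots> = (4 * (\<epsilon> * (1 + C))) * norm h" by simp
      also have "\<dots> \<le> e * norm h" using \<epsilon>(3) by (intro mult_right_mono) auto
      finally show "norm (u s q' - u s q - z (q' - q) s) \<le> e * norm (q' - q)"
        by (simp add: E_def h_def)
    qed
  qed
qed

text \<open>Solving the linearized equation in every direction supplies the derivative, so
  \<open>fder (u s) q w\<close> itself obeys that equation as a curve in \<open>s\<close>.\<close>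

lemma fder_u_eq:
  assumes q: "q \<in> B"
  shows "continuous_on {0..1} (\<lambda>s. fder (u s) q w)"
    and "s \<in> {0..1} \<Longrightarrow> fder (u s) q w = K (\<lambda>r. dF q r (w, fder (u r) q w)) s"
    and "s \<in> {0..1} \<Longrightarrow> u s differentiable (at q)"
proof -
  have "\<exists>z. continuous_on {0..1} z \<and> (\<forall>s\<in>{0..1}. z s = K (\<lambda>r. dF q r (w, z r)) s)" for w
    by (rule linearized_exists[OF q, of w]) blast
  then have "\<exists>z. \<forall>w. continuous_on {0..1} (z w) \<and> (\<forall>s\<in>{0..1}. z w s = K (\<lambda>r. dF q r (w, z w r)) s)"
    by (intro choice) blast
  then obtain z where zc: "\<And>w. continuous_on {0..1} (z w)"
    and z: "\<And>w s. s \<in> {0..1} \<Longrightarrow> z w s = K (\<lambda>r. dF q r (w, z w r)) s"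
    by blast
  have d: "(u s has_derivative (\<lambda>w. z w s)) (at q)" if "s \<in> {0..1}" for s
    using has_derivative_u[OF q zc z that] .
  then have eq: "fder (u s) q w = z w s" if "s \<in> {0..1}" for s w
    using fder_eqI[OF d[OF that]] by simp
  show "continuous_on {0..1} (\<lambda>s. fder (u s) q w)"
    by (rule continuous_on_cong[THEN iffD1, OF refl _ zc[of w]]) (simp add: eq)
  show "u s differentiable (at q)" if "s \<in> {0..1}" using d[OF that] by (rule differentiableI)
  show "fder (u s) q w = K (\<lambda>r. dF q r (w, fder (u r) q w)) s" if s: "s \<in> {0..1}"
    unfolding eq[OF s] z[OF s, of w] by (rule averaging_cong[OF K dF_cont[OF q zc] s]) (simp add: eq)
qed

end

text \<open>A directional derivative of \<open>u\<close> is again an averaged fixed point with values in \<open>'f\<close>. Since the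
  target space does not grow, the order of smoothness can be raised by induction.\<close>

lemma linearized_fixed_point:
  assumes F1: "pCk (Suc 0) {0..1} (B \<times> W) F" and u1: "pCk k {0..1} B u" and F: "pCk (Suc k) {0..1} (B \<times> W) F"
  shows "averaged_fixed_point K B UNIV (\<lambda>r p. fder (F r) (fst p, u r (fst p)) (w, snd p)) (\<lambda>s q. fder (u s) q w)"
    and "pCk k {0..1} (B \<times> UNIV) (\<lambda>r p. fder (F r) (fst p, u r (fst p)) (w, snd p))"
proof -
  let ?F = "\<lambda>r p. fder (F r) (fst p, u r (fst p)) (w, snd p)"
  have o: "open (B \<times> (UNIV :: 'f set))" by (simp add: open_Times open_B)
  have fst: "pCk k {0..1} (B \<times> (UNIV :: 'f set)) (\<lambda>_. fst)"
    by (rule pCk_bounded_linear[OF bounded_linear_fst o pCk_id[OF o]])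
  have snd: "pCk k {0..1} (B \<times> (UNIV :: 'f set)) (\<lambda>_. snd)"
    by (rule pCk_bounded_linear[OF bounded_linear_snd o pCk_id[OF o]])
  have ufst: "pCk k {0..1} (B \<times> (UNIV :: 'f set)) (\<lambda>r p. u r (fst p))"
    by (rule pCk_compose[OF o open_B u1 fst]) auto
  have dF: "pCk k {0..1} (B \<times> (UNIV :: 'f set)) (\<lambda>r p. fder (F r) (fst p, u r (fst p)) b)" for b
  proof (rule pCk_compose[where f = "\<lambda>r y. fder (F r) y b" and y = "\<lambda>r p. (fst p, u r (fst p))", OF o open_Times[OF open_B open_W]])
    show "pCk k {0..1} (B \<times> W) (\<lambda>r y. fder (F r) y b)" using F unfolding pCk.simps by blast
    show "pCk k {0..1} (B \<times> (UNIV :: 'f set)) (\<lambda>r p. (fst p, u r (fst p)))" by (rule pCk_Pair[OF o fst ufst])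
  qed (use u_in in auto)
  show F': "pCk k {0..1} (B \<times> UNIV) ?F"
  proof (rule pCk_cong[OF o])
    show "pCk k {0..1} (B \<times> UNIV) (\<lambda>r p. \<Sum>b\<in>Basis. ((w, snd p) \<bullet> b) *\<^sub>R fder (F r) (fst p, u r (fst p)) b)"
      by (intro pCk_sum[OF o] pCk_scaleR[OF o] pCk_bounded_linear[OF bounded_linear_inner_left o] 
          pCk_Pair[OF o pCk_const[OF o] snd] dF)
    fix r :: real and p :: "'q \<times> 'f" assume "r \<in> {0..1}" "p \<in> B \<times> UNIV"
    then show "(\<Sum>b\<in>Basis. ((w, snd p) \<bullet> b) *\<^sub>R fder (F r) (fst p, u r (fst p)) b) = ?F r p"
      by (intro linear_basis_sum[symmetric] dF_linear[OF F1]) auto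
  qed
  show "averaged_fixed_point K B UNIV ?F (\<lambda>s q. fder (u s) q w)"
  proof
    show "continuous_on ({0..1} \<times> (B \<times> UNIV)) (\<lambda>(r, y). ?F r y)"
      by (rule pCk_continuous[OF F'])
    fix r q x y assume r: "r \<in> {0..1::real}" and q: "q \<in> B"
    show "norm (?F r (q, x) - ?F r (q, y)) \<le> norm (x - y) / 2"
      using dF_lip[OF F1 r q, of "x - y"] linear_diff[OF dF_linear[OF F1 r q], of "(w, x)" "(w, y)"] by simp
  qed (use K open_B fder_u_eq[OF F1] in auto)
qed

end

text \<open>The induction hypothesis is used twice. For \<open>u\<close> itself it gives order k, so
  that the linearized right-hand side has order k; for the linearized equation it then gives order k
  of every directional derivative. \<open>W\<close>, \<open>F\<close> and \<open>u\<close> must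
  therefore be generalized.\<close>

theorem averaged_fixed_point_pCk:
  assumes "averaged_fixed_point K B W F u" "pCk k {0..1} (B \<times> W) F"
  shows "pCk k {0..1} B u"
  using assms
proof (induction k arbitrary: W F u)
  case 0
  then interpret averaged_fixed_point K B W F u by simp
  show ?case using u_jointly_cont by simp
next
  case (Suc k)
  interpret averaged_fixed_point K B W F u by fact
  have F1: "pCk (Suc 0) {0..1} (B \<times> W) F" by (rule pCk_le[OF _ Suc.prems(2)]) simp
  have u1: "pCk k {0..1} B u" by (rule Suc.IH[OF Suc.prems(1) pCk_SucD[OF Suc.prems(2)]])
  have "pCk k {0..1} B (\<lambda>s q. fder (u s) q w)" for w
    by (rule Suc.IH[OF linearized_fixed_point[OF F1 u1 Suc.prems(2)]])
  then show ?case using u_jointly_cont fder_u_eq(3)[OF F1] by simp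
qed

text \<open>A guess for the variation of \<open>u\<close> in one direction is confirmed by checking
  the linearized equation. The variation of the flow along the frame is computed in this
  way.\<close>

lemma (in averaged_fixed_point) fder_u_unique:
  assumes F1: "pCk (Suc 0) {0..1} (B \<times> W) F" and q: "q \<in> B" and zc: "continuous_on {0..1} z"
    and z: "\<And>s. s \<in> {0..1} \<Longrightarrow> z s = K (\<lambda>r. dF q r (w, z r)) s" and s: "s \<in> {0..1}"
  shows "fder (u s) q w = z s"
proof (rule linearized_unique[OF F1 q fder_u_eq(1)[OF F1 q] zc _ s])
  fix s :: real assume s: "s \<in> {0..1}"
  have "fder (u s) q w - z s = K (\<lambda>r. dF q r (w, fder (u r) q w) - dF q r (w, z r)) s"
    by (simp add: averaging_diff[OF K _ _ s] dF_cont[OF F1 q] fder_u_eq(1)[OF F1 q] zc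
        fder_u_eq(2)[OF F1 q s, symmetric] z[OF s, symmetric])
  also have "\<dots> = K (\<lambda>r. dF q r (0, fder (u r) q w - z r)) s"
  proof (rule averaging_cong[OF K _ s])
    fix r :: real assume "r \<in> {0..1}"
    from dF_linear[OF F1 this q] show "dF q r (w, fder (u r) q w) - dF q r (w, z r) = dF q r (0, fder (u r) q w - z r)"
      by (simp flip: linear_diff)
  qed (intro continuous_intros dF_cont[OF F1 q] zc fder_u_eq(1)[OF F1 q])
  finally show "fder (u s) q w - z s = K (\<lambda>r. dF q r (0, fder (u r) q w - z r)) s" .
qed

text \<open>The solution is found in the closed ball of radius \<rho>, which \<open>F\<close>
  preserves; the strictly larger open ball provides the open set on which \<open>F\<close> is smooth
  and contracting.\<close>

theorem smooth_averaged_fixed_point: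
  fixes F :: "'q::euclidean_space \<times> 'f::euclidean_space \<Rightarrow> 'f"
  assumes K: "averaging K" and B: "open B" and \<rho>: "0 \<le> \<rho>" "\<rho> < r" and F: "smooth_on (B \<times> ball 0 r) F"
    and L: "\<And>q x y. q \<in> B \<Longrightarrow> x \<in> ball 0 r \<Longrightarrow> y \<in> ball 0 r \<Longrightarrow> norm (F (q, x) - F (q, y)) \<le> norm (x - y) / 2"
    and le: "\<And>q x. q \<in> B \<Longrightarrow> x \<in> cball 0 \<rho> \<Longrightarrow> norm (F (q, x)) \<le> \<rho>"
  obtains u where "averaged_fixed_point K B (ball 0 r) (\<lambda>_. F) u" "\<forall>k. pCk k {0..1} B u"
proof -
  have sub: "cball 0 \<rho> \<subseteq> ball (0::'f) r" using \<rho>(2) by auto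
  have "\<exists>u. continuous_on {0..1} u \<and> (\<forall>s\<in>{0..1}. u s = K (\<lambda>r. F (q, u r)) s) \<and> (\<forall>s\<in>{0..1}. u s \<in> cball 0 \<rho>)"
    if q: "q \<in> B" for q
  proof -
    have "continuous_on ({0..1::real} \<times> cball 0 \<rho>) (\<lambda>p. F (q, snd p))"
      by (rule continuous_on_compose2[OF smooth_on_continuous[OF F]])
        (use q sub in \<open>auto intro!: continuous_intros\<close>)
    then have c: "continuous_on ({0..1::real} \<times> cball 0 \<rho>) (\<lambda>(r, x). F (q, x))" by (simp add: case_prod_beta)
    show ?thesis
      by (rule averaging_fixed_point_ball[OF K c \<rho>(1)]) (use L le q sub in blast)+
  qed
  then have "\<forall>q. \<exists>u. q \<in> B \<longrightarrow> continuous_on {0..1} u \<and> (\<forall>s\<in>{0..1}. u s = K (\<lambda>r. F (q, u r)) s) \<and> (\<forall>s\<in>{0..1}. u s \<in> cball 0 \<rho>)"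
    by blast
  from choice[OF this] obtain v where v: "\<forall>q. q \<in> B \<longrightarrow> continuous_on {0..1} (v q) \<and>
      (\<forall>s\<in>{0..1}. v q s = K (\<lambda>r. F (q, v q r)) s) \<and> (\<forall>s\<in>{0..1}. v q s \<in> cball 0 \<rho>)" ..
  have afp: "averaged_fixed_point K B (ball 0 r) (\<lambda>_. F) (\<lambda>s q. v q s)"
  proof
    show "continuous_on ({0..1::real} \<times> (B \<times> ball 0 r)) (\<lambda>(r, y). F y)"
      by (rule continuous_on_constant_family[OF smooth_on_continuous[OF F]])
    show "v q s \<in> ball 0 r" if "s \<in> {0..1}" "q \<in> B" for s q using v that sub by blast
  qed (use v K B L in auto)
  show ?thesis
    by (rule that[OF afp]) (blast intro: averaged_fixed_point_pCk[OF afp] smooth_on_imp_pCk[OF F])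
qed

subsection \<open>The inverse function theorem\<close>

lemma lipschitz_of_partials:
  fixes f :: "'e::euclidean_space \<Rightarrow> 'b::real_normed_vector"
  assumes "convex C" "\<And>x. x \<in> C \<Longrightarrow> f differentiable (at x)" "\<And>x. x \<in> C \<Longrightarrow> (\<Sum>b\<in>Basis. norm (fder f x b)) \<le> c"
    "x \<in> C" "y \<in> C"
  shows "norm (f x - f y) \<le> c * norm (x - y)"
proof (rule differentiable_bound[OF assms(1) _ _ assms(4,5)])
  fix x assume x: "x \<in> C"
  show "(f has_derivative fder f x) (at x within C)"
    using assms(2)[OF x] has_derivative_fder has_derivative_at_withinI by blast
  show "onorm (fder f x) \<le> c"
  proof (rule onorm_le)
    fix v
    have "norm (fder f x v) = norm (\<Sum>b\<in>Basis. (v \<bullet> b) *\<^sub>R fder f x b)"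
      by (subst linear_basis_sum[OF linear_frechet_derivative[OF assms(2)[OF x]]]) simp
    also have "\<dots> \<le> (\<Sum>b\<in>Basis. norm v * norm (fder f x b))"
      by (intro sum_norm_le) (auto intro!: mult_right_mono Basis_le_norm)
    also have "\<dots> = norm v * (\<Sum>b\<in>Basis. norm (fder f x b))" by (simp add: sum_distrib_left)
    also have "\<dots> \<le> norm v * c" using assms(3)[OF x] by (intro mult_left_mono) auto
    finally show "norm (fder f x v) \<le> c * norm v" by (simp add: mult.commute)
  qed
qed

lemma smooth_on_partials_continuous:
  assumes "smooth_on S f" shows "continuous_on S (\<lambda>x. \<Sum>b\<in>Basis. norm (fder f x b))"
  by (intro continuous_intros smooth_on_continuous smooth_on_fder assms)

lemma smooth_lipschitz_cball:
  fixes f :: "'e::euclidean_space \<Rightarrow> 'b::real_normed_vector"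
  assumes f: "smooth_on S f" and sub: "cball x0 r \<subseteq> S"
  obtains M where "M \<ge> 0" "\<forall>x\<in>cball x0 r. norm (f x) \<le> M"
    "\<forall>x\<in>cball x0 r. \<forall>y\<in>cball x0 r. norm (f x - f y) \<le> M * norm (x - y)"
proof -
  have "continuous_on (cball x0 r) (\<lambda>x. \<Sum>b\<in>Basis. norm (fder f x b))" "continuous_on (cball x0 r) f"
    using smooth_on_partials_continuous[OF f] smooth_on_continuous[OF f] continuous_on_subset sub by blast+
  then have "bounded ((\<lambda>x. \<Sum>b\<in>Basis. norm (fder f x b)) ` cball x0 r)" "bounded (f ` cball x0 r)"
    using compact_cball compact_continuous_image compact_imp_bounded by blast+
  then obtain M1 M2 where M1: "\<forall>x\<in>cball x0 r. norm (\<Sum>b\<in>Basis. norm (fder f x b)) \<le> M1"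
    and M2: "\<forall>x\<in>cball x0 r. norm (f x) \<le> M2"
    unfolding bounded_iff by blast
  define M where "M = max 0 (max M1 M2)"
  have "norm (f x - f y) \<le> M * norm (x - y)" if "x \<in> cball x0 r" "y \<in> cball x0 r" for x y
  proof (rule lipschitz_of_partials[OF convex_cball _ _ that])
    show "f differentiable (at x)" if "x \<in> cball x0 r" for x using smooth_on_differentiable[OF f] sub that by blast
    show "(\<Sum>b\<in>Basis. norm (fder f x b)) \<le> M" if "x \<in> cball x0 r" for x
    proof -
      have "(\<Sum>b\<in>Basis. norm (fder f x b)) \<le> M1" using M1 that by (metis abs_le_D1 real_norm_def)
      also have "\<dots> \<le> M" by (simp add: M_def)
      finally show ?thesis .
    qed
  qed
  moreover have "norm (f x) \<le> M" if "x \<in> cball x0 r" for x using M2[rule_format, OF that] by (simp add: M_def)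
  ultimately show ?thesis by (intro that[of M]) (auto simp: M_def)
qed

lemma smooth_on_affine_comp:
  assumes "open S" "smooth_on S f" shows "smooth_on ((\<lambda>u. u - a) ` S) (\<lambda>u. f (a + u))"
proof (rule smooth_on_compose[OF _ assms(1,2)])
  show o: "open ((\<lambda>u. u - a) ` S)" using open_translation_subtract[OF assms(1)] .
  show "smooth_on ((\<lambda>u. u - a) ` S) (\<lambda>u. a + u)"
    by (intro smooth_on_add smooth_on_const smooth_on_id o)
qed auto

text \<open>The equation \<open>F (x0 + u) = F x0 + q\<close> is rewritten as
  \<open>u = G u + l q\<close>, where \<open>G\<close> has derivative zero at 0 and so contracts
  near 0. A fixed point gives equality only after applying \<open>l\<close>, and injectivity of
  \<open>l\<close> removes it. The contraction property of \<open>G\<close> also yields injectivity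
  of \<open>F\<close> near \<open>x0\<close>.\<close>

theorem smooth_inverse_function:
  fixes F :: "'e::euclidean_space \<Rightarrow> 'f::euclidean_space"
  assumes S: "open S" "x0 \<in> S" and F: "smooth_on S F" and l: "linear l" "\<And>v. l (fder F x0 v) = v" "inj l"
  obtains r \<delta> H where "r > 0" "\<delta> > 0" "ball x0 r \<subseteq> S" "inj_on F (ball x0 r)" "smooth_on (ball (F x0) \<delta>) H"
    "\<forall>z\<in>ball (F x0) \<delta>. H z \<in> ball x0 r \<and> F (H z) = z"
proof -
  define G where "G = (\<lambda>u. u - l (F (x0 + u) - F x0))"
  define S' where "S' = (\<lambda>u. u - x0) ` S"
  have S': "open S'" "0 \<in> S'" using S open_translation_subtract by (auto simp: S'_def)
  have lb: "bounded_linear l" using l(1) by (simp add: linear_conv_bounded_linear)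
  have Fs: "smooth_on S' (\<lambda>u. F (x0 + u))" unfolding S'_def by (rule smooth_on_affine_comp[OF S(1) F])
  have G_alt: "G = (\<lambda>u. u + (- l (F (x0 + u)) + l (F x0)))"
    using l(1) by (simp add: G_def linear_diff fun_eq_iff)
  have G: "smooth_on S' G"
    unfolding G_alt
    by (intro smooth_on_add smooth_on_id smooth_on_const S' smooth_on_bounded_linear[OF bounded_linear_minus[OF lb]] Fs)
  have "((\<lambda>u. x0 + u) has_derivative (\<lambda>u. u)) (at 0)" by (auto intro!: derivative_eq_intros)
  from has_derivative_compose[OF this, of F "fder F x0"] smooth_on_has_derivative[OF F S(2)]
  have "((\<lambda>u. F (x0 + u)) has_derivative fder F x0) (at 0)" by simp
  then have "(G has_derivative (\<lambda>v. v - l (fder F x0 v - 0))) (at 0)"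
    unfolding G_def by (intro has_derivative_diff has_derivative_ident has_derivative_const bounded_linear.has_derivative[OF lb])
  then have dG0: "fder G 0 = (\<lambda>_. 0)" using fder_eqI l(2) by fastforce
  have "isCont (\<lambda>x. \<Sum>b\<in>Basis. norm (fder G x b)) 0"
    using smooth_on_partials_continuous[OF G] S' continuous_on_eq_continuous_at by blast
  then obtain d where d: "d > 0" and d_less: "\<forall>x. x \<noteq> 0 \<and> dist x 0 < d \<longrightarrow>
      dist (\<Sum>b\<in>Basis. norm (fder G x b)) (\<Sum>b\<in>Basis. norm (fder G 0 b)) < 1 / 2"
    unfolding isCont_def LIM_def by (meson half_gt_zero zero_less_one)
  have d_le: "(\<Sum>b\<in>Basis. norm (fder G x b)) \<le> 1 / 2" if "dist x 0 < d" for x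
  proof (cases "x = 0")
    case False
    with d_less that have "dist (\<Sum>b\<in>Basis. norm (fder G x b)) (\<Sum>b\<in>Basis. norm (fder G 0 b)) < 1 / 2"
      by blast
    then show ?thesis by (simp add: dG0 dist_real_def)
  qed (simp add: dG0)
  obtain d' where d': "d' > 0" "ball 0 d' \<subseteq> S'" using S' open_contains_ball by blast
  define r where "r = min d d'"
  have r: "r > 0" "ball 0 r \<subseteq> S'" using d d' by (auto simp: r_def)
  have GL: "norm (G x - G y) \<le> 1 / 2 * norm (x - y)" if "x \<in> ball 0 r" "y \<in> ball 0 r" for x y
  proof (rule lipschitz_of_partials[OF convex_ball _ _ that])
    show "G differentiable (at x)" if "x \<in> ball 0 r" for x using smooth_on_differentiable[OF G] r(2) that by blast
    show "(\<Sum>b\<in>Basis. norm (fder G x b)) \<le> 1 / 2" if "x \<in> ball 0 r" for x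
      using d_le[of x] that by (simp add: r_def)
  qed
  obtain c where c: "c > 0" "\<And>z. norm (l z) \<le> norm z * c" using bounded_linear.pos_bounded[OF lb] by blast
  \<comment> \<open>With \<open>c\<close> bounding \<open>l\<close>, a shift shorter than \<delta>
    contributes at most \<open>r / 4\<close>. On the ball of radius \<open>r / 2\<close> the map
    \<open>G\<close> contributes at most another \<open>r / 4\<close>, so the ball is
    preserved.\<close>
  define \<delta> where "\<delta> = r / (4 * c)"
  have \<delta>: "\<delta> > 0" using r c by (simp add: \<delta>_def)
  have l\<delta>: "norm (l z) \<le> r / 4" if "norm z < \<delta>" for z
  proof -
    have "norm z * c \<le> \<delta> * c" using that c by simp
    also have "\<dots> = r / 4" using c by (simp add: \<delta>_def)
    finally show ?thesis using c(2)[of z] by simp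
  qed
  define Phi where "Phi = (\<lambda>p. G (snd p) + l (fst p))"
  have o: "open (ball (0::'f) \<delta> \<times> ball (0::'e) r)" by (simp add: open_Times)
  have Phi: "smooth_on (ball (0::'f) \<delta> \<times> ball (0::'e) r) Phi"
    unfolding Phi_def
  proof (intro smooth_on_add o)
    have snd: "smooth_on (ball (0::'f) \<delta> \<times> ball (0::'e) r) snd"
      by (rule smooth_on_bounded_linear[OF bounded_linear_snd o smooth_on_id[OF o]])
    have fst: "smooth_on (ball (0::'f) \<delta> \<times> ball (0::'e) r) fst"
      by (rule smooth_on_bounded_linear[OF bounded_linear_fst o smooth_on_id[OF o]])
    show "smooth_on (ball (0::'f) \<delta> \<times> ball (0::'e) r) (\<lambda>p. G (snd p))"
      by (rule smooth_on_compose[OF o S'(1) G snd]) (use r in auto)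
    show "smooth_on (ball (0::'f) \<delta> \<times> ball (0::'e) r) (\<lambda>p. l (fst p))"
      by (rule smooth_on_bounded_linear[OF lb o fst])
  qed
  have G0: "G 0 = 0" using l(1) by (simp add: G_def linear_0)
  have le: "norm (Phi (q, x)) \<le> r / 2" if "q \<in> ball 0 \<delta>" "x \<in> cball 0 (r / 2)" for q x
  proof -
    have "norm (G x) \<le> r / 4" using GL[of x 0] that r by (simp add: G0)
    with l\<delta>[of q] that show ?thesis using norm_triangle_ineq[of "G x" "l q"] by (simp add: Phi_def)
  qed
  have L: "norm (Phi (q, x) - Phi (q, y)) \<le> norm (x - y) / 2" if "q \<in> ball 0 \<delta>" "x \<in> ball 0 r" "y \<in> ball 0 r" for q x y
    using GL[OF that(2,3)] by (simp add: Phi_def)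
  have r2: "0 \<le> r / 2" "r / 2 < r" using r by auto
  obtain u where u: "averaged_fixed_point (\<lambda>f. f) (ball 0 \<delta>) (ball 0 r) (\<lambda>_. Phi) u" "\<forall>k. pCk k {0..1} (ball 0 \<delta>) u"
    by (rule smooth_averaged_fixed_point[OF averaging_ident open_ball r2 Phi L le])
  have us: "smooth_on (ball 0 \<delta>) (u 0)" using pCk_imp_smooth_on[of "{0..1}" _ u 0] u(2) by simp
  have uq: "F (x0 + u 0 q) = F x0 + q" "u 0 q \<in> ball 0 r" if "q \<in> ball 0 \<delta>" for q
  proof -
    interpret averaged_fixed_point "\<lambda>f. f" "ball 0 \<delta>" "ball 0 r" "\<lambda>_. Phi" u by (rule u(1))
    have "u 0 q = Phi (q, u 0 q)" using u_eq[of 0 q] that by simp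
    then have "l (F (x0 + u 0 q) - F x0) = l q" by (simp add: Phi_def G_def algebra_simps)
    then show "F (x0 + u 0 q) = F x0 + q" using l(3) by (metis add_diff_cancel_left' diff_add_cancel injD add.commute)
    show "u 0 q \<in> ball 0 r" using u_in[of 0 q] that by simp
  qed
  define H where "H = (\<lambda>z. x0 + u 0 (z - F x0))"
  show ?thesis
  proof (rule that[of r \<delta> H])
    show "ball x0 r \<subseteq> S"
    proof
      fix x assume "x \<in> ball x0 r"
      then have "x - x0 \<in> ball 0 r" by (simp add: dist_norm norm_minus_commute)
      then show "x \<in> S" using r(2) by (auto simp: S'_def)
    qed
    show "inj_on F (ball x0 r)"
    proof (rule inj_onI)
      fix x y assume xy: "x \<in> ball x0 r" "y \<in> ball x0 r" "F x = F y"
      then have "x - x0 \<in> ball 0 r" "y - x0 \<in> ball 0 r" by (simp_all add: dist_norm norm_minus_commute)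
      from GL[OF this] xy(3) show "x = y" by (simp add: G_def)
    qed
    show "smooth_on (ball (F x0) \<delta>) H"
      unfolding H_def
    proof (intro smooth_on_add smooth_on_const smooth_on_compose[OF _ _ us])
      show "smooth_on (ball (F x0) \<delta>) (\<lambda>z. z - F x0)"
        using smooth_on_add[OF open_ball smooth_on_id smooth_on_const[of _ "- F x0"]] by simp
    qed (auto simp: dist_norm norm_minus_commute)
    show "\<forall>z\<in>ball (F x0) \<delta>. H z \<in> ball x0 r \<and> F (H z) = z"
    proof
      fix z assume "z \<in> ball (F x0) \<delta>"
      then have "z - F x0 \<in> ball 0 \<delta>" by (simp add: dist_norm norm_minus_commute)
      from uq[OF this] show "H z \<in> ball x0 r \<and> F (H z) = z" by (simp add: H_def dist_norm)
    qed
  qed (use r \<delta> in auto)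
qed

lemma smooth_on_chain:
  assumes "smooth_on S f" "(y has_derivative y') (at x)" "y x \<in> S"
  shows "((\<lambda>x. f (y x)) has_derivative (\<lambda>v. fder f (y x) (y' v))) (at x)"
  by (rule has_derivative_compose[OF assms(2) smooth_on_has_derivative[OF assms(1,3)]])

subsection \<open>Symmetry of second derivatives\<close>

text \<open>The second difference is a first difference, over one side of a small parallelogram, of
  the increment along the other side. After subtraction of the expected value, the derivative of
  that increment consists of two first-order remainders of the directional derivative
  \<open>k\<close> at \<open>x\<close>, each of order \<epsilon> t.\<close>

lemma second_difference:
  fixes f :: "'e::euclidean_space \<Rightarrow> 'b::real_normed_vector"
  assumes S: "open S" "x \<in> S" and f: "smooth_on S f" and "\<epsilon> > 0"
  obtains d where "d > 0" "\<forall>t. 0 < t \<and> t < d \<longrightarrow>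
    norm (f (x + t *\<^sub>R v + t *\<^sub>R w) - f (x + t *\<^sub>R v) - f (x + t *\<^sub>R w) + f x
      - t\<^sup>2 *\<^sub>R fder (\<lambda>y. fder f y v) x w) \<le> \<epsilon> * t\<^sup>2"
proof -
  define k where "k = (\<lambda>y. fder f y v)"
  \<comment> \<open>Every point of the parallelogram differs from \<open>x\<close> by at most
    \<open>t * N\<close>; the summand 1 makes \<open>N\<close> positive.\<close>
  define N where "N = norm v + norm w + 1"
  have N: "N > 0" using norm_ge_zero[of v] norm_ge_zero[of w] unfolding N_def by linarith
  have k: "(k has_derivative fder k x) (at x)"
    unfolding k_def by (rule smooth_on_has_derivative[OF smooth_on_fder[OF f] S(2)])
  have "\<epsilon> / (2 * N) > 0" using \<open>\<epsilon> > 0\<close> N by simp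
  with k obtain d where d: "d > 0"
    "\<And>y. norm (y - x) < d \<Longrightarrow> norm (k y - k x - fder k x (y - x)) \<le> \<epsilon> / (2 * N) * norm (y - x)"
    unfolding has_derivative_at_alt by blast
  obtain d' where d': "d' > 0" "ball x d' \<subseteq> S" using S open_contains_ball by blast
  define D where "D = min d d' / N"
  have D: "D > 0" using d d' N by (simp add: D_def)
  have "norm (f (x + t *\<^sub>R v + t *\<^sub>R w) - f (x + t *\<^sub>R v) - f (x + t *\<^sub>R w) + f x
      - t\<^sup>2 *\<^sub>R fder k x w) \<le> \<epsilon> * t\<^sup>2" if t: "0 < t" "t < D" for t
  proof -
    have tN: "t * N < min d d'" using t N by (simp add: D_def field_simps)
    have small: "norm (\<theta> *\<^sub>R t *\<^sub>R v + \<theta>' *\<^sub>R t *\<^sub>R w) \<le> t * N" if "\<theta> \<in> {0..1}" "\<theta>' \<in> {0..1}" for \<theta> \<theta>' :: real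
    proof -
      have "norm (\<theta> *\<^sub>R t *\<^sub>R v + \<theta>' *\<^sub>R t *\<^sub>R w) \<le> \<theta> * (t * norm v) + \<theta>' * (t * norm w)"
        using norm_triangle_ineq[of "\<theta> *\<^sub>R t *\<^sub>R v" "\<theta>' *\<^sub>R t *\<^sub>R w"] that t by (simp add: abs_mult)
      also have "\<dots> \<le> 1 * (t * norm v) + 1 * (t * norm w)"
        using that t by (intro add_mono mult_right_mono) auto
      also have "\<dots> \<le> t * N" using t by (simp add: N_def algebra_simps)
      finally show ?thesis .
    qed
    define p where "p = (\<lambda>\<theta>. f (x + \<theta> *\<^sub>R t *\<^sub>R v + t *\<^sub>R w) - f (x + \<theta> *\<^sub>R t *\<^sub>R v) - \<theta> *\<^sub>R t\<^sup>2 *\<^sub>R fder k x w)"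
    define p' where "p' = (\<lambda>\<theta>. t *\<^sub>R k (x + \<theta> *\<^sub>R t *\<^sub>R v + t *\<^sub>R w) - t *\<^sub>R k (x + \<theta> *\<^sub>R t *\<^sub>R v) - t\<^sup>2 *\<^sub>R fder k x w)"
    have "norm (p 1 - p 0) \<le> (\<epsilon> * t\<^sup>2) * norm (1 - 0 :: real)"
    proof (rule differentiable_bound[of "{0..1}" p "\<lambda>\<theta> h. h *\<^sub>R p' \<theta>"])
      fix \<theta> :: real assume \<theta>: "\<theta> \<in> {0..1}"
      have in1: "norm (\<theta> *\<^sub>R t *\<^sub>R v + t *\<^sub>R w) \<le> t * N" "norm (\<theta> *\<^sub>R t *\<^sub>R v) \<le> t * N"
        using small[OF \<theta>, of 1] small[OF \<theta>, of 0] by simp_all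
      have "x + y \<in> S" if "norm y \<le> t * N" for y
        by (rule subsetD[OF d'(2)]) (use that tN in \<open>simp add: dist_norm\<close>)
      from this[OF in1(1)] this[OF in1(2)]
      have inS: "x + \<theta> *\<^sub>R t *\<^sub>R v + t *\<^sub>R w \<in> S" "x + \<theta> *\<^sub>R t *\<^sub>R v \<in> S"
        by (simp_all only: add.assoc)
      have 1: "((\<lambda>\<theta>. f (x + \<theta> *\<^sub>R t *\<^sub>R v + t *\<^sub>R w)) has_derivative (\<lambda>h. fder f (x + \<theta> *\<^sub>R t *\<^sub>R v + t *\<^sub>R w) (h *\<^sub>R t *\<^sub>R v))) (at \<theta>)"
        by (rule smooth_on_chain[OF f]) (use inS in \<open>auto intro!: derivative_eq_intros\<close>)
      have 2: "((\<lambda>\<theta>. f (x + \<theta> *\<^sub>R t *\<^sub>R v)) has_derivative (\<lambda>h. fder f (x + \<theta> *\<^sub>R t *\<^sub>R v) (h *\<^sub>R t *\<^sub>R v))) (at \<theta>)"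
        by (rule smooth_on_chain[OF f]) (use inS in \<open>auto intro!: derivative_eq_intros\<close>)
      have l: "linear (fder f y)" if "y \<in> S" for y
        by (rule linear_frechet_derivative[OF smooth_on_differentiable[OF f that]])
      have "(p has_derivative (\<lambda>h. fder f (x + \<theta> *\<^sub>R t *\<^sub>R v + t *\<^sub>R w) (h *\<^sub>R t *\<^sub>R v)
          - fder f (x + \<theta> *\<^sub>R t *\<^sub>R v) (h *\<^sub>R t *\<^sub>R v) - h *\<^sub>R t\<^sup>2 *\<^sub>R fder k x w)) (at \<theta>)"
        unfolding p_def by (intro has_derivative_diff 1 2 has_derivative_scaleR_left has_derivative_ident)
      then have "(p has_derivative (\<lambda>h. h *\<^sub>R p' \<theta>)) (at \<theta>)"
        by (simp only: p'_def k_def linear_scale[OF l[OF inS(1)]] linear_scale[OF l[OF inS(2)]] scaleR_diff_right)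
      then show "(p has_derivative (\<lambda>h. h *\<^sub>R p' \<theta>)) (at \<theta> within {0..1})" by (rule has_derivative_at_withinI)
      define R where "R = (\<lambda>y. k y - k x - fder k x (y - x))"
      have R: "norm (R (x + y)) \<le> \<epsilon> / (2 * N) * (t * N)" if "norm y \<le> t * N" for y
      proof -
        have "norm (R (x + y)) \<le> \<epsilon> / (2 * N) * norm y"
          using d(2)[of "x + y"] that tN by (simp add: R_def)
        also have "\<dots> \<le> \<epsilon> / (2 * N) * (t * N)" using that \<open>\<epsilon> / (2 * N) > 0\<close> by (intro mult_left_mono) auto
        finally show ?thesis .
      qed
      have lk: "linear (fder k x)" using has_derivative_linear[OF k] .
      have "p' \<theta> = t *\<^sub>R (R (x + (\<theta> *\<^sub>R t *\<^sub>R v + t *\<^sub>R w)) - R (x + \<theta> *\<^sub>R t *\<^sub>R v))"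
        by (simp add: p'_def R_def linear_add[OF lk] linear_scale[OF lk] algebra_simps power2_eq_square)
      then have "norm (p' \<theta>) \<le> t * (norm (R (x + (\<theta> *\<^sub>R t *\<^sub>R v + t *\<^sub>R w))) + norm (R (x + \<theta> *\<^sub>R t *\<^sub>R v)))"
        using t by (simp add: norm_triangle_ineq4)
      also have "\<dots> \<le> t * (\<epsilon> / (2 * N) * (t * N) + \<epsilon> / (2 * N) * (t * N))"
        using t by (intro mult_left_mono add_mono R in1) auto
      also have "\<dots> = \<epsilon> * t\<^sup>2" using N by (simp add: power2_eq_square field_simps)
      finally have "norm (p' \<theta>) \<le> \<epsilon> * t\<^sup>2" .
      then show "onorm (\<lambda>h. h *\<^sub>R p' \<theta>) \<le> \<epsilon> * t\<^sup>2"
        by (intro onorm_le) (simp add: mult.commute[of "\<epsilon> * t\<^sup>2"] mult_left_mono)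
    qed auto
    then show ?thesis by (simp add: p_def algebra_simps)
  qed
  with D show ?thesis unfolding k_def using that by blast
qed

text \<open>The same second difference, symmetric in \<open>v\<close> and \<open>w\<close>,
  approximates both mixed derivatives to order \<epsilon> in units of t squared.\<close>

theorem symmetric_second_derivative:
  fixes f :: "'e::euclidean_space \<Rightarrow> 'b::real_normed_vector"
  assumes "open S" "x \<in> S" "smooth_on S f"
  shows "fder (\<lambda>y. fder f y v) x w = fder (\<lambda>y. fder f y w) x v"
proof -
  let ?A = "fder (\<lambda>y. fder f y v) x w" and ?B = "fder (\<lambda>y. fder f y w) x v"
  have "norm (?A - ?B) \<le> 0 + \<epsilon>" if "\<epsilon> > 0" for \<epsilon>
  proof -
    have e: "\<epsilon> / 2 > 0" using that by simp
    obtain d where d: "d > 0" "\<forall>t. 0 < t \<and> t < d \<longrightarrow>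
      norm (f (x + t *\<^sub>R v + t *\<^sub>R w) - f (x + t *\<^sub>R v) - f (x + t *\<^sub>R w) + f x - t\<^sup>2 *\<^sub>R ?A) \<le> \<epsilon> / 2 * t\<^sup>2"
      by (rule second_difference[OF assms e])
    obtain d' where d': "d' > 0" "\<forall>t. 0 < t \<and> t < d' \<longrightarrow>
      norm (f (x + t *\<^sub>R w + t *\<^sub>R v) - f (x + t *\<^sub>R w) - f (x + t *\<^sub>R v) + f x - t\<^sup>2 *\<^sub>R ?B) \<le> \<epsilon> / 2 * t\<^sup>2"
      by (rule second_difference[OF assms e])
    define t where "t = min d d' / 2"
    have t: "0 < t" "t < d" "t < d'" using d d' by (auto simp: t_def)
    have "norm (t\<^sup>2 *\<^sub>R (?A - ?B)) \<le> \<epsilon> / 2 * t\<^sup>2 + \<epsilon> / 2 * t\<^sup>2"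
    proof -
      let ?a = "f (x + t *\<^sub>R v + t *\<^sub>R w) - f (x + t *\<^sub>R v) - f (x + t *\<^sub>R w) + f x - t\<^sup>2 *\<^sub>R ?A"
      let ?b = "f (x + t *\<^sub>R w + t *\<^sub>R v) - f (x + t *\<^sub>R w) - f (x + t *\<^sub>R v) + f x - t\<^sup>2 *\<^sub>R ?B"
      have "t\<^sup>2 *\<^sub>R (?A - ?B) = ?b - ?a" by (simp add: algebra_simps)
      also have "norm \<dots> \<le> norm ?b + norm ?a" by (rule norm_triangle_ineq4)
      also have "\<dots> \<le> \<epsilon> / 2 * t\<^sup>2 + \<epsilon> / 2 * t\<^sup>2" using d(2) d'(2) t by (intro add_mono) blast+
      finally show ?thesis .
    qed
    then have "t\<^sup>2 * norm (?A - ?B) \<le> t\<^sup>2 * \<epsilon>" by (simp add: mult.commute[of "t\<^sup>2"])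
    then show ?thesis using t by simp
  qed
  then have "norm (?A - ?B) \<le> 0" by (rule field_le_epsilon)
  then show ?thesis by simp
qed

subsection \<open>Closed 1-forms are locally exact\<close>

text \<open>The first-order remainder is small uniformly in \<open>s\<close>, so it stays small
  after integration. The integral is the averaging operator at time 1, whose linearity and bound are
  reused.\<close>

lemma has_derivative_integral_param:
  fixes f :: "real \<Rightarrow> 'e::euclidean_space \<Rightarrow> 'b::euclidean_space"
  assumes S: "open S" "x \<in> S" and f: "pCk (Suc 0) {0..1} S f"
  shows "((\<lambda>x. integral {0..1} (\<lambda>s. f s x)) has_derivative (\<lambda>v. integral {0..1} (\<lambda>s. fder (f s) x v))) (at x)"
proof -
  note K = averaging_integral[where ?'a = 'b]
  have l: "linear (fder (f s) x)" if "s \<in> {0..1}" for s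
    using f S that by (intro linear_frechet_derivative) auto
  have swap: "continuous_on {0..1} (\<lambda>s. g s y)" if "continuous_on ({0..1} \<times> S) (\<lambda>(s, x). g s x)" "y \<in> S"
    for g :: "real \<Rightarrow> 'e \<Rightarrow> 'b" and y
  proof -
    have "continuous_on {0..1} (\<lambda>s. (\<lambda>(s, x). g s x) (s, y))"
      by (rule continuous_on_compose2[OF that(1)]) (use that(2) in \<open>auto intro!: continuous_intros\<close>)
    then show ?thesis by simp
  qed
  have cf: "continuous_on {0..1} (\<lambda>s. f s y)" if "y \<in> S" for y
    using swap[of f] f that by simp
  have cd: "continuous_on {0..1} (\<lambda>s. fder (f s) x v)" for v
    using swap[of "\<lambda>s x. fder (f s) x v" x] f S(2) by simp
  have one: "(1::real) \<in> {0..1}" by simp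
  have lin: "linear (\<lambda>v. integral {0..1} (\<lambda>s. fder (f s) x v))"
  proof
    fix v w and c :: real
    have "integral {0..1} (\<lambda>s. fder (f s) x (v + w)) = integral {0..1} (\<lambda>s. fder (f s) x v + fder (f s) x w)"
      by (intro integral_cong linear_add l)
    also have "\<dots> = integral {0..1} (\<lambda>s. fder (f s) x v) + integral {0..1} (\<lambda>s. fder (f s) x w)"
      by (rule averaging_add[OF K cd cd one])
    finally show "integral {0..1} (\<lambda>s. fder (f s) x (v + w)) = integral {0..1} (\<lambda>s. fder (f s) x v) + integral {0..1} (\<lambda>s. fder (f s) x w)" .
    have "integral {0..1} (\<lambda>s. fder (f s) x (c *\<^sub>R v)) = integral {0..1} (\<lambda>s. c *\<^sub>R fder (f s) x v)"
      by (intro integral_cong linear_scale l)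
    then show "integral {0..1} (\<lambda>s. fder (f s) x (c *\<^sub>R v)) = c *\<^sub>R integral {0..1} (\<lambda>s. fder (f s) x v)" by simp
  qed
  show ?thesis
    unfolding has_derivative_at_alt
  proof (intro conjI allI impI)
    show "bounded_linear (\<lambda>v. integral {0..1} (\<lambda>s. fder (f s) x v))" using lin by (simp add: linear_conv_bounded_linear)
    fix e :: real assume "e > 0"
    obtain d where d: "d > 0" "ball x d \<subseteq> S"
      "\<forall>s\<in>{0..1}. \<forall>h. norm h < d \<longrightarrow> norm (f s (x + h) - f s x - fder (f s) x h) \<le> e * norm h"
      by (rule uniform_derivative[OF S f \<open>e > 0\<close>])
    have "norm (integral {0..1} (\<lambda>s. f s y) - integral {0..1} (\<lambda>s. f s x) - integral {0..1} (\<lambda>s. fder (f s) x (y - x)))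
        \<le> e * norm (y - x)" if y: "norm (y - x) < d" for y
    proof -
      have "y \<in> S" using d(2) y by (auto simp: dist_norm norm_minus_commute)
      have "integral {0..1} (\<lambda>s. f s y) - integral {0..1} (\<lambda>s. f s x) - integral {0..1} (\<lambda>s. fder (f s) x (y - x))
        = integral {0..1} (\<lambda>s. f s y - f s x - fder (f s) x (y - x))"
        using averaging_diff[OF K cf[OF \<open>y \<in> S\<close>] cf[OF S(2)] one]
          averaging_diff[OF K continuous_on_diff[OF cf[OF \<open>y \<in> S\<close>] cf[OF S(2)]] cd one, of "y - x"] by simp
      also have "norm \<dots> \<le> e * norm (y - x)"
        by (rule averaging_norm_le[OF K _ _ one])
          (use d(3)[rule_format, of _ "y - x"] y in \<open>auto intro!: continuous_intros cf cd \<open>y \<in> S\<close> S(2)\<close>)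
      finally show ?thesis .
    qed
    with d(1) show "\<exists>d>0. \<forall>y. norm (y - x) < d \<longrightarrow>
      norm (integral {0..1} (\<lambda>s. f s y) - integral {0..1} (\<lambda>s. f s x) - integral {0..1} (\<lambda>s. fder (f s) x (y - x)))
        \<le> e * norm (y - x)" by blast
  qed
qed

text \<open>The primitive is the integral of the form along the segment from \<open>x0\<close>, as
  in the Poincare lemma. Closedness turns the derivative of the integrand in \<open>x\<close> into a
  derivative with respect to \<open>s\<close>, which integrates to
  \<open>\<eta> x v\<close>.\<close>

theorem closed_form_locally_exact:
  fixes \<eta> :: "'e::euclidean_space \<Rightarrow> 'e \<Rightarrow> real"
  assumes \<eta>: "\<And>x. x \<in> ball x0 r \<Longrightarrow> linear (\<eta> x)" "\<And>v. smooth_on (ball x0 r) (\<lambda>x. \<eta> x v)"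
    and closed: "\<And>x u v. x \<in> ball x0 r \<Longrightarrow> fder (\<lambda>y. \<eta> y v) x u = fder (\<lambda>y. \<eta> y u) x v"
  obtains t where "t x0 = 0" "\<forall>x\<in>ball x0 r. (t has_derivative \<eta> x) (at x)"
proof -
  define \<gamma> where "\<gamma> = (\<lambda>s x. x0 + s *\<^sub>R (x - x0))"
  define f where "f = (\<lambda>s x. \<eta> (\<gamma> s x) (x - x0))"
  have \<gamma>: "\<gamma> s x \<in> ball x0 r" if "s \<in> {0..1}" "x \<in> ball x0 r" for s x
  proof -
    have "norm (s *\<^sub>R (x - x0)) \<le> 1 * norm (x - x0)" using that(1) by (simp add: mult_left_le_one_le)
    also have "\<dots> < r" using that(2) by (simp add: dist_norm norm_minus_commute)
    finally show ?thesis by (simp add: \<gamma>_def dist_norm)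
  qed
  have id': "pCk k {0..1} (ball x0 r) (\<lambda>_ x. x - x0)" for k
    using pCk_add[OF open_ball pCk_id[OF open_ball] pCk_const[OF open_ball, where c = "- x0"]] by simp
  have p\<gamma>: "pCk k {0..1} (ball x0 r) \<gamma>" for k
    unfolding \<gamma>_def
    by (intro pCk_add[OF open_ball] pCk_const[OF open_ball] pCk_scaleR[OF open_ball] id' pCk_const_vec[OF open_ball] continuous_intros)
  have pf: "pCk k {0..1} (ball x0 r) f" for k
  proof (rule pCk_cong[OF open_ball])
    show "(\<Sum>b\<in>Basis. ((x - x0) \<bullet> b) *\<^sub>R \<eta> (\<gamma> s x) b) = f s x" if "s \<in> {0..1}" "x \<in> ball x0 r" for s x
      unfolding f_def by (rule linear_basis_sum[OF \<eta>(1)[OF \<gamma>[OF that]], symmetric])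
    show "pCk k {0..1} (ball x0 r) (\<lambda>s x. \<Sum>b\<in>Basis. ((x - x0) \<bullet> b) *\<^sub>R \<eta> (\<gamma> s x) b)"
    proof (intro pCk_sum[OF open_ball] pCk_scaleR[OF open_ball] pCk_bounded_linear[OF bounded_linear_inner_left open_ball id'])
      show "pCk k {0..1} (ball x0 r) (\<lambda>s x. \<eta> (\<gamma> s x) b)" for b
        by (rule pCk_compose[OF open_ball open_ball smooth_on_imp_pCk[OF \<eta>(2)] p\<gamma> \<gamma>])
    qed
  qed
  define t where "t = (\<lambda>x. integral {0..1} (\<lambda>s. f s x))"
  have "(t has_derivative \<eta> x) (at x)" if x: "x \<in> ball x0 r" for x
  proof -
    have df: "fder (f s) x v = \<eta> (\<gamma> s x) v + s * fder (\<lambda>y. \<eta> y v) (\<gamma> s x) (x - x0)" if s: "s \<in> {0..1}" for s v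
    proof -
      have d\<gamma>: "(\<gamma> s has_derivative (\<lambda>v. s *\<^sub>R v)) (at x)"
        unfolding \<gamma>_def by (auto intro!: derivative_eq_intros)
      have comp: "((\<lambda>y. \<eta> (\<gamma> s y) c) has_derivative (\<lambda>v. fder (\<lambda>y. \<eta> y c) (\<gamma> s x) (s *\<^sub>R v))) (at x)" for c
        by (rule has_derivative_compose[OF d\<gamma> smooth_on_has_derivative[OF \<eta>(2) \<gamma>[OF s x]]])
      have "((\<lambda>y. \<eta> (\<gamma> s y) (y - x0)) has_derivative
        (\<lambda>v. fder (\<lambda>y. \<eta> (\<gamma> s y) (x - x0)) x v + \<eta> (\<gamma> s x) (v - 0))) (at x)"
        by (rule has_derivative_apply[OF open_ball x])
          (use \<eta>(1) \<gamma>[OF s] in \<open>auto intro!: derivative_eq_intros differentiableI[OF comp]\<close>)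
      then have "fder (f s) x v = fder (\<lambda>y. \<eta> (\<gamma> s y) (x - x0)) x v + \<eta> (\<gamma> s x) v"
        unfolding f_def using fder_eqI by fastforce
      also have "fder (\<lambda>y. \<eta> (\<gamma> s y) (x - x0)) x v = fder (\<lambda>y. \<eta> y (x - x0)) (\<gamma> s x) (s *\<^sub>R v)"
        using fder_eqI[OF comp] by simp
      also have "\<dots> = s * fder (\<lambda>y. \<eta> y (x - x0)) (\<gamma> s x) v"
        using linear_frechet_derivative[OF smooth_on_differentiable[OF \<eta>(2) \<gamma>[OF s x]]] by (simp add: linear_scale)
      also have "fder (\<lambda>y. \<eta> y (x - x0)) (\<gamma> s x) v = fder (\<lambda>y. \<eta> y v) (\<gamma> s x) (x - x0)"
        by (rule closed[OF \<gamma>[OF s x]])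
      finally show ?thesis by simp
    qed
    have "integral {0..1} (\<lambda>s. fder (f s) x v) = \<eta> x v" for v
    proof -
      \<comment> \<open>The integrand is the derivative of
        \<open>s * \<eta> (\<gamma> s x) v\<close>; the factor \<open>s\<close> kills the
        contribution of the lower endpoint.\<close>
      have "((\<lambda>s. \<eta> (\<gamma> s x) v + s * fder (\<lambda>y. \<eta> y v) (\<gamma> s x) (x - x0)) has_integral (1 * \<eta> (\<gamma> 1 x) v - 0 * \<eta> (\<gamma> 0 x) v)) {0..1}"
      proof (rule fundamental_theorem_of_calculus)
        fix s :: real assume s: "s \<in> {0..1}"
        have "((\<lambda>s. \<gamma> s x) has_derivative (\<lambda>h. h *\<^sub>R (x - x0))) (at s)"
          unfolding \<gamma>_def by (auto intro!: derivative_eq_intros)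
        from has_derivative_compose[OF this smooth_on_has_derivative[OF \<eta>(2) \<gamma>[OF s x]]]
        have "((\<lambda>s. \<eta> (\<gamma> s x) v) has_derivative (\<lambda>h. fder (\<lambda>y. \<eta> y v) (\<gamma> s x) (h *\<^sub>R (x - x0)))) (at s)" .
        then have "((\<lambda>s. s * \<eta> (\<gamma> s x) v) has_derivative
            (\<lambda>h. s * fder (\<lambda>y. \<eta> y v) (\<gamma> s x) (h *\<^sub>R (x - x0)) + h * \<eta> (\<gamma> s x) v)) (at s)"
          by (intro has_derivative_mult has_derivative_ident)
        then have "((\<lambda>s. s * \<eta> (\<gamma> s x) v) has_derivative
            (\<lambda>h. h *\<^sub>R (\<eta> (\<gamma> s x) v + s * fder (\<lambda>y. \<eta> y v) (\<gamma> s x) (x - x0)))) (at s)"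
          by (simp add: linear_scale[OF linear_frechet_derivative[OF smooth_on_differentiable[OF \<eta>(2) \<gamma>[OF s x]]]]
              ring_distribs mult_ac add_ac)
        then show "((\<lambda>s. s * \<eta> (\<gamma> s x) v) has_vector_derivative
            \<eta> (\<gamma> s x) v + s * fder (\<lambda>y. \<eta> y v) (\<gamma> s x) (x - x0)) (at s within {0..1})"
          unfolding has_vector_derivative_def by (rule has_derivative_at_withinI)
      qed simp
      then have "integral {0..1} (\<lambda>s. \<eta> (\<gamma> s x) v + s * fder (\<lambda>y. \<eta> y v) (\<gamma> s x) (x - x0)) = \<eta> x v"
        by (simp add: \<gamma>_def integral_unique)
      then show ?thesis using integral_cong[of "{0..1}" "\<lambda>s. fder (f s) x v"] df by simp
    qed
    then show ?thesis
      using has_derivative_integral_param[OF open_ball x pf] unfolding t_def by (simp add: fun_eq_iff)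
  qed
  then have "((\<lambda>x. t x - t x0) has_derivative \<eta> x) (at x)" if "x \<in> ball x0 r" for x
    using has_derivative_diff[OF _ has_derivative_const[of "t x0"], of t "\<eta> x" "at x"] that by simp
  then show ?thesis by (intro that[of "\<lambda>x. t x - t x0"]) auto
qed

subsection \<open>Charts adapted to a commuting frame\<close>

text \<open>The time-one map is written as \<open>x\<close> plus a displacement that solves an
  integral equation with parameter (x, \<tau>). The last conclusion is the infinitesimal flow law:
  starting further along \<xi> a and flowing correspondingly less in that direction leaves the
  endpoint fixed to first order.\<close>

theorem commuting_flow:
  fixes \<xi> :: "'s::finite \<Rightarrow> 'e::euclidean_space \<Rightarrow> 'e"
  assumes S: "open S" "x0 \<in> S" and \<xi>: "\<And>a. smooth_on S (\<xi> a)"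
    and comm: "\<And>x a b. x \<in> S \<Longrightarrow> fder (\<xi> a) x (\<xi> b x) = fder (\<xi> b) x (\<xi> a x)"
  obtains r \<delta> and \<Psi> :: "'e \<times> (real ^ 's) \<Rightarrow> 'e" where "r > 0" "\<delta> > 0" "ball x0 r \<subseteq> S"
    "smooth_on (ball x0 r \<times> ball 0 \<delta>) \<Psi>" "\<forall>x. \<Psi> (x, 0) = x"
    "\<forall>x\<in>ball x0 r. \<forall>\<tau>\<in>ball 0 \<delta>. \<forall>a. fder \<Psi> (x, \<tau>) (\<xi> a x, - axis a 1) = 0"
proof -
  obtain R where R: "R > 0" "cball x0 R \<subseteq> S" using S open_contains_cball by blast
  define r where "r = R / 2"
  have r: "r > 0" using R by (simp add: r_def)
  have "\<exists>M. M \<ge> 0 \<and> (\<forall>x\<in>cball x0 R. norm (\<xi> a x) \<le> M) \<and>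
      (\<forall>x\<in>cball x0 R. \<forall>y\<in>cball x0 R. norm (\<xi> a x - \<xi> a y) \<le> M * norm (x - y))" for a
    by (rule smooth_lipschitz_cball[OF \<xi>[of a] R(2)]) blast
  then have "\<forall>a. \<exists>M. M \<ge> 0 \<and> (\<forall>x\<in>cball x0 R. norm (\<xi> a x) \<le> M) \<and>
      (\<forall>x\<in>cball x0 R. \<forall>y\<in>cball x0 R. norm (\<xi> a x - \<xi> a y) \<le> M * norm (x - y))" by blast
  from choice[OF this] obtain M where M: "\<forall>a. M a \<ge> 0 \<and> (\<forall>x\<in>cball x0 R. norm (\<xi> a x) \<le> M a) \<and>
      (\<forall>x\<in>cball x0 R. \<forall>y\<in>cball x0 R. norm (\<xi> a x - \<xi> a y) \<le> M a * norm (x - y))" ..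
  define m where "m = 1 + (\<Sum>a\<in>UNIV. M a)"
  have m: "m > 0" using M sum_nonneg[of UNIV M] by (simp add: m_def add_pos_nonneg)
  \<comment> \<open>Dividing by \<open>m\<close> makes the right-hand side half-Lipschitz through
    the entry 1/2, and bounds it by \<open>r / 2\<close> through the other entry, so the
    displacement stays within radius \<open>r / 2\<close>.\<close>
  define \<delta> where "\<delta> = min (1 / 2) (r / 2) / m"
  have \<delta>: "\<delta> > 0" "\<delta> * m \<le> 1 / 2" "\<delta> * m \<le> r / 2" using m r by (auto simp: \<delta>_def)
  have sum_le: "(\<Sum>a\<in>UNIV. \<bar>\<tau> $ a\<bar> * (M a * c)) \<le> (\<delta> * m) * c" if "\<tau> \<in> ball (0 :: real ^ 's) \<delta>" "c \<ge> 0" for \<tau> c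
  proof -
    have "(\<Sum>a\<in>UNIV. \<bar>\<tau> $ a\<bar> * (M a * c)) \<le> (\<Sum>a\<in>UNIV. \<delta> * (M a * c))"
    proof (intro sum_mono mult_right_mono)
      show "\<bar>\<tau> $ a\<bar> \<le> \<delta>" for a using component_le_norm_cart[of \<tau> a] that by simp
      show "0 \<le> M a * c" for a using M that by simp
    qed
    also have "\<dots> = \<delta> * (\<Sum>a\<in>UNIV. M a) * c" by (simp add: sum_distrib_left sum_distrib_right mult.assoc)
    also have "\<dots> \<le> (\<delta> * m) * c" using that(2) \<delta>(1) by (intro mult_right_mono mult_left_mono) (auto simp: m_def)
    finally show ?thesis .
  qed
  define B where "B = ball x0 r \<times> ball (0 :: real ^ 's) \<delta>"
  have B: "open B" by (simp add: B_def open_Times)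
  have in_R: "x + y \<in> cball x0 R" if "x \<in> ball x0 r" "y \<in> ball 0 r" for x y
  proof -
    have "norm (x0 - (x + y)) \<le> norm (x0 - x) + norm y"
      using norm_triangle_ineq4[of "x0 - x" y] by (simp add: algebra_simps)
    with that show ?thesis by (simp add: dist_norm r_def)
  qed
  have in_S: "x + y \<in> S" if "x \<in> ball x0 r" "y \<in> ball 0 r" for x y using in_R[OF that] R(2) by blast
  \<comment> \<open>The right-hand side of the flow equation for the displacement from the starting
    point. Start and times are parameters, and every curve begins at 0.\<close>
  define F where "F = (\<lambda>p :: ('e \<times> (real ^ 's)) \<times> 'e. \<Sum>a\<in>UNIV. (snd (fst p) $ a) *\<^sub>R \<xi> a (fst (fst p) + snd p))"
  have o: "open (B \<times> ball (0::'e) r)" using B by (simp add: open_Times)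
  have F: "smooth_on (B \<times> ball 0 r) F"
    unfolding F_def
  proof (intro smooth_on_sum[OF o] smooth_on_scaleR[OF o])
    have bl: "bounded_linear (\<lambda>p :: ('e \<times> (real ^ 's)) \<times> 'e. snd (fst p) $ a)" for a
      using bounded_linear_compose[OF bounded_linear_vec_nth bounded_linear_compose[OF bounded_linear_snd bounded_linear_fst]] .
    show "smooth_on (B \<times> ball (0::'e) r) (\<lambda>p. snd (fst p) $ a)" for a
      by (rule smooth_on_bounded_linear[OF bl o smooth_on_id[OF o]])
    have bl2: "bounded_linear (\<lambda>p :: ('e \<times> (real ^ 's)) \<times> 'e. fst (fst p) + snd p)"
      by (intro bounded_linear_add bounded_linear_compose[OF bounded_linear_fst] bounded_linear_fst bounded_linear_snd)
    show "smooth_on (B \<times> ball (0::'e) r) (\<lambda>p. \<xi> a (fst (fst p) + snd p))" for a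
      by (rule smooth_on_compose[OF o S(1) \<xi> smooth_on_bounded_linear[OF bl2 o smooth_on_id[OF o]]])
        (auto simp: B_def intro!: in_S)
  qed
  have L: "norm (F (q, x) - F (q, y)) \<le> norm (x - y) / 2" if "q \<in> B" "x \<in> ball 0 r" "y \<in> ball 0 r" for q x y
  proof -
    have q: "fst q \<in> ball x0 r" "snd q \<in> ball 0 \<delta>" using that(1) by (auto simp: B_def)
    have "F (q, x) - F (q, y) = (\<Sum>a\<in>UNIV. (snd q $ a) *\<^sub>R (\<xi> a (fst q + x) - \<xi> a (fst q + y)))"
      by (simp add: F_def sum_subtractf scaleR_diff_right)
    also have "norm \<dots> \<le> (\<Sum>a\<in>UNIV. \<bar>snd q $ a\<bar> * (M a * norm (x - y)))"
    proof (intro sum_norm_le)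
      fix a
      have "norm (\<xi> a (fst q + x) - \<xi> a (fst q + y)) \<le> M a * norm ((fst q + x) - (fst q + y))"
        using M in_R[OF q(1) that(2)] in_R[OF q(1) that(3)] by blast
      then show "norm ((snd q $ a) *\<^sub>R (\<xi> a (fst q + x) - \<xi> a (fst q + y))) \<le> \<bar>snd q $ a\<bar> * (M a * norm (x - y))"
        by (simp add: mult_left_mono)
    qed
    also have "\<dots> \<le> (\<delta> * m) * norm (x - y)" by (rule sum_le[OF q(2)]) simp
    also have "\<dots> \<le> 1 / 2 * norm (x - y)" using \<delta>(2) by (intro mult_right_mono) auto
    finally show ?thesis by simp
  qed
  have le: "norm (F (q, x)) \<le> r / 2" if "q \<in> B" "x \<in> cball 0 (r / 2)" for q x
  proof -
    have q: "fst q \<in> ball x0 r" "snd q \<in> ball 0 \<delta>" using that(1) by (auto simp: B_def)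
    have x: "x \<in> ball 0 r" using that(2) r by simp
    have "norm (F (q, x)) \<le> (\<Sum>a\<in>UNIV. \<bar>snd q $ a\<bar> * (M a * 1))"
      unfolding F_def using M in_R[OF q(1) x] by (intro sum_norm_le) (simp add: mult_left_mono)
    also have "\<dots> \<le> (\<delta> * m) * 1" by (rule sum_le[OF q(2)]) simp
    finally show ?thesis using \<delta>(3) by simp
  qed
  have r2: "0 \<le> r / 2" "r / 2 < r" using r by auto
  note K = averaging_integral[where ?'a = 'e]
  obtain u where u: "averaged_fixed_point (\<lambda>f s. integral {0..s} f) B (ball 0 r) (\<lambda>_. F) u" "\<forall>k. pCk k {0..1} B u"
    by (rule smooth_averaged_fixed_point[OF K B r2 F L le])
  interpret averaged_fixed_point "\<lambda>f s. integral {0..s} f" B "ball 0 r" "\<lambda>_. F" u by (rule u(1))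
  have us: "smooth_on B (u s)" if "s \<in> {0..1}" for s by (rule pCk_imp_smooth_on[of "{0..1}" _ u, OF u(2)[rule_format] that])
  have F1: "pCk (Suc 0) {0..1} (B \<times> ball 0 r) (\<lambda>_. F)" by (rule smooth_on_imp_pCk[OF F])
  have fst_diff: "smooth_on B fst" by (rule smooth_on_bounded_linear[OF bounded_linear_fst B smooth_on_id[OF B]])
  have dF: "fder F ((x, \<tau>), y) ((v, \<sigma>), z)
      = (\<Sum>a\<in>UNIV. (\<tau> $ a) *\<^sub>R fder (\<xi> a) (x + y) (v + z) + (\<sigma> $ a) *\<^sub>R \<xi> a (x + y))"
    if "(x, \<tau>) \<in> B" "y \<in> ball 0 r" for x \<tau> y v \<sigma> z
  proof -
    have "((\<lambda>p :: ('e \<times> (real ^ 's)) \<times> 'e. fst (fst p) + snd p) has_derivative (\<lambda>p. fst (fst p) + snd p)) (at ((x, \<tau>), y))"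
      by (auto intro!: derivative_eq_intros)
    then have "((\<lambda>p :: ('e \<times> (real ^ 's)) \<times> 'e. \<xi> a (fst (fst p) + snd p)) has_derivative
        (\<lambda>w. fder (\<xi> a) (fst (fst ((x, \<tau>), y)) + snd ((x, \<tau>), y)) (fst (fst w) + snd w))) (at ((x, \<tau>), y))" for a
      by (rule smooth_on_chain[OF \<xi>]) (use that in_S in \<open>auto simp: B_def\<close>)
    then have 1: "((\<lambda>p :: ('e \<times> (real ^ 's)) \<times> 'e. \<xi> a (fst (fst p) + snd p)) has_derivative
        (\<lambda>w. fder (\<xi> a) (x + y) (fst (fst w) + snd w))) (at ((x, \<tau>), y))" for a by simp
    have 2: "((\<lambda>p :: ('e \<times> (real ^ 's)) \<times> 'e. snd (fst p) $ a) has_derivative (\<lambda>w. snd (fst w) $ a)) (at ((x, \<tau>), y))" for a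
      by (intro bounded_linear_imp_has_derivative 
          bounded_linear_compose[OF bounded_linear_vec_nth bounded_linear_compose[OF bounded_linear_snd bounded_linear_fst]])
    have "(F has_derivative (\<lambda>w. \<Sum>a\<in>UNIV. (snd (fst ((x, \<tau>), y)) $ a) *\<^sub>R fder (\<xi> a) (x + y) (fst (fst w) + snd w)
        + (snd (fst w) $ a) *\<^sub>R \<xi> a (fst (fst ((x, \<tau>), y)) + snd ((x, \<tau>), y)))) (at ((x, \<tau>), y))"
      unfolding F_def by (intro has_derivative_sum has_derivative_scaleR 1 2)
    from fder_eqI[OF this] show ?thesis by simp
  qed
  have key: "fder (u 1) (x, \<tau>) (\<xi> a x, - axis a 1) = - \<xi> a x" if q: "(x, \<tau>) \<in> B" for x \<tau> a
  proof -
    define U where "U = (\<lambda>s. x + u s (x, \<tau>))"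
    (* The variation of the trajectory U in the direction (xi_a x, - e_a) is (1 - s) xi_a (U s): both solve
       the variational equation, the latter because the frame commutes. *)
    define z where "z = (\<lambda>s. (1 - s) *\<^sub>R \<xi> a (U s) - \<xi> a x)"
    have xr: "x \<in> ball x0 r" using q by (simp add: B_def)
    have US: "U s \<in> S" if "s \<in> {0..1}" for s unfolding U_def by (rule in_S[OF xr u_in[OF that q]])
    have Fc: "continuous_on {0..1} (\<lambda>r. F ((x, \<tau>), u r (x, \<tau>)))" by (rule F_curve_cont[OF q q])
    have u0: "u 0 (x, \<tau>) = 0" using u_eq[of 0, OF _ q] by simp
    have dU: "(U has_vector_derivative (\<Sum>b\<in>UNIV. (\<tau> $ b) *\<^sub>R \<xi> b (U s))) (at s within {0..1})" if s: "s \<in> {0..1}" for s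
    proof -
      have "((\<lambda>s. integral {0..s} (\<lambda>r. F ((x, \<tau>), u r (x, \<tau>)))) has_vector_derivative F ((x, \<tau>), u s (x, \<tau>))) (at s within {0..1})"
        by (rule integral_has_vector_derivative[OF Fc s])
      then have "((\<lambda>s. u s (x, \<tau>)) has_vector_derivative F ((x, \<tau>), u s (x, \<tau>))) (at s within {0..1})"
        by (rule has_vector_derivative_transform[OF s, rotated]) (rule u_eq[OF _ q])
      then have "((\<lambda>s. x + u s (x, \<tau>)) has_vector_derivative 0 + F ((x, \<tau>), u s (x, \<tau>))) (at s within {0..1})"
        by (intro has_vector_derivative_add has_vector_derivative_const)
      then show ?thesis by (simp add: U_def F_def)
    qed
    have dz: "(z has_vector_derivative fder F ((x, \<tau>), u s (x, \<tau>)) ((\<xi> a x, - axis a 1), z s)) (at s within {0..1})"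
      if s: "s \<in> {0..1}" for s
    proof -
      let ?U' = "\<Sum>b\<in>UNIV. (\<tau> $ b) *\<^sub>R \<xi> b (U s)"
      have l: "linear (fder (\<xi> b) (U s))" for b
        by (rule linear_frechet_derivative[OF smooth_on_differentiable[OF \<xi> US[OF s]]])
      have "((\<lambda>s. \<xi> a (U s)) has_derivative (\<lambda>h. fder (\<xi> a) (U s) (h *\<^sub>R ?U'))) (at s within {0..1})"
        by (rule has_derivative_compose[OF dU[OF s, unfolded has_vector_derivative_def] smooth_on_has_derivative[OF \<xi> US[OF s]]])
      then have "((\<lambda>s. \<xi> a (U s)) has_vector_derivative fder (\<xi> a) (U s) ?U') (at s within {0..1})"
        by (simp add: has_vector_derivative_def linear_scale[OF l])
      then have "(z has_vector_derivative ((1 - s) *\<^sub>R fder (\<xi> a) (U s) ?U' + (0 - 1) *\<^sub>R \<xi> a (U s) - 0)) (at s within {0..1})"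
        unfolding z_def
        by (intro has_vector_derivative_diff has_vector_derivative_scaleR has_vector_derivative_const DERIV_diff DERIV_const DERIV_ident)
      moreover have "fder (\<xi> a) (U s) ?U' = (\<Sum>b\<in>UNIV. (\<tau> $ b) *\<^sub>R fder (\<xi> b) (U s) (\<xi> a (U s)))"
        by (simp add: linear_sum[OF l] linear_scale[OF l] comm[OF US[OF s], of a])
      moreover have "fder F ((x, \<tau>), u s (x, \<tau>)) ((\<xi> a x, - axis a 1), z s)
          = (\<Sum>b\<in>UNIV. (\<tau> $ b) *\<^sub>R fder (\<xi> b) (U s) ((1 - s) *\<^sub>R \<xi> a (U s)) + (- axis a 1 $ b) *\<^sub>R \<xi> b (U s))"
        unfolding dF[OF q u_in[OF s q]] by (simp add: z_def U_def)
      moreover have "\<dots> = (1 - s) *\<^sub>R (\<Sum>b\<in>UNIV. (\<tau> $ b) *\<^sub>R fder (\<xi> b) (U s) (\<xi> a (U s))) - \<xi> a (U s)"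
      proof -
        have "(\<Sum>b\<in>UNIV. (- axis a 1 $ b) *\<^sub>R \<xi> b (U s)) = (\<Sum>b\<in>UNIV. if b = a then - \<xi> a (U s) else 0)"
          by (rule sum.cong) (auto simp: axis_def)
        then have e: "(\<Sum>b\<in>UNIV. (- axis a 1 $ b) *\<^sub>R \<xi> b (U s)) = - \<xi> a (U s)"
          unfolding sum.delta[OF finite] by simp
        show ?thesis
          unfolding sum.distrib e by (simp add: linear_scale[OF l] scaleR_sum_right mult.commute)
      qed
      ultimately show ?thesis by simp
    qed
    have zc: "continuous_on {0..1} z"
      using dz by (meson has_vector_derivative_continuous continuous_on_eq_continuous_within)
    \<comment> \<open>\<open>u\<close> measures displacement from a starting point that itself moves
      with velocity \<open>\<xi> a x\<close>, hence the subtraction of this vector in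
      \<open>z\<close>. It gives \<open>z 0 = 0\<close>, so the fundamental theorem turns the
      differential equation into the fixed point equation, and at time 1 only
      \<open>- \<xi> a x\<close> is left.\<close>
    have "fder (u 1) (x, \<tau>) (\<xi> a x, - axis a 1) = z 1"
    proof (rule fder_u_unique[OF F1 q zc])
      fix s :: real assume s: "s \<in> {0..1}"
      have "((\<lambda>r. fder F ((x, \<tau>), u r (x, \<tau>)) ((\<xi> a x, - axis a 1), z r)) has_integral z s - z 0) {0..s}"
      proof (rule fundamental_theorem_of_calculus)
        show "0 \<le> s" using s by simp
        show "(z has_vector_derivative fder F ((x, \<tau>), u r (x, \<tau>)) ((\<xi> a x, - axis a 1), z r)) (at r within {0..s})"
          if "r \<in> {0..s}" for r
          by (rule has_vector_derivative_within_subset[OF dz]) (use that s in auto)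
      qed
      then show "z s = integral {0..s} (\<lambda>r. fder F ((x, \<tau>), u r (x, \<tau>)) ((\<xi> a x, - axis a 1), z r))"
        by (simp add: integral_unique z_def U_def u0)
    qed simp
    then show ?thesis by (simp add: z_def)
  qed
  have u1: "smooth_on B (u 1)" by (rule us) simp
  (* The case distinction only makes \<Psi> (x, 0) = x hold outside of B as well. *)
  define \<Psi> where "\<Psi> = (\<lambda>q. if snd q = 0 then fst q else fst q + u 1 q)"
  have \<Psi>: "\<Psi> q = fst q + u 1 q" if "q \<in> B" for q
  proof -
    have "u 1 (x, 0) = 0" if q: "(x, 0) \<in> B" for x
      unfolding u_eq[OF _ q, of 1, simplified] by (simp add: F_def)
    with that show ?thesis by (cases q) (auto simp: \<Psi>_def)
  qed
  show ?thesis
  proof (rule that[of r \<delta> \<Psi>])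
    show "ball x0 r \<subseteq> S" using R(2) r by (auto simp: r_def)
    show "smooth_on (ball x0 r \<times> ball 0 \<delta>) \<Psi>"
      unfolding B_def[symmetric]
      by (rule smooth_on_cong[OF B _ smooth_on_add[OF B fst_diff u1]]) (simp add: \<Psi>)
    show "\<forall>x. \<Psi> (x, 0) = x" by (simp add: \<Psi>_def)
    show "\<forall>x\<in>ball x0 r. \<forall>\<tau>\<in>ball 0 \<delta>. \<forall>a. fder \<Psi> (x, \<tau>) (\<xi> a x, - axis a 1) = 0"
    proof (intro ballI allI)
      fix x \<tau> a assume "x \<in> ball x0 r" "\<tau> \<in> ball (0 :: real ^ 's) \<delta>"
      then have q: "(x, \<tau>) \<in> B" by (simp add: B_def)
      have "((\<lambda>q. fst q + u 1 q) has_derivative (\<lambda>v. fst v + fder (u 1) (x, \<tau>) v)) (at (x, \<tau>))"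
        by (intro has_derivative_add has_derivative_fst has_derivative_ident smooth_on_has_derivative[OF u1 q])
      then have "fder (\<lambda>q. fst q + u 1 q) (x, \<tau>) (\<xi> a x, - axis a 1) = 0"
        by (simp add: fder_eqI key[OF q])
      moreover have "fder \<Psi> (x, \<tau>) = fder (\<lambda>q. fst q + u 1 q) (x, \<tau>)"
        by (rule fder_cong_open[OF B q \<Psi>])
      ultimately show "fder \<Psi> (x, \<tau>) (\<xi> a x, - axis a 1) = 0" by simp
    qed
  qed (use r \<delta> in auto)
qed

text \<open>The first coordinate has differential \<eta>. The second is constant along the frame,
  since its differential on \<open>\<xi> a x\<close> factors through that of \<Psi> on
  \<open>(\<xi> a x, - axis a 1)\<close>. At \<open>x0\<close> the two differentials complement each
  other, so the inverse function theorem applies.\<close>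

theorem adapted_chart:
  fixes \<xi> :: "'s::finite \<Rightarrow> 'e::euclidean_space \<Rightarrow> 'e" and \<eta> :: "'s \<Rightarrow> 'e \<Rightarrow> 'e \<Rightarrow> real"
  assumes S: "open S" "x0 \<in> S" and \<xi>: "\<And>a. smooth_on S (\<xi> a)"
    and comm: "\<And>x a b. x \<in> S \<Longrightarrow> fder (\<xi> a) x (\<xi> b x) = fder (\<xi> b) x (\<xi> a x)"
    and \<eta>: "\<And>a x. x \<in> S \<Longrightarrow> linear (\<eta> a x)" "\<And>a v. smooth_on S (\<lambda>x. \<eta> a x v)"
    and closed: "\<And>a x u v. x \<in> S \<Longrightarrow> fder (\<lambda>y. \<eta> a y v) x u = fder (\<lambda>y. \<eta> a y u) x v"
    and dual: "\<And>a b x. x \<in> S \<Longrightarrow> \<eta> a x (\<xi> b x) = (if a = b then 1 else 0)"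
    and dim: "DIM('e) = DIM('v::euclidean_space) + CARD('s)"
  obtains U C H and \<epsilon> :: real and y0 :: "'v::euclidean_space" where "open U" "x0 \<in> U" "U \<subseteq> S" "\<epsilon> > 0"
    "smooth_on U C" "smooth_on (ball (0 :: real ^ 's) \<epsilon> \<times> ball y0 \<epsilon>) H"
    "\<forall>x\<in>U. C x \<in> ball 0 \<epsilon> \<times> ball y0 \<epsilon> \<and> H (C x) = x"
    "\<forall>z\<in>ball 0 \<epsilon> \<times> ball y0 \<epsilon>. H z \<in> U \<and> C (H z) = z"
    "\<forall>x\<in>U. \<forall>v. fst (fder C x v) = (\<chi> a. \<eta> a x v)"
    "\<forall>x\<in>U. \<forall>a. fder C x (\<xi> a x) = (axis a 1, 0)"
proof -
  obtain r \<delta> and \<Psi> :: "'e \<times> (real ^ 's) \<Rightarrow> 'e" where r: "r > 0" "\<delta> > 0" "ball x0 r \<subseteq> S"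
    and \<Psi>: "smooth_on (ball x0 r \<times> ball 0 \<delta>) \<Psi>" and \<Psi>0: "\<forall>x. \<Psi> (x, 0) = x"
    and d\<Psi>: "\<forall>x\<in>ball x0 r. \<forall>\<tau>\<in>ball 0 \<delta>. \<forall>a. fder \<Psi> (x, \<tau>) (\<xi> a x, - axis a 1) = 0"
    by (rule commuting_flow[OF S \<xi> comm])
  have "\<exists>t. t x0 = 0 \<and> (\<forall>x\<in>ball x0 r. (t has_derivative \<eta> a x) (at x))" for a
    by (rule closed_form_locally_exact[of x0 r "\<eta> a"])
      (use \<eta>(1) smooth_on_subset[OF \<eta>(2) r(3)] closed r(3) in blast)+
  then have "\<forall>a. \<exists>t. t x0 = 0 \<and> (\<forall>x\<in>ball x0 r. (t has_derivative \<eta> a x) (at x))" by blast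
  from choice[OF this] obtain T where T: "\<forall>a. T a x0 = 0 \<and> (\<forall>x\<in>ball x0 r. (T a has_derivative \<eta> a x) (at x))" ..
  define t where "t = (\<lambda>x. \<chi> a. T a x)"
  define E where "E = (\<lambda>x v. \<chi> a. \<eta> a x v)"
  have vec_sum: "(\<chi> a. f a) = (\<Sum>a\<in>UNIV. f a *\<^sub>R axis a 1)" for f :: "'s \<Rightarrow> real"
    by (simp add: vec_eq_iff axis_def if_distrib[of "\<lambda>x. _ * x"] cong: if_cong)
  have dt: "(t has_derivative E x) (at x)" if "x \<in> ball x0 r" for x
    unfolding t_def E_def vec_sum
    by (intro has_derivative_sum has_derivative_scaleR_left) (use T that in blast)
  have t0: "t x0 = 0" using T by (simp add: t_def vec_eq_iff)
  have ts: "smooth_on (ball x0 r) t"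
  proof (rule smooth_onI_derivative[OF dt open_ball])
    show "smooth_on (ball x0 r) (\<lambda>x. E x v)" for v
      unfolding E_def vec_sum
      by (intro smooth_on_sum smooth_on_scaleR smooth_on_const open_ball smooth_on_subset[OF \<eta>(2) r(3)])
  qed
  have x0: "x0 \<in> ball x0 r" using r by simp
  have lE: "linear (E x)" if "x \<in> ball x0 r" for x using dt[OF that] by (rule has_derivative_linear)
  have E\<xi>: "E x (\<xi> a x) = axis a 1" if "x \<in> ball x0 r" for x a
    using dual[of x _ a] that r(3) by (auto simp: E_def vec_eq_iff axis_def)
  define N where "N = {v. E x0 v = 0}"
  \<comment> \<open>Projection onto the common kernel \<open>N\<close> of the forms at
    \<open>x0\<close>, along the span of the frame there.\<close>
  define P where "P = (\<lambda>v. v - (\<Sum>a\<in>UNIV. E x0 v $ a *\<^sub>R \<xi> a x0))"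
  have EP: "E x0 (\<Sum>a\<in>UNIV. \<tau> $ a *\<^sub>R \<xi> a x0) = \<tau>" for \<tau>
    using vec_sum[of "\<lambda>a. \<tau> $ a"]
    by (simp add: linear_sum[OF lE[OF x0]] linear_scale[OF lE[OF x0]] E\<xi>[OF x0])
  have lP: "linear P"
    unfolding P_def
    by (rule linearI) (simp_all add: linear_add[OF lE[OF x0]] linear_scale[OF lE[OF x0]] scaleR_add_left sum.distrib
        scaleR_diff_right scaleR_sum_right)
  have PN: "P v \<in> N" for v
    by (simp add: N_def P_def linear_diff[OF lE[OF x0]] EP)
  have subN: "subspace N" unfolding N_def by (rule linear_subspace_kernel[OF lE[OF x0]])
  \<comment> \<open>The kernel is complementary to the span of the frame, which has dimension
    \<open>CARD('s)\<close> because the forms detect its coefficients.\<close>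
  have "dim N = DIM('v)"
  proof -
    define m where "m = (\<lambda>\<tau>. \<Sum>a\<in>UNIV. \<tau> $ a *\<^sub>R \<xi> a x0)"
    have lm: "linear m"
      unfolding m_def by (rule linearI) (simp_all add: scaleR_add_left sum.distrib scaleR_sum_right)
    have "inj m" using EP by (metis injI m_def)
    then have "dim (range m) = CARD('s)"
      using dim_image_eq[OF lm, of UNIV] by (simp add: inj_on_subset dim_UNIV)
    moreover have "{x + y |x y. x \<in> N \<and> y \<in> range m} = UNIV"
    proof -
      have "v = P v + m (E x0 v)" for v by (simp add: P_def m_def)
      then show ?thesis using PN by blast
    qed
    moreover have "N \<inter> range m = {0}"
    proof
      show "N \<inter> range m \<subseteq> {0}"
      proof
        fix v assume "v \<in> N \<inter> range m"
        then obtain \<tau> where "v = m \<tau>" "E x0 (m \<tau>) = 0" by (auto simp: N_def)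
        then show "v \<in> {0}" using EP[of \<tau>] linear_0[OF lm] by (simp add: m_def)
      qed
      show "{0} \<subseteq> N \<inter> range m"
        using subspace_0[OF subN] linear_0[OF lm] by (metis Int_iff empty_subsetI insert_subset rangeI)
    qed
    ultimately show ?thesis
      using dim_sums_Int[OF subN linear_subspace_image[OF lm subspace_UNIV]] dim by (simp add: dim_UNIV)
  qed
  \<comment> \<open>The hyperplane directions \<open>N\<close> are identified linearly with the
    model space \<open>'v\<close>, which is possible by equality of dimensions.\<close>
  then obtain \<iota> :: "'e \<Rightarrow> 'v" and j :: "'v \<Rightarrow> 'e" where lin: "linear \<iota>" "linear j" and im: "\<iota> ` N = UNIV" "j ` UNIV = N"
    and inv: "\<And>v. v \<in> N \<Longrightarrow> j (\<iota> v) = v" "\<And>w. \<iota> (j w) = w"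
    using isometries_subspaces[OF subN subspace_UNIV] by (metis UNIV_I dim_UNIV)
  define Q where "Q = \<iota> \<circ> P"
  have lQ: "bounded_linear Q" using linear_compose[OF lP lin(1)] by (simp add: Q_def linear_conv_bounded_linear)
  \<comment> \<open>The points for which the return time \<open>- t x\<close> lies in the range on
    which the flow is controlled.\<close>
  define S1 where "S1 = {x \<in> ball x0 r. t x \<in> ball 0 \<delta>}"
  have S1: "open S1" "x0 \<in> S1"
    using continuous_open_preimage[OF smooth_on_continuous[OF ts] open_ball open_ball, of 0 \<delta>] r x0 t0
    by (auto simp: S1_def vimage_def Int_def)
  have S1r: "S1 \<subseteq> ball x0 r" by (auto simp: S1_def)
  have ts1: "smooth_on S1 t" by (rule smooth_on_subset[OF ts S1r])
  (* Y flows x back to the slice t = 0, hence it is constant along the frame. *)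
  define Y where "Y = (\<lambda>x. Q (\<Psi> (x, - t x)))"
  define C where "C = (\<lambda>x. (t x, Y x))"
  have o: "open (ball x0 r \<times> ball (0 :: real ^ 's) \<delta>)" by (simp add: open_Times)
  have in_dom: "(x, - t x) \<in> ball x0 r \<times> ball 0 \<delta>" if "x \<in> S1" for x using that by (simp add: S1_def)
  have C: "smooth_on S1 C"
    unfolding C_def Y_def
  proof (rule smooth_on_Pair[OF S1(1) ts1], rule smooth_on_bounded_linear[OF lQ S1(1)], rule smooth_on_compose[OF S1(1) o \<Psi>])
    show "smooth_on S1 (\<lambda>x. (x, - t x))"
      by (rule smooth_on_Pair[OF S1(1) smooth_on_id[OF S1(1)] smooth_on_bounded_linear[OF bounded_linear_minus[OF bounded_linear_ident] S1(1) ts1]])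
  qed (rule in_dom)
  have dC: "fder C x v = (E x v, Q (fder \<Psi> (x, - t x) (v, - E x v)))" if x: "x \<in> S1" for x v
  proof -
    have 1: "(t has_derivative E x) (at x)" using dt x S1r by blast
    have "((\<lambda>x. (x, - t x)) has_derivative (\<lambda>v. (v, - E x v))) (at x)"
      by (intro has_derivative_Pair has_derivative_ident has_derivative_minus 1)
    from smooth_on_chain[OF \<Psi> this in_dom[OF x]]
    have "(Y has_derivative (\<lambda>v. Q (fder \<Psi> (x, - t x) (v, - E x v)))) (at x)"
      unfolding Y_def by (rule bounded_linear.has_derivative[OF lQ])
    from fder_eqI[OF has_derivative_Pair[OF 1 this]] show ?thesis by (simp add: C_def)
  qed
  have dC\<xi>: "fder C x (\<xi> a x) = (axis a 1, 0)" if x: "x \<in> S1" for x a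
  proof -
    have "fder \<Psi> (x, - t x) (\<xi> a x, - axis a 1) = 0" using d\<Psi> in_dom[OF x] by simp
    then show ?thesis using x S1r E\<xi>[of x a] linear_0[OF bounded_linear.linear[OF lQ]] by (auto simp: dC[OF x])
  qed
  \<comment> \<open>From \<Psi>(x, 0) = x and the invariance identity, the differential of \<Psi> at
    \<open>(x0, 0)\<close> sends \<open>(v, 0)\<close> to \<open>v\<close> and each time direction
    to the corresponding frame vector. Returning by the time \<open>E x0 v\<close> therefore acts as
    the projection \<open>P\<close>.\<close>
  have dC0: "fder C x0 v = (E x0 v, \<iota> (P v))" for v
  proof -
    have D: "(\<Psi> has_derivative fder \<Psi> (x0, 0)) (at (x0, 0))"
      by (rule smooth_on_has_derivative[OF \<Psi>]) (use r in auto)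
    have lD: "linear (fder \<Psi> (x0, 0))" using D by (rule has_derivative_linear)
    have "((\<lambda>x. \<Psi> (x, 0)) has_derivative (\<lambda>v. fder \<Psi> (x0, 0) (v, 0))) (at x0)"
      by (rule smooth_on_chain[OF \<Psi>]) (use r in \<open>auto intro!: derivative_eq_intros\<close>)
    then have "((\<lambda>x. x) has_derivative (\<lambda>v. fder \<Psi> (x0, 0) (v, 0))) (at x0)" using \<Psi>0 by simp
    then have Dv: "fder \<Psi> (x0, 0) (v, 0) = v" for v using has_derivative_unique[OF _ has_derivative_ident] by metis
    have D\<tau>: "fder \<Psi> (x0, 0) (0, axis a 1) = \<xi> a x0" for a
    proof -
      have "fder \<Psi> (x0, 0) (\<xi> a x0, - axis a 1) = 0" using d\<Psi> x0 r(2) by simp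
      moreover have "(\<xi> a x0, - axis a 1) = (\<xi> a x0, 0) - (0, axis a (1::real))" by simp
      ultimately have "fder \<Psi> (x0, 0) (\<xi> a x0, 0) - fder \<Psi> (x0, 0) (0, axis a 1) = 0" using linear_diff[OF lD] by metis
      then show ?thesis by (simp add: Dv)
    qed
    have "(v, - E x0 v) = (v, 0) - (\<Sum>a\<in>UNIV. E x0 v $ a *\<^sub>R (0, axis a (1::real)))"
      using vec_sum[of "\<lambda>a. E x0 v $ a"] by (simp add: prod_eq_iff fst_sum snd_sum)
    then have "fder \<Psi> (x0, 0) (v, - E x0 v) = P v"
      by (simp only: linear_diff[OF lD] linear_sum[OF lD] linear_scale[OF lD] Dv D\<tau> P_def)
    moreover have "P w = w" if "w \<in> N" for w using that by (simp add: N_def P_def)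
    then have "P (P v) = P v" using PN by blast
    ultimately show ?thesis by (simp add: dC[OF S1(2)] t0 Q_def)
  qed
  \<comment> \<open>The explicit inverse of the differential of \<open>C\<close> at
    \<open>x0\<close>: kernel part from the second component, frame part from the first.\<close>
  define l where "l = (\<lambda>p. j (snd p) + (\<Sum>a\<in>UNIV. fst p $ a *\<^sub>R \<xi> a x0))"
  have jN: "E x0 (j w) = 0" for w using im(2) by (auto simp: N_def)
  have ll: "linear l"
    unfolding l_def
    by (rule linearI) (simp_all add: linear_add[OF lin(2)] linear_scale[OF lin(2)] scaleR_add_left sum.distrib
        scaleR_add_right scaleR_sum_right)
  have l_inv: "l (fder C x0 v) = v" for v
    by (simp add: dC0 l_def inv(1)[OF PN]) (simp add: P_def)
  have l_inj: "inj l"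
  proof (rule linear_injective_0[OF ll, THEN iffD2], intro allI impI)
    fix p assume p: "l p = 0"
    then have "E x0 (l p) = 0" using linear_0[OF lE[OF x0]] by simp
    then have "fst p = 0" by (simp add: l_def linear_add[OF lE[OF x0]] jN EP)
    moreover from this p have "j (snd p) = 0" by (simp add: l_def)
    then have "snd p = 0" using inv(2)[of "snd p"] linear_0[OF lin(1)] by simp
    ultimately show "p = 0" by (simp add: prod_eq_iff)
  qed
  obtain r2 \<delta>2 H where r2: "r2 > 0" "\<delta>2 > 0" "ball x0 r2 \<subseteq> S1" and inj: "inj_on C (ball x0 r2)"
    and H: "smooth_on (ball (C x0) \<delta>2) H" "\<forall>z\<in>ball (C x0) \<delta>2. H z \<in> ball x0 r2 \<and> C (H z) = z"
    by (rule smooth_inverse_function[OF S1 C ll l_inv l_inj])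
  define y0 where "y0 = Y x0"
  define \<epsilon> where "\<epsilon> = \<delta>2 / 2"
  let ?W = "ball (0 :: real ^ 's) \<epsilon> \<times> ball y0 \<epsilon>"
  have C0: "C x0 = (0, y0)" by (simp add: C_def t0 y0_def)
  have W: "?W \<subseteq> ball (C x0) \<delta>2"
  proof
    fix z assume z: "z \<in> ?W"
    have "norm (C x0 - z) \<le> norm (0 - fst z) + norm (y0 - snd z)"
      using norm_Pair_le[of "0 - fst z" "y0 - snd z"] by (cases z) (simp add: C0)
    also have "\<dots> < \<delta>2" using z by (auto simp: dist_norm \<epsilon>_def)
    finally show "z \<in> ball (C x0) \<delta>2" by (simp add: dist_norm)
  qed
  \<comment> \<open>The domain is cut down to the preimage of the box, so that \<open>C\<close> maps
    it bijectively onto a product of balls. The radius \<open>\<epsilon>\<close>, half of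
    \<open>\<delta>2\<close>, places this box inside the ball on which \<open>H\<close> inverts
    \<open>C\<close>.\<close>
  define U where "U = {x \<in> ball x0 r2. C x \<in> ?W}"
  have US1: "U \<subseteq> S1" using r2 by (auto simp: U_def)
  show ?thesis
  proof (rule that[of U \<epsilon> C y0 H])
    have "continuous_on (ball x0 r2) C" using smooth_on_continuous[OF C] r2(3) by (rule continuous_on_subset)
    from continuous_open_preimage[OF this open_ball, of ?W]
    show "open U" by (simp add: U_def vimage_def Int_def open_Times)
    show "x0 \<in> U" using r2 by (simp add: U_def C0 \<epsilon>_def)
    show "U \<subseteq> S" using US1 S1r r(3) by blast
    show "smooth_on U C" by (rule smooth_on_subset[OF C US1])
    show "smooth_on ?W H" by (rule smooth_on_subset[OF H(1) W])
    show "\<forall>x\<in>U. C x \<in> ?W \<and> H (C x) = x"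
    proof
      fix x assume x: "x \<in> U"
      then have 1: "C x \<in> ?W" "x \<in> ball x0 r2" unfolding U_def by blast+
      from H(2)[rule_format, OF subsetD[OF W 1(1)]]
      have "H (C x) = x" using inj_onD[OF inj, of "H (C x)" x] 1(2) by blast
      with 1 show "C x \<in> ?W \<and> H (C x) = x" by blast
    qed
    show "\<forall>z\<in>?W. H z \<in> U \<and> C (H z) = z"
    proof
      fix z assume z: "z \<in> ?W"
      from H(2)[rule_format, OF subsetD[OF W z]] z
      show "H z \<in> U \<and> C (H z) = z" unfolding U_def mem_Collect_eq by presburger
    qed
    show "\<forall>x\<in>U. \<forall>v. fst (fder C x v) = (\<chi> a. \<eta> a x v)"
      using dC US1 by (auto simp: E_def)
    show "\<forall>x\<in>U. \<forall>a. fder C x (\<xi> a x) = (axis a 1, 0)" using dC\<xi> US1 by blast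
  qed (use r2 in \<open>simp add: \<epsilon>_def\<close>)
qed

subsection \<open>Generalized Kenmotsu structures in a chart\<close>

lemma has_derivative_apply2:
  fixes T :: "'e::euclidean_space \<Rightarrow> 'f::euclidean_space \<Rightarrow> 'g::euclidean_space \<Rightarrow> 'b::real_normed_vector"
  assumes S: "open S" "x \<in> S" and T: "\<And>x. x \<in> S \<Longrightarrow> bilinear (T x)"
    "\<And>u v. (\<lambda>x. T x u v) differentiable (at x)"
    and X: "(X has_derivative X') (at x)" and Y: "(Y has_derivative Y') (at x)"
  shows "((\<lambda>x. T x (X x) (Y x)) has_derivative
    (\<lambda>w. fder (\<lambda>y. T y (X x) (Y x)) x w + T x (X' w) (Y x) + T x (X x) (Y' w))) (at x)"
proof -
  have l: "linear (\<lambda>u. T x u v)" "linear (T x u)" if "x \<in> S" for x u v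
    using T(1)[OF that] by (auto simp: bilinear_def)
  have 1: "((\<lambda>x. T x (X x) v) has_derivative (\<lambda>w. fder (\<lambda>y. T y (X x) v) x w + T x (X' w) v)) (at x)" for v
    by (rule has_derivative_apply[OF S, of "\<lambda>x u. T x u v"]) (use l T(2) X in auto)
  have "((\<lambda>x. T x (X x) (Y x)) has_derivative
    (\<lambda>w. fder (\<lambda>y. T y (X y) (Y x)) x w + T x (X x) (Y' w))) (at x)"
    by (rule has_derivative_apply[OF S, of "\<lambda>x v. T x (X x) v"]) (use l differentiableI[OF 1] Y in auto)
  then show ?thesis by (simp add: fder_eqI[OF 1])
qed

lemma smooth_on_apply2:
  fixes T :: "'e::euclidean_space \<Rightarrow> 'f::euclidean_space \<Rightarrow> 'g::euclidean_space \<Rightarrow> 'b::real_normed_vector"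
  assumes "open S" "\<And>x. x \<in> S \<Longrightarrow> bilinear (T x)" "\<And>u v. smooth_on S (\<lambda>x. T x u v)" "smooth_on S X" "smooth_on S Y"
  shows "smooth_on S (\<lambda>x. T x (X x) (Y x))"
proof -
  have l: "linear (\<lambda>u. T x u v)" "linear (T x u)" if "x \<in> S" for x u v
    using assms(2)[OF that] by (auto simp: bilinear_def)
  have 1: "smooth_on S (\<lambda>x. T x (X x) v)" for v
    by (rule smooth_on_apply[OF assms(1), of "\<lambda>x u. T x u v"]) (use l assms in auto)
  show ?thesis
    by (rule smooth_on_apply[OF assms(1), of "\<lambda>x v. T x (X x) v"]) (use l assms 1 in auto)
qed

lemma derivative_of_constant:
  assumes "open S" "x \<in> S" "\<And>y. y \<in> S \<Longrightarrow> f y = c" "(f has_derivative f') (at x)"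
  shows "f' w = 0"
proof -
  have "((\<lambda>_. c) has_derivative f') (at x)"
    by (rule has_derivative_transform_within_open[OF assms(4,1,2)]) (rule assms(3))
  then show ?thesis using has_derivative_unique[OF has_derivative_const] by metis
qed

text \<open>The structure equations are evaluated on constant coordinate fields, whose brackets
  vanish. With closed forms, normality is the vanishing of the Nijenhuis tensor, written out as
  \<open>normal\<close>; in \<open>dPhi\<close> the normalizing factors 1/3 of both sides have been
  cancelled.\<close>

locale local_kenmotsu =
  fixes S :: "'e::euclidean_space set" and \<phi> :: "'e \<Rightarrow> 'e \<Rightarrow> 'e" and \<eta> :: "'s::finite \<Rightarrow> 'e \<Rightarrow> 'e \<Rightarrow> real"
    and \<xi> :: "'s \<Rightarrow> 'e \<Rightarrow> 'e" and g :: "'e \<Rightarrow> 'e \<Rightarrow> 'e \<Rightarrow> real"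
  assumes S: "open S"
    and phi_linear: "\<And>x. x \<in> S \<Longrightarrow> linear (\<phi> x)" and phi_smooth: "\<And>v. smooth_on S (\<lambda>x. \<phi> x v)"
    and eta_linear: "\<And>a x. x \<in> S \<Longrightarrow> linear (\<eta> a x)" and eta_smooth: "\<And>a v. smooth_on S (\<lambda>x. \<eta> a x v)"
    and xi_smooth: "\<And>a. smooth_on S (\<xi> a)"
    and g_bilinear: "\<And>x. x \<in> S \<Longrightarrow> bilinear (g x)" and g_smooth: "\<And>u v. smooth_on S (\<lambda>x. g x u v)"
    and g_sym: "\<And>x u v. x \<in> S \<Longrightarrow> g x u v = g x v u" and g_pos: "\<And>x u. x \<in> S \<Longrightarrow> u \<noteq> 0 \<Longrightarrow> g x u u > 0"
    and phi_phi: "\<And>x u. x \<in> S \<Longrightarrow> \<phi> x (\<phi> x u) = - u + (\<Sum>a\<in>UNIV. \<eta> a x u *\<^sub>R \<xi> a x)"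
    and eta_xi: "\<And>x a b. x \<in> S \<Longrightarrow> \<eta> a x (\<xi> b x) = (if a = b then 1 else 0)"
    and g_phi: "\<And>x u v. x \<in> S \<Longrightarrow> g x (\<phi> x u) (\<phi> x v) = g x u v - (\<Sum>a\<in>UNIV. \<eta> a x u * \<eta> a x v)"
    and phi_skew: "\<And>x u v. x \<in> S \<Longrightarrow> g x v (\<phi> x u) = - g x u (\<phi> x v)"
    and eta_closed: "\<And>a x u v. x \<in> S \<Longrightarrow> fder (\<lambda>y. \<eta> a y v) x u = fder (\<lambda>y. \<eta> a y u) x v"
    and normal: "\<And>x u v. x \<in> S \<Longrightarrow> fder (\<lambda>y. \<phi> y v) x (\<phi> x u) - fder (\<lambda>y. \<phi> y u) x (\<phi> x v)
      + \<phi> x (fder (\<lambda>y. \<phi> y u) x v) - \<phi> x (fder (\<lambda>y. \<phi> y v) x u) = 0"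
    and dPhi: "\<And>x u v w. x \<in> S \<Longrightarrow> fder (\<lambda>y. g y v (\<phi> y w)) x u + fder (\<lambda>y. g y w (\<phi> y u)) x v
      + fder (\<lambda>y. g y u (\<phi> y v)) x w = 2 * (\<Sum>a\<in>UNIV. \<eta> a x u * g x v (\<phi> x w)
        + \<eta> a x v * g x w (\<phi> x u) + \<eta> a x w * g x u (\<phi> x v))"
begin

lemma g_linear: "x \<in> S \<Longrightarrow> linear (g x u)" "x \<in> S \<Longrightarrow> linear (\<lambda>u. g x u v)"
  using g_bilinear[of x] by (auto simp: bilinear_def)

lemma Phi_bilinear: "x \<in> S \<Longrightarrow> bilinear (\<lambda>u v. g x u (\<phi> x v))"
  using g_linear[of x] linear_compose[OF phi_linear[of x] g_linear(1)[of x]] by (auto simp: bilinear_def o_def)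

lemma Phi_smooth: "smooth_on S (\<lambda>x. g x u (\<phi> x v))"
  by (rule smooth_on_apply2[OF S g_bilinear g_smooth smooth_on_const[OF S] phi_smooth])

text \<open>The vector \<open>\<phi> x (\<xi> a x)\<close> has norm zero: by skewness its square is
  minus the product of \<open>\<xi> a x\<close> with \<open>\<phi> x (\<phi> x (\<xi> a x))\<close>,
  and the formula for the square of \<phi> makes the latter vector zero.\<close>

lemma phi_xi: assumes x: "x \<in> S" shows "\<phi> x (\<xi> a x) = 0"
proof (rule ccontr)
  assume "\<phi> x (\<xi> a x) \<noteq> 0"
  then have "g x (\<phi> x (\<xi> a x)) (\<phi> x (\<xi> a x)) > 0" by (rule g_pos[OF x])
  moreover have "\<phi> x (\<phi> x (\<xi> a x)) = 0"
    by (simp add: phi_phi[OF x] eta_xi[OF x] if_distrib[of "\<lambda>c. c *\<^sub>R _"] cong: if_cong)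
  then have "g x (\<phi> x (\<xi> a x)) (\<phi> x (\<xi> a x)) = 0"
    using phi_skew[OF x, of "\<phi> x (\<xi> a x)" "\<xi> a x"] linear_0[OF g_linear(1)[OF x]] by simp
  ultimately show False by simp
qed

lemma g_xi: assumes x: "x \<in> S" shows "g x v (\<xi> a x) = \<eta> a x v"
  using g_phi[OF x, of v "\<xi> a x"] phi_xi[OF x] linear_0[OF g_linear(1)[OF x]]
  by (simp add: eta_xi[OF x] if_distrib[of "\<lambda>c. _ * c"] cong: if_cong)

lemma eta_phi: assumes x: "x \<in> S" shows "\<eta> a x (\<phi> x v) = 0"
  using g_xi[OF x, of "\<phi> x v" a] g_sym[OF x, of "\<phi> x v" "\<xi> a x"] phi_skew[OF x, of "\<xi> a x" v]
    phi_xi[OF x] linear_0[OF g_linear(1)[OF x]] by simp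

lemma Phi_xi: assumes x: "x \<in> S" shows "g x (\<xi> a x) (\<phi> x v) = 0"
  using eta_phi[OF x] g_xi[OF x] g_sym[OF x] by metis

lemma eq_0I: assumes x: "x \<in> S" and "\<phi> x v = 0" "\<And>a. \<eta> a x v = 0" shows "v = 0"
  using phi_phi[OF x, of v] assms linear_0[OF phi_linear[OF x]] by simp

section \<open>Derivatives of the structure along the frame\<close>

lemma fder_phi_linear: assumes x: "x \<in> S"
  shows "linear (fder (\<lambda>y. \<phi> y v) x)" "linear (fder (\<lambda>y. \<eta> a y v) x)" "linear (fder (\<xi> a) x)"
    "linear (fder (\<lambda>y. g y u (\<phi> y v)) x)"
  using x by (auto intro!: linear_frechet_derivative smooth_on_differentiable[of S] phi_smooth eta_smooth xi_smooth Phi_smooth)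

text \<open>Differentiating the constant \<phi> \<xi> trades a derivative of \<phi> for one of the
  frame. The three lemmas that follow do the same with the constants \<eta>(\<xi>), \<eta>(\<phi> v)
  and \<Phi>(\<xi>, v).\<close>

lemma fder_phi_xi: assumes x: "x \<in> S"
  shows "fder (\<lambda>y. \<phi> y (\<xi> a x)) x w = - \<phi> x (fder (\<xi> a) x w)"
proof -
  have "((\<lambda>y. \<phi> y (\<xi> a y)) has_derivative (\<lambda>w. fder (\<lambda>y. \<phi> y (\<xi> a x)) x w + \<phi> x (fder (\<xi> a) x w))) (at x)"
    using x by (intro has_derivative_apply[OF S x] phi_linear smooth_on_differentiable[OF phi_smooth]
        smooth_on_has_derivative[OF xi_smooth])
  from derivative_of_constant[OF S x phi_xi this]
  have "fder (\<lambda>y. \<phi> y (\<xi> a x)) x w + \<phi> x (fder (\<xi> a) x w) = 0" .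
  then show ?thesis by (simp add: eq_neg_iff_add_eq_0)
qed

lemma eta_fder_xi: assumes x: "x \<in> S"
  shows "\<eta> b x (fder (\<xi> a) x w) = - fder (\<lambda>y. \<eta> b y (\<xi> a x)) x w"
proof -
  have "((\<lambda>y. \<eta> b y (\<xi> a y)) has_derivative (\<lambda>w. fder (\<lambda>y. \<eta> b y (\<xi> a x)) x w + \<eta> b x (fder (\<xi> a) x w))) (at x)"
    using x by (intro has_derivative_apply[OF S x] eta_linear smooth_on_differentiable[OF eta_smooth]
        smooth_on_has_derivative[OF xi_smooth])
  from derivative_of_constant[OF S x eta_xi this]
  have "fder (\<lambda>y. \<eta> b y (\<xi> a x)) x w + \<eta> b x (fder (\<xi> a) x w) = 0" .
  then show ?thesis by (simp add: eq_neg_iff_add_eq_0)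
qed

lemma eta_fder_phi: assumes x: "x \<in> S"
  shows "\<eta> b x (fder (\<lambda>y. \<phi> y v) x w) = - fder (\<lambda>y. \<eta> b y (\<phi> x v)) x w"
proof -
  have "((\<lambda>y. \<eta> b y (\<phi> y v)) has_derivative (\<lambda>w. fder (\<lambda>y. \<eta> b y (\<phi> x v)) x w + \<eta> b x (fder (\<lambda>y. \<phi> y v) x w))) (at x)"
    using x by (intro has_derivative_apply[OF S x] eta_linear smooth_on_differentiable[OF eta_smooth]
        smooth_on_has_derivative[OF phi_smooth])
  from derivative_of_constant[OF S x eta_phi this]
  have "fder (\<lambda>y. \<eta> b y (\<phi> x v)) x w + \<eta> b x (fder (\<lambda>y. \<phi> y v) x w) = 0" .
  then show ?thesis by (simp add: eq_neg_iff_add_eq_0)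
qed

lemma fder_Phi_xi: assumes x: "x \<in> S"
  shows "fder (\<lambda>y. g y (\<xi> a x) (\<phi> y v)) x w = - g x (fder (\<xi> a) x w) (\<phi> x v)"
proof -
  have "((\<lambda>y. g y (\<xi> a y) (\<phi> y v)) has_derivative
     (\<lambda>w. fder (\<lambda>y. g y (\<xi> a x) (\<phi> y v)) x w + g x (fder (\<xi> a) x w) (\<phi> x v))) (at x)"
    using x
    by (intro has_derivative_apply[OF S x, of "\<lambda>y u. g y u (\<phi> y v)"] g_linear smooth_on_differentiable[OF Phi_smooth]
        smooth_on_has_derivative[OF xi_smooth])
  from derivative_of_constant[OF S x Phi_xi this]
  have "fder (\<lambda>y. g y (\<xi> a x) (\<phi> y v)) x w + g x (fder (\<xi> a) x w) (\<phi> x v) = 0" .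
  then show ?thesis by (simp add: eq_neg_iff_add_eq_0)
qed

lemma fder_Phi_skew: assumes x: "x \<in> S"
  shows "fder (\<lambda>y. g y u (\<phi> y v)) x w = - fder (\<lambda>y. g y v (\<phi> y u)) x w"
proof -
  have "fder (\<lambda>y. g y u (\<phi> y v)) x = fder (\<lambda>y. - g y v (\<phi> y u)) x"
    by (rule fder_cong_open[OF S x]) (rule phi_skew)
  also have "\<dots> = (\<lambda>w. - fder (\<lambda>y. g y v (\<phi> y u)) x w)"
    by (intro fder_eqI has_derivative_minus smooth_on_has_derivative[OF Phi_smooth] x)
  finally show ?thesis by simp
qed

text \<open>Normality on two frame fields says that the square of \<phi> kills their bracket, and
  closedness says that every \<eta> kills it. The formula for the square of \<phi> leaves only the
  zero vector.\<close>

lemma xi_commute: assumes x: "x \<in> S"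
  shows "fder (\<xi> a) x (\<xi> b x) = fder (\<xi> b) x (\<xi> a x)"
proof -
  let ?Z = "fder (\<xi> a) x (\<xi> b x) - fder (\<xi> b) x (\<xi> a x)"
  have "\<phi> x (\<phi> x ?Z) = 0"
    using normal[OF x, of "\<xi> b x" "\<xi> a x"]
    by (simp add: phi_xi[OF x] linear_0[OF fder_phi_linear(1)[OF x]] linear_0[OF fder_phi_linear(3)[OF x]]
        linear_0[OF phi_linear[OF x]] fder_phi_xi[OF x]
        linear_neg[OF phi_linear[OF x]] linear_diff[OF phi_linear[OF x]])
  moreover have "\<eta> c x ?Z = 0" for c
    using eta_closed[OF x, of c "\<xi> a x" "\<xi> b x"]
    by (simp add: linear_diff[OF eta_linear[OF x]] eta_fder_xi[OF x])
  ultimately have "?Z = 0"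
    using phi_phi[OF x, of ?Z] by simp
  then show ?thesis by simp
qed

text \<open>This is the vanishing of the Lie derivative of \<phi> along \<xi> a, on a constant
  vector. Normality with \<xi> a in one slot shows that \<phi> kills the Lie derivative, closedness
  that every \<eta> does, and these maps together are injective.\<close>

lemma lie_phi: assumes x: "x \<in> S"
  shows "fder (\<lambda>y. \<phi> y v) x (\<xi> a x) + \<phi> x (fder (\<xi> a) x v) = fder (\<xi> a) x (\<phi> x v)"
proof -
  let ?Z = "fder (\<xi> a) x (\<phi> x v) - \<phi> x (fder (\<xi> a) x v) - fder (\<lambda>y. \<phi> y v) x (\<xi> a x)"
  have "\<phi> x ?Z = 0"
    using normal[OF x, of v "\<xi> a x"]
    by (simp add: phi_xi[OF x] linear_0[OF fder_phi_linear(1)[OF x]] linear_0[OF fder_phi_linear(3)[OF x]]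
        linear_0[OF phi_linear[OF x]] fder_phi_xi[OF x]
        linear_neg[OF phi_linear[OF x]] linear_diff[OF phi_linear[OF x]])
  moreover have "\<eta> c x ?Z = 0" for c
    using eta_closed[OF x, of c "\<xi> a x" "\<phi> x v"]
    by (simp add: linear_diff[OF eta_linear[OF x]] eta_fder_xi[OF x] eta_fder_phi[OF x] eta_phi[OF x])
  ultimately have "?Z = 0" by (rule eq_0I[OF x])
  then show ?thesis by (simp add: algebra_simps)
qed

text \<open>Cartan's formula in coordinates: contracting \<Phi> with \<xi> a gives zero, so the Lie
  derivative is the contraction of its exterior derivative, and in the sum over the forms only the
  a-th one pairs with \<xi> a.\<close>

lemma lie_Phi: assumes x: "x \<in> S"
  shows "fder (\<lambda>y. g y u (\<phi> y v)) x (\<xi> a x) + g x (fder (\<xi> a) x u) (\<phi> x v) + g x u (\<phi> x (fder (\<xi> a) x v))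
    = 2 * g x u (\<phi> x v)"
proof -
  have sum: "(\<Sum>b\<in>UNIV. \<eta> b x u * g x v (\<phi> x (\<xi> a x)) + \<eta> b x v * g x (\<xi> a x) (\<phi> x u) + \<eta> b x (\<xi> a x) * g x u (\<phi> x v))
    = g x u (\<phi> x v)"
    by (simp add: phi_xi[OF x] Phi_xi[OF x] eta_xi[OF x] linear_0[OF g_linear(1)[OF x]]
        if_distrib[of "\<lambda>c. c * _"] cong: if_cong)
  have "fder (\<lambda>y. g y v (\<phi> y (\<xi> a x))) x u = g x (fder (\<xi> a) x u) (\<phi> x v)"
    unfolding fder_Phi_skew[OF x, of v] fder_Phi_xi[OF x] by simp
  moreover have "fder (\<lambda>y. g y (\<xi> a x) (\<phi> y u)) x v = g x u (\<phi> x (fder (\<xi> a) x v))"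
    unfolding fder_Phi_xi[OF x] using phi_skew[OF x, of u] by simp
  ultimately show ?thesis using dPhi[OF x, where u = u and v = v and w = "\<xi> a x"] unfolding sum by simp
qed

end

section \<open>Inverse charts and transport in the coordinates t\<close>

lemma derivative_of_ident:
  assumes "open S" "x \<in> S" "\<And>y. y \<in> S \<Longrightarrow> f y = y" "(f has_derivative f') (at x)"
  shows "f' w = w"
proof -
  have "((\<lambda>y. y) has_derivative f') (at x)"
    by (rule has_derivative_transform_within_open[OF assms(4,1,2)]) (rule assms(3))
  then show ?thesis using has_derivative_unique[OF has_derivative_ident] by metis
qed

text \<open>Along the segment from 0 to \<open>t\<close> the equations in the coordinate directions
  add up to one linear equation with rate \<open>m\<close>, so multiplying by
  \<open>exp (- m * s)\<close> gives a constant. The rate \<open>c = 0\<close> will serve for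
  \<open>K\<close>, the rate \<open>c = 2\<close> for \<open>P\<close>.\<close>

lemma exponential_transport:
  fixes f :: "(real ^ 's::finite) \<times> 'v::euclidean_space \<Rightarrow> 'b::real_normed_vector"
  assumes f: "smooth_on (ball 0 \<epsilon> \<times> ball y0 \<epsilon>') f"
    and df: "\<And>z a. z \<in> ball 0 \<epsilon> \<times> ball y0 \<epsilon>' \<Longrightarrow> fder f z (axis a 1, 0) = c *\<^sub>R f z"
    and t: "t \<in> ball 0 \<epsilon>" and y: "y \<in> ball y0 \<epsilon>'"
  shows "f (t, y) = exp (c * (\<Sum>a\<in>UNIV. t $ a)) *\<^sub>R f (0, y)"
proof -
  define m where "m = c * (\<Sum>a\<in>UNIV. t $ a)"
  define q where "q = (\<lambda>s. exp (- m * s) *\<^sub>R f (s *\<^sub>R t, y))"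
  have "(q has_derivative (\<lambda>h. 0)) (at s within {0..1})" if s: "s \<in> {0..1}" for s
  proof -
    have "norm (s *\<^sub>R t) \<le> 1 * norm t" using s by (simp add: mult_left_le_one_le)
    with t y have z: "(s *\<^sub>R t, y) \<in> ball 0 \<epsilon> \<times> ball y0 \<epsilon>'" by simp
    have l: "linear (fder f (s *\<^sub>R t, y))"
      by (rule linear_frechet_derivative[OF smooth_on_differentiable[OF f z]])
    have dec: "(t, 0 :: 'v) = (\<Sum>a\<in>UNIV. t $ a *\<^sub>R (axis a 1, 0))"
      by (simp add: prod_eq_iff fst_sum snd_sum vec_eq_iff axis_def if_distrib[of "\<lambda>x. _ * x"] cong: if_cong)
    have "fder f (s *\<^sub>R t, y) (t, 0) = (\<Sum>a\<in>UNIV. t $ a *\<^sub>R c *\<^sub>R f (s *\<^sub>R t, y))"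
      by (subst dec) (simp only: linear_sum[OF l] linear_scale[OF l] df[OF z])
    then have "fder f (s *\<^sub>R t, y) (t, 0) = m *\<^sub>R f (s *\<^sub>R t, y)"
      by (simp add: m_def scaleR_sum_left sum_distrib_left mult.commute)
    moreover have "((\<lambda>s. (s *\<^sub>R t, y)) has_derivative (\<lambda>h. h *\<^sub>R (t, 0))) (at s)"
      by (auto intro!: derivative_eq_intros)
    from smooth_on_chain[OF f this z]
    have "((\<lambda>s. f (s *\<^sub>R t, y)) has_derivative (\<lambda>h. h *\<^sub>R fder f (s *\<^sub>R t, y) (t, 0))) (at s)"
      by (simp only: linear_scale[OF l])
    ultimately have 1: "((\<lambda>s. f (s *\<^sub>R t, y)) has_derivative (\<lambda>h. h *\<^sub>R m *\<^sub>R f (s *\<^sub>R t, y))) (at s)"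
      by simp
    have 2: "((\<lambda>s. exp (- m * s)) has_derivative (\<lambda>h. - m * h * exp (- m * s))) (at s)"
      by (auto intro!: derivative_eq_intros)
    have "(q has_derivative (\<lambda>h. exp (- m * s) *\<^sub>R (h *\<^sub>R m *\<^sub>R f (s *\<^sub>R t, y)) + (- m * h * exp (- m * s)) *\<^sub>R f (s *\<^sub>R t, y))) (at s)"
      unfolding q_def by (rule has_derivative_scaleR[OF 2 1])
    then have "(q has_derivative (\<lambda>h. 0)) (at s)"
      by (simp add: mult.commute mult.left_commute)
    then show ?thesis by (rule has_derivative_at_withinI)
  qed
  from has_derivative_zero_constant[OF _ this] obtain k where "\<forall>s\<in>{0..1}. q s = k" by (auto simp: convex_real_interval)
  then have "q 1 = q 0" by simp
  then have "exp m *\<^sub>R q 1 = exp m *\<^sub>R f (0, y)" by (simp add: q_def)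
  then show ?thesis by (simp add: q_def m_def[symmetric] flip: exp_add)
qed

section \<open>The structure in adapted coordinates\<close>

locale adapted_kenmotsu = local_kenmotsu S \<phi> \<eta> \<xi> g
  for S :: "'e::euclidean_space set" and \<phi> and \<eta> :: "'s::finite \<Rightarrow> 'e \<Rightarrow> 'e \<Rightarrow> real" and \<xi> g +
  fixes U :: "'e set" and C :: "'e \<Rightarrow> (real ^ 's) \<times> 'v::euclidean_space" and H and \<epsilon> :: real and y0 :: 'v
  assumes U: "open U" "U \<subseteq> S" and eps: "\<epsilon> > 0"
    and C_smooth: "smooth_on U C" and H_smooth: "smooth_on (ball 0 \<epsilon> \<times> ball y0 \<epsilon>) H"
    and HC: "\<And>x. x \<in> U \<Longrightarrow> C x \<in> ball 0 \<epsilon> \<times> ball y0 \<epsilon>" "\<And>x. x \<in> U \<Longrightarrow> H (C x) = x"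
    and CH: "\<And>z. z \<in> ball 0 \<epsilon> \<times> ball y0 \<epsilon> \<Longrightarrow> H z \<in> U" "\<And>z. z \<in> ball 0 \<epsilon> \<times> ball y0 \<epsilon> \<Longrightarrow> C (H z) = z"
    and fst_dC: "\<And>x v. x \<in> U \<Longrightarrow> fst (fder C x v) = (\<chi> a. \<eta> a x v)"
    and dC_xi: "\<And>x a. x \<in> U \<Longrightarrow> fder C x (\<xi> a x) = (axis a 1, 0)"
begin

text \<open>\<open>X\<close> embeds the directions of the slice; \<open>K\<close> and, below, \<open>P\<close> are \<open>\<phi>\<close> and \<open>\<Phi>\<close> on these
  directions, in the adapted coordinates \<open>z = (t, y)\<close>.\<close>

definition Z :: "((real ^ 's) \<times> 'v) set" where "Z = ball 0 \<epsilon> \<times> ball y0 \<epsilon>"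
definition X :: "(real ^ 's) \<times> 'v \<Rightarrow> 'v \<Rightarrow> 'e" where "X z u = fder H z (0, u)"
definition K :: "(real ^ 's) \<times> 'v \<Rightarrow> 'v \<Rightarrow> 'v" where "K z u = snd (fder C (H z) (\<phi> (H z) (X z u)))"

lemma Z: "open Z" by (simp add: Z_def open_Times)

lemma H_smooth': "smooth_on Z H" using H_smooth by (simp add: Z_def)

lemma HU: "z \<in> Z \<Longrightarrow> H z \<in> U" and HS: "z \<in> Z \<Longrightarrow> H z \<in> S"
  using CH U by (auto simp: Z_def)

lemma H_der: "z \<in> Z \<Longrightarrow> (H has_derivative fder H z) (at z)"
  by (rule smooth_on_has_derivative[OF H_smooth'])

lemma dH_linear: "z \<in> Z \<Longrightarrow> linear (fder H z)" using H_der has_derivative_linear by blast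

lemma dC_linear: "x \<in> U \<Longrightarrow> linear (fder C x)"
  by (rule linear_frechet_derivative[OF smooth_on_differentiable[OF C_smooth]])

lemma dH_dC: assumes "x \<in> U" shows "fder H (C x) (fder C x v) = v"
  by (rule derivative_of_ident[OF U(1) assms HC(2) smooth_on_chain[OF H_smooth smooth_on_has_derivative[OF C_smooth assms] HC(1)[OF assms]]])

lemma dC_dH: assumes "z \<in> Z" shows "fder C (H z) (fder H z w) = w"
  by (rule derivative_of_ident[OF Z assms _ smooth_on_chain[OF C_smooth H_der[OF assms] HU[OF assms]]])
    (simp add: CH Z_def)

lemma dH_xi: assumes "z \<in> Z" shows "fder H z (axis a 1, 0) = \<xi> a (H z)"
  using dH_dC[OF HU[OF assms], of "\<xi> a (H z)"] CH(2)[of z] assms by (simp add: dC_xi[OF HU[OF assms]] Z_def)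

lemma eta_dH: assumes "z \<in> Z" shows "\<eta> a (H z) (fder H z p) = fst p $ a"
  using fst_dC[OF HU[OF assms], of "fder H z p"] by (simp add: dC_dH[OF assms])

lemma X_linear: assumes "z \<in> Z" shows "linear (X z)"
  unfolding X_def
proof (rule linearI)
  show "fder H z (0, u + v) = fder H z (0, u) + fder H z (0, v)" for u v
    using linear_add[OF dH_linear[OF assms], of "(0, u)" "(0, v)"] by simp
  show "fder H z (0, c *\<^sub>R u) = c *\<^sub>R fder H z (0, u)" for c u
    using linear_scale[OF dH_linear[OF assms], of c "(0, u)"] by simp
qed

lemma X_inject: assumes "z \<in> Z" "X z u = X z v" shows "u = v"
proof -
  have "fder C (H z) (X z w) = (0, w)" for w unfolding X_def by (rule dC_dH[OF assms(1)])
  then show ?thesis using assms(2) by (metis prod.inject)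
qed

lemma eta_X: "z \<in> Z \<Longrightarrow> \<eta> a (H z) (X z u) = 0"
  by (simp add: X_def eta_dH)

lemma dH_decomp: assumes z: "z \<in> Z" shows "fder H z p = (\<Sum>a\<in>UNIV. fst p $ a *\<^sub>R \<xi> a (H z)) + X z (snd p)"
proof -
  have "p = (\<Sum>a\<in>UNIV. fst p $ a *\<^sub>R (axis a 1, 0)) + (0, snd p)"
    by (simp add: prod_eq_iff fst_sum snd_sum vec_eq_iff axis_def if_distrib[of "\<lambda>x. _ * x"] cong: if_cong)
  then have "fder H z p = fder H z ((\<Sum>a\<in>UNIV. fst p $ a *\<^sub>R (axis a 1, 0)) + (0, snd p))" by simp
  then show ?thesis
    by (simp only: linear_add[OF dH_linear[OF z]] linear_sum[OF dH_linear[OF z]] linear_scale[OF dH_linear[OF z]] dH_xi[OF z] X_def)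
qed

text \<open>The forms vanish on the image of \<phi>, so \<phi> maps slice directions to slice
  directions and is represented on them by \<open>K\<close>.\<close>

lemma phi_X: assumes z: "z \<in> Z" shows "\<phi> (H z) (X z u) = X z (K z u)"
proof -
  have "fst (fder C (H z) (\<phi> (H z) (X z u))) = 0"
    by (simp add: fst_dC[OF HU[OF z]] eta_phi[OF HS[OF z]] vec_eq_iff)
  then have "fder C (H z) (\<phi> (H z) (X z u)) = (0, K z u)" by (simp add: K_def prod_eq_iff)
  with dH_dC[OF HU[OF z], of "\<phi> (H z) (X z u)"] show ?thesis
    using CH(2)[of z] z by (simp add: X_def Z_def)
qed

lemma phi_dH: assumes z: "z \<in> Z" shows "\<phi> (H z) (fder H z p) = \<phi> (H z) (X z (snd p))"
  by (simp add: dH_decomp[OF z] linear_add[OF phi_linear[OF HS[OF z]]] linear_sum[OF phi_linear[OF HS[OF z]]]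
      linear_scale[OF phi_linear[OF HS[OF z]]] phi_xi[OF HS[OF z]])

lemma X_smooth: "smooth_on Z (\<lambda>z. X z u)"
  unfolding X_def by (rule smooth_on_fder[OF H_smooth'])

lemma phi_H_smooth: "smooth_on Z (\<lambda>z. \<phi> (H z) v)"
  by (rule smooth_on_compose[OF Z S phi_smooth H_smooth' HS])

lemma K_smooth: "smooth_on Z (\<lambda>z. K z u)"
  unfolding K_def
proof (rule smooth_on_bounded_linear[OF bounded_linear_snd Z],
    rule smooth_on_apply[OF Z, of "\<lambda>z. fder C (H z)" "\<lambda>z. \<phi> (H z) (X z u)"])
  show "smooth_on Z (\<lambda>z. fder C (H z) v)" for v
    by (rule smooth_on_compose[OF Z U(1) smooth_on_fder[OF C_smooth] H_smooth' HU])
  show "smooth_on Z (\<lambda>z. \<phi> (H z) (X z u))"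
    by (rule smooth_on_apply[OF Z, of "\<lambda>z. \<phi> (H z)", OF phi_linear[OF HS] phi_H_smooth X_smooth])
qed (rule dC_linear[OF HU])

lemma K_linear: assumes z: "z \<in> Z" shows "linear (K z)"
proof -
  have "linear (\<lambda>u. fder C (H z) (\<phi> (H z) (X z u)))"
    using linear_compose[OF linear_compose[OF X_linear[OF z] phi_linear[OF HS[OF z]]] dC_linear[OF HU[OF z]]]
    by (simp add: o_def)
  from linear_compose[OF this bounded_linear.linear[OF bounded_linear_snd]]
  show ?thesis by (simp add: K_def[abs_def] o_def)
qed

text \<open>Symmetry of the second derivatives of \<open>H\<close>, with the a-th coordinate
  direction replaced by the frame field it represents: coordinate fields commute.\<close>

lemma fder_X: assumes z: "z \<in> Z"
  shows "fder (\<lambda>z. X z u) z (axis a 1, 0) = fder (\<xi> a) (H z) (X z u)"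
proof -
  have "fder (\<lambda>z. fder H z (0, u)) z (axis a 1, 0) = fder (\<lambda>z. fder H z (axis a 1, 0)) z (0, u)"
    by (rule symmetric_second_derivative[OF Z z H_smooth'])
  also have "fder (\<lambda>z. fder H z (axis a 1, 0)) z = fder (\<lambda>z. \<xi> a (H z)) z"
    by (rule fder_cong_open[OF Z z dH_xi])
  also have "\<dots> = (\<lambda>w. fder (\<xi> a) (H z) (fder H z w))"
    by (rule fder_eqI[OF smooth_on_chain[OF xi_smooth H_der[OF z] HS[OF z]]])
  finally show ?thesis by (simp add: X_def)
qed

text \<open>Differentiating \<open>\<phi> (H z) (X z u) = X z (K z u)\<close> along a coordinate
  \<open>t\<close>, the invariance of \<phi> cancels everything except the derivative of
  \<open>K\<close>, and \<open>X\<close> is injective.\<close>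

lemma fder_K: assumes z: "z \<in> Z" shows "fder (\<lambda>z. K z u) z (axis a 1, 0) = 0"
proof -
  let ?e = "(axis a 1, 0)" and ?v = "X z u" and ?x = "H z"
  have 1: "((\<lambda>z. X z (K z u)) has_derivative
      (\<lambda>w. fder (\<lambda>z'. X z' (K z u)) z w + X z (fder (\<lambda>z. K z u) z w))) (at z)"
    by (rule has_derivative_apply[OF Z z X_linear smooth_on_differentiable[OF X_smooth z]
        smooth_on_has_derivative[OF K_smooth z]])
  have 2: "((\<lambda>z. \<phi> (H z) (X z u)) has_derivative
      (\<lambda>w. fder (\<lambda>z'. \<phi> (H z') ?v) z w + \<phi> ?x (fder (\<lambda>z. X z u) z w))) (at z)"
    by (rule has_derivative_apply[OF Z z phi_linear[OF HS] smooth_on_differentiable[OF phi_H_smooth z]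
        smooth_on_has_derivative[OF X_smooth z]])
  have 3: "fder (\<lambda>z'. \<phi> (H z') ?v) z = (\<lambda>w. fder (\<lambda>y. \<phi> y ?v) ?x (fder H z w))"
    by (rule fder_eqI[OF smooth_on_chain[OF phi_smooth H_der[OF z] HS[OF z]]])
  have "fder (\<lambda>z. \<phi> (H z) (X z u)) z = fder (\<lambda>z. X z (K z u)) z"
    by (rule fder_cong_open[OF Z z phi_X])
  from fun_cong[OF this, of ?e]
  have "fder (\<lambda>z'. X z' (K z u)) z ?e + X z (fder (\<lambda>z. K z u) z ?e)
     = fder (\<lambda>y. \<phi> y ?v) ?x (\<xi> a ?x) + \<phi> ?x (fder (\<xi> a) ?x ?v)"
    unfolding fder_eqI[OF 1] fder_eqI[OF 2] 3 by (simp add: dH_xi[OF z] fder_X[OF z])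
  then have "X z (fder (\<lambda>z. K z u) z ?e) = X z 0"
    using lie_phi[OF HS[OF z], of ?v a]
    by (simp add: fder_X[OF z] phi_X[OF z] linear_0[OF X_linear[OF z]])
  then show ?thesis by (rule X_inject[OF z])
qed

lemma K_transport: assumes "(t, y) \<in> Z" shows "K (t, y) u = K (0, y) u"
  using exponential_transport[of \<epsilon> y0 \<epsilon> "\<lambda>z. K z u" 0 t y] K_smooth fder_K assms by (simp add: Z_def)

lemma Phi_H_smooth: "smooth_on Z (\<lambda>z. g (H z) u (\<phi> (H z) v))"
  by (rule smooth_on_compose[OF Z S Phi_smooth H_smooth' HS])

definition P :: "(real ^ 's) \<times> 'v \<Rightarrow> 'v \<Rightarrow> 'v \<Rightarrow> real" where
  "P z u v = g (H z) (X z u) (\<phi> (H z) (X z v))"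

lemma P_smooth: "smooth_on Z (\<lambda>z. P z u v)"
  unfolding P_def
  by (rule smooth_on_apply2[OF Z, of "\<lambda>z u v. g (H z) u (\<phi> (H z) v)", OF Phi_bilinear[OF HS] Phi_H_smooth X_smooth X_smooth])

lemma fder_P: assumes z: "z \<in> Z" shows "fder (\<lambda>z. P z u v) z (axis a 1, 0) = 2 * P z u v"
proof -
  have 1: "((\<lambda>z. P z u v) has_derivative (\<lambda>w. fder (\<lambda>z'. g (H z') (X z u) (\<phi> (H z') (X z v))) z w
      + g (H z) (fder (\<lambda>z. X z u) z w) (\<phi> (H z) (X z v)) + g (H z) (X z u) (\<phi> (H z) (fder (\<lambda>z. X z v) z w)))) (at z)"
    unfolding P_def
    by (rule has_derivative_apply2[OF Z z, of "\<lambda>z u v. g (H z) u (\<phi> (H z) v)", OF Phi_bilinear[OF HS]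
          smooth_on_differentiable[OF Phi_H_smooth z] smooth_on_has_derivative[OF X_smooth z] smooth_on_has_derivative[OF X_smooth z]])
  have 2: "fder (\<lambda>z'. g (H z') (X z u) (\<phi> (H z') (X z v))) z = (\<lambda>w. fder (\<lambda>x. g x (X z u) (\<phi> x (X z v))) (H z) (fder H z w))"
    by (rule fder_eqI[OF smooth_on_chain[OF Phi_smooth H_der[OF z] HS[OF z]]])
  show ?thesis
    using lie_Phi[OF HS[OF z], of "X z u" "X z v" a]
    unfolding fder_eqI[OF 1] 2 by (simp add: dH_xi[OF z] fder_X[OF z] P_def)
qed

lemma P_transport: assumes "(t, y) \<in> Z" shows "P (t, y) u v = exp (2 * (\<Sum>a\<in>UNIV. t $ a)) * P (0, y) u v"
  using exponential_transport[of \<epsilon> y0 \<epsilon> "\<lambda>z. P z u v" 2 t y] P_smooth fder_P assms by (simp add: Z_def)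

text \<open>On slice directions the square of \<phi> is minus the identity, so the metric is
  recovered from \<Phi> and \<phi>. The independence of \<open>K\<close> from \<open>t\<close> and
  the exponential growth of \<open>P\<close> thereby pass to the metric.\<close>

lemma g_X: assumes z: "z \<in> Z"
  shows "g (H z) (X z u) (X z v) = - P z u (K z v)"
proof -
  have "\<phi> (H z) (X z (K z v)) = - X z v"
    by (simp add: phi_X[OF z, symmetric] phi_phi[OF HS[OF z]] eta_X[OF z])
  then show ?thesis by (simp add: P_def linear_neg[OF g_linear(1)[OF HS[OF z]]])
qed

section \<open>The induced structure on the slice\<close>

abbreviation V :: "'v set" where "V \<equiv> ball y0 \<epsilon>"
definition h :: "'v \<Rightarrow> 'e" where "h y = H (0, y)"
definition J :: "'v \<Rightarrow> 'v \<Rightarrow> 'v" where "J y u = K (0, y) u"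
definition G :: "'v \<Rightarrow> 'v \<Rightarrow> 'v \<Rightarrow> real" where "G y u v = g (h y) (fder h y u) (fder h y v)"

lemma slice: "y \<in> V \<Longrightarrow> (0, y) \<in> Z" using eps by (simp add: Z_def)

lemma hS: "y \<in> V \<Longrightarrow> h y \<in> S" by (simp add: h_def HS slice)

lemma slice_smooth: "smooth_on V (\<lambda>y. (0, y))"
  by (intro smooth_on_Pair smooth_on_const smooth_on_id open_ball)

lemma h_smooth: "smooth_on V h"
  unfolding h_def by (rule smooth_on_compose[OF open_ball Z H_smooth' slice_smooth slice])

lemma h_der: "y \<in> V \<Longrightarrow> (h has_derivative fder h y) (at y)"
  by (rule smooth_on_has_derivative[OF h_smooth])

lemma dh_eq: assumes y: "y \<in> V" shows "fder h y = X (0, y)"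
proof -
  have "((\<lambda>y. (0, y)) has_derivative (\<lambda>u. (0, u))) (at y)" by (auto intro!: derivative_eq_intros)
  from fder_eqI[OF smooth_on_chain[OF H_smooth' this slice[OF y]]]
  show ?thesis by (simp add: h_def[abs_def] X_def[abs_def])
qed

lemma dh_linear: "y \<in> V \<Longrightarrow> linear (fder h y)" by (simp add: dh_eq X_linear slice)

lemma phi_dh: assumes y: "y \<in> V" shows "\<phi> (h y) (fder h y u) = fder h y (J y u)"
  using phi_X[OF slice[OF y], of u] by (simp add: dh_eq[OF y] h_def J_def)

lemma eta_dh: "y \<in> V \<Longrightarrow> \<eta> a (h y) (fder h y u) = 0"
  by (simp add: dh_eq eta_X slice h_def)

lemma dh_inject: "y \<in> V \<Longrightarrow> fder h y u = fder h y v \<Longrightarrow> u = v"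
  using X_inject[OF slice] by (simp add: dh_eq)

lemma J_linear: "y \<in> V \<Longrightarrow> linear (J y)"
  using K_linear[OF slice] by (simp add: J_def[abs_def])

lemma J_smooth: "smooth_on V (\<lambda>y. J y u)"
  unfolding J_def by (rule smooth_on_compose[OF open_ball Z K_smooth slice_smooth slice])

lemma J_J: assumes y: "y \<in> V" shows "J y (J y u) = - u"
proof -
  have "fder h y (J y (J y u)) = - fder h y u"
    by (simp add: phi_dh[OF y, symmetric] phi_phi[OF hS[OF y]] eta_dh[OF y])
  then show ?thesis using dh_inject[OF y] linear_neg[OF dh_linear[OF y]] by metis
qed

lemma G_bilinear: assumes y: "y \<in> V" shows "bilinear (G y)"
proof -
  note gb = g_bilinear[OF hS[OF y]] and l = dh_linear[OF y]
  show ?thesis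
    unfolding bilinear_def G_def
    by (auto intro!: linearI simp: linear_add[OF l] linear_scale[OF l] bilinear_ladd[OF gb] bilinear_radd[OF gb]
        bilinear_lmul[OF gb] bilinear_rmul[OF gb])
qed

lemma G_smooth: "smooth_on V (\<lambda>y. G y u v)"
  unfolding G_def
  by (rule smooth_on_apply2[OF open_ball, of _ _ "\<lambda>y. g (h y)"])
    (auto intro!: g_bilinear hS smooth_on_fder h_smooth smooth_on_compose[OF open_ball S g_smooth h_smooth])

lemma G_sym: "y \<in> V \<Longrightarrow> G y u v = G y v u"
  by (simp add: G_def g_sym[OF hS])

lemma G_pos: assumes y: "y \<in> V" and "u \<noteq> 0" shows "G y u u > 0"
  unfolding G_def using assms dh_inject[OF y, of u 0] linear_0[OF dh_linear[OF y]] by (intro g_pos[OF hS]) auto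

lemma G_J: assumes y: "y \<in> V" shows "G y (J y u) (J y v) = G y u v"
  by (simp add: G_def phi_dh[OF y, symmetric] g_phi[OF hS[OF y]] eta_dh[OF y])

text \<open>The compatibility condition splits off the forms, which are the differentials of
  \<open>t\<close>; the remaining term g(\<phi> p, \<phi> q) sees only slice directions. Transport
  to \<open>t = 0\<close> multiplies it by the exponential of twice the sum, which is the square of
  the warping function.\<close>

lemma warped: assumes z: "(t, y) \<in> Z"
  shows "g (H (t, y)) (fder H (t, y) p) (fder H (t, y) q)
    = (\<Sum>a\<in>UNIV. fst p $ a * fst q $ a) + (exp (\<Sum>a\<in>UNIV. t $ a))\<^sup>2 * G y (snd p) (snd q)"
proof -
  have y: "y \<in> V" using z by (simp add: Z_def)
  let ?z = "(t, y)"
  have "g (H ?z) (fder H ?z p) (fder H ?z q) = g (H ?z) (\<phi> (H ?z) (fder H ?z p)) (\<phi> (H ?z) (fder H ?z q))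
      + (\<Sum>a\<in>UNIV. fst p $ a * fst q $ a)"
    by (simp add: g_phi[OF HS[OF z]] eta_dH[OF z])
  also have "g (H ?z) (\<phi> (H ?z) (fder H ?z p)) (\<phi> (H ?z) (fder H ?z q)) = g (H ?z) (X ?z (snd p)) (X ?z (snd q))"
    by (simp add: phi_dH[OF z] g_phi[OF HS[OF z]] eta_X[OF z])
  also have "\<dots> = - (exp (2 * (\<Sum>a\<in>UNIV. t $ a)) * P (0, y) (snd p) (K (0, y) (snd q)))"
    by (simp add: g_X[OF z] K_transport[OF z] P_transport[OF z])
  also have "\<dots> = (exp (\<Sum>a\<in>UNIV. t $ a))\<^sup>2 * G y (snd p) (snd q)"
    using g_X[OF slice[OF y], of "snd p" "snd q"] by (simp add: G_def dh_eq[OF y] h_def exp_double)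
  finally show ?thesis by simp
qed

abbreviation d2h :: "'v \<Rightarrow> 'v \<Rightarrow> 'v \<Rightarrow> 'e" where "d2h y w u \<equiv> fder (\<lambda>y. fder h y u) y w"

lemma d2h_sym: "y \<in> V \<Longrightarrow> d2h y w u = d2h y u w"
  by (rule symmetric_second_derivative[OF open_ball _ h_smooth])

text \<open>Differentiation of the intertwining relation between \<phi> and \<open>J\<close> along
  the slice. It expresses derivatives of \<open>J\<close> by those of \<phi> and second derivatives
  of the embedding.\<close>

lemma dh_fder_J: assumes y: "y \<in> V"
  shows "fder h y (fder (\<lambda>y. J y u) y w)
    = fder (\<lambda>x. \<phi> x (fder h y u)) (h y) (fder h y w) + \<phi> (h y) (d2h y w u) - d2h y w (J y u)"
proof -
  have s: "smooth_on V (\<lambda>y. fder h y u)" for u by (rule smooth_on_fder[OF h_smooth])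
  have p: "smooth_on V (\<lambda>y. \<phi> (h y) c)" for c
    by (rule smooth_on_compose[OF open_ball S phi_smooth h_smooth hS])
  have 1: "((\<lambda>y. fder h y (J y u)) has_derivative
      (\<lambda>w. d2h y w (J y u) + fder h y (fder (\<lambda>y. J y u) y w))) (at y)"
    by (rule has_derivative_apply[OF open_ball y dh_linear smooth_on_differentiable[OF s y] smooth_on_has_derivative[OF J_smooth y]])
  have 2: "((\<lambda>y. \<phi> (h y) (fder h y u)) has_derivative
      (\<lambda>w. fder (\<lambda>y'. \<phi> (h y') (fder h y u)) y w + \<phi> (h y) (d2h y w u))) (at y)"
    by (rule has_derivative_apply[OF open_ball y phi_linear[OF hS] smooth_on_differentiable[OF p y] smooth_on_has_derivative[OF s y]])
  have 3: "fder (\<lambda>y'. \<phi> (h y') (fder h y u)) y = (\<lambda>w. fder (\<lambda>x. \<phi> x (fder h y u)) (h y) (fder h y w))"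
    by (rule fder_eqI[OF smooth_on_chain[OF phi_smooth h_der[OF y] hS[OF y]]])
  have "fder (\<lambda>y. \<phi> (h y) (fder h y u)) y = fder (\<lambda>y. fder h y (J y u)) y"
    by (rule fder_cong_open[OF open_ball y phi_dh])
  from fun_cong[OF this, of w] show ?thesis
    unfolding fder_eqI[OF 1] fder_eqI[OF 2] 3 by (simp add: algebra_simps)
qed

text \<open>The differential of \<open>h\<close> carries this tensor to the Nijenhuis tensor of
  \<phi>: by symmetry the second derivatives of \<open>h\<close> cancel. It is injective, so the
  tensor vanishes on the slice.\<close>

lemma J_integrable: assumes y: "y \<in> V"
  shows "fder (\<lambda>y. J y v) y (J y u) - fder (\<lambda>y. J y u) y (J y v)
    + J y (fder (\<lambda>y. J y u) y v) - J y (fder (\<lambda>y. J y v) y u) = 0" (is "?N = 0")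
proof -
  note l = linear_add[OF dh_linear[OF y]] linear_diff[OF dh_linear[OF y]]
  note p = linear_add[OF phi_linear[OF hS[OF y]]] linear_diff[OF phi_linear[OF hS[OF y]]]
  have "fder h y ?N = 0"
    using normal[OF hS[OF y], where u = "fder h y u" and v = "fder h y v"]
      d2h_sym[OF y, of u v] d2h_sym[OF y, of u "J y v"] d2h_sym[OF y, of v "J y u"] d2h_sym[OF y, of "J y u" "J y v"]
    by (simp add: l phi_dh[OF y, symmetric] dh_fder_J[OF y] p)
  then show ?thesis using dh_inject[OF y, of ?N 0] linear_0[OF dh_linear[OF y]] by simp
qed

lemma fder_G_J: assumes y: "y \<in> V"
  shows "fder (\<lambda>y. G y u (J y v)) y w
    = fder (\<lambda>x. g x (fder h y u) (\<phi> x (fder h y v))) (h y) (fder h y w)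
      + g (h y) (d2h y w u) (\<phi> (h y) (fder h y v)) + g (h y) (fder h y u) (\<phi> (h y) (d2h y w v))"
proof -
  have s: "smooth_on V (\<lambda>y. fder h y u)" for u by (rule smooth_on_fder[OF h_smooth])
  have p: "smooth_on V (\<lambda>y. g (h y) u (\<phi> (h y) v))" for u v
    by (rule smooth_on_compose[OF open_ball S Phi_smooth h_smooth hS])
  have "((\<lambda>y. g (h y) (fder h y u) (\<phi> (h y) (fder h y v))) has_derivative
     (\<lambda>w. fder (\<lambda>y'. g (h y') (fder h y u) (\<phi> (h y') (fder h y v))) y w
      + g (h y) (d2h y w u) (\<phi> (h y) (fder h y v)) + g (h y) (fder h y u) (\<phi> (h y) (d2h y w v)))) (at y)"
    by (rule has_derivative_apply2[OF open_ball y, of "\<lambda>y u v. g (h y) u (\<phi> (h y) v)", OF Phi_bilinear[OF hS]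
          smooth_on_differentiable[OF p y] smooth_on_has_derivative[OF s y] smooth_on_has_derivative[OF s y]])
  moreover have "fder (\<lambda>y'. g (h y') (fder h y u) (\<phi> (h y') (fder h y v))) y
      = (\<lambda>w. fder (\<lambda>x. g x (fder h y u) (\<phi> x (fder h y v))) (h y) (fder h y w))"
    by (rule fder_eqI[OF smooth_on_chain[OF Phi_smooth h_der[OF y] hS[OF y]]])
  moreover have "fder (\<lambda>y. G y u (J y v)) y = fder (\<lambda>y. g (h y) (fder h y u) (\<phi> (h y) (fder h y v))) y"
    by (rule fder_cong_open[OF open_ball y]) (simp add: G_def phi_dh)
  ultimately show ?thesis by (simp add: fder_eqI)
qed

text \<open>\<open>G y u (J y v)\<close> is the pullback of \<Phi> by \<open>h\<close>. In the
  cyclic sum the second derivatives of \<open>h\<close> cancel in pairs by symmetry and skewness,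
  and the right-hand side for \<Phi> vanishes because every form does so on the slice.\<close>

lemma G_J_closed: assumes y: "y \<in> V"
  shows "fder (\<lambda>y. G y v (J y w)) y u + fder (\<lambda>y. G y w (J y u)) y v + fder (\<lambda>y. G y u (J y v)) y w = 0"
  using dPhi[OF hS[OF y], where u = "fder h y u" and v = "fder h y v" and w = "fder h y w"]
    phi_skew[OF hS[OF y], of "d2h y v u" "fder h y w"] phi_skew[OF hS[OF y], of "d2h y w u" "fder h y v"]
    phi_skew[OF hS[OF y], of "d2h y w v" "fder h y u"]
    d2h_sym[OF y, of u v] d2h_sym[OF y, of u w] d2h_sym[OF y, of v w]
  by (simp add: fder_G_J[OF y] eta_dh[OF y])

end

subsection \<open>Charts of a smooth manifold\<close>

context
  fixes M :: "('i, 'a, 'e::euclidean_space) manifold"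
  assumes M: "smooth_manifold M"
begin

lemma cdom_open: "i \<in> ind M \<Longrightarrow> openin (mtop M) (cdom M i)"
  and cimg_open: "i \<in> ind M \<Longrightarrow> open (cimg M i)"
  and chart_homeo: "i \<in> ind M \<Longrightarrow>
    homeomorphic_map (subtopology (mtop M) (cdom M i)) (top_of_set (cimg M i)) (cmap M i)"
  and transition_smooth: "i \<in> ind M \<Longrightarrow> j \<in> ind M \<Longrightarrow>
    smooth_on (cmap M i ` (cdom M i \<inter> cdom M j)) (cmap M j \<circ> cinv M i)"
  and charts_cover: "(\<Union>i\<in>ind M. cdom M i) = topspace (mtop M)"
  using M unfolding smooth_manifold_def by blast+

lemma topspace_chart: "i \<in> ind M \<Longrightarrow> topspace (subtopology (mtop M) (cdom M i)) = cdom M i"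
  using cdom_open openin_subset by (metis topspace_subtopology_subset)

lemma cmap_inj: "i \<in> ind M \<Longrightarrow> inj_on (cmap M i) (cdom M i)"
  using homeomorphic_imp_injective_map[OF chart_homeo] topspace_chart by metis

lemma cinv_cmap: "i \<in> ind M \<Longrightarrow> p \<in> cdom M i \<Longrightarrow> cinv M i (cmap M i p) = p"
  by (simp add: cinv_def cmap_inj)

lemma cmap_cinv: "x \<in> cimg M i \<Longrightarrow> cmap M i (cinv M i x) = x"
  and cinv_in: "x \<in> cimg M i \<Longrightarrow> cinv M i x \<in> cdom M i"
  by (simp_all add: cinv_def cimg_def f_inv_into_f inv_into_into)

lemma cmap_in: "p \<in> cdom M i \<Longrightarrow> cmap M i p \<in> cimg M i" by (simp add: cimg_def)

lemma open_image_chart: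
  assumes i: "i \<in> ind M" and W: "openin (mtop M) W" "W \<subseteq> cdom M i" shows "open (cmap M i ` W)"
proof -
  have "openin (subtopology (mtop M) (cdom M i)) W"
    using W by (simp add: openin_open_subtopology cdom_open[OF i])
  then have "openin (top_of_set (cimg M i)) (cmap M i ` W)"
    using homeomorphic_imp_open_map[OF chart_homeo[OF i]] by (auto simp: open_map_def)
  then show ?thesis using cimg_open[OF i] openin_open_eq by metis
qed

lemma open_overlap: "i \<in> ind M \<Longrightarrow> j \<in> ind M \<Longrightarrow> open (cmap M i ` (cdom M i \<inter> cdom M j))"
  by (rule open_image_chart) (auto intro: cdom_open)

lemma chart_continuous: "i \<in> ind M \<Longrightarrow>
    continuous_map (subtopology (mtop M) (cdom M i)) (top_of_set (cimg M i)) (cmap M i)"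
  by (rule homeomorphic_imp_continuous_map[OF chart_homeo])

lemma open_preimage_chart:
  assumes i: "i \<in> ind M" and A: "open A" shows "openin (mtop M) {p \<in> cdom M i. cmap M i p \<in> A}"
proof -
  have "openin (top_of_set (cimg M i)) (cimg M i \<inter> A)" using A by auto
  from openin_continuous_map_preimage[OF chart_continuous[OF i] this]
  have "openin (subtopology (mtop M) (cdom M i)) {p \<in> cdom M i. cmap M i p \<in> cimg M i \<inter> A}"
    unfolding topspace_chart[OF i] .
  moreover have "{p \<in> cdom M i. cmap M i p \<in> cimg M i \<inter> A} = {p \<in> cdom M i. cmap M i p \<in> A}"
    using cmap_in by auto
  ultimately show ?thesis using openin_trans_full[OF _ cdom_open[OF i]] by metis
qed

lemma cinv_continuous:
  assumes i: "i \<in> ind M"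
  shows "continuous_map (top_of_set (cimg M i)) (subtopology (mtop M) (cdom M i)) (cinv M i)"
proof -
  obtain G where G: "homeomorphic_maps (subtopology (mtop M) (cdom M i)) (top_of_set (cimg M i)) (cmap M i) G"
    using chart_homeo[OF i] homeomorphic_map_maps by blast
  then have c: "continuous_map (top_of_set (cimg M i)) (subtopology (mtop M) (cdom M i)) G"
    and inv: "\<And>p. p \<in> cdom M i \<Longrightarrow> G (cmap M i p) = p"
    using topspace_chart[OF i] by (auto simp: homeomorphic_maps_def)
  show ?thesis
  proof (rule continuous_map_eq[OF c])
    fix x assume "x \<in> topspace (top_of_set (cimg M i))"
    then have "x \<in> cimg M i" by simp
    then show "G x = cinv M i x" using inv[OF cinv_in] cmap_cinv by metis
  qed
qed

lemma tchange_has_derivative: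
  assumes "i \<in> ind M" "j \<in> ind M" "p \<in> cdom M i \<inter> cdom M j"
  shows "((\<lambda>x. cmap M j (cinv M i x)) has_derivative tchange M i j p) (at (cmap M i p))"
  using smooth_on_has_derivative[OF transition_smooth[OF assms(1,2)], of "cmap M i p"] assms(3)
  by (simp add: tchange_def o_def)

lemma tchange_self:
  assumes "i \<in> ind M" "p \<in> cdom M i" shows "tchange M i i p v = v"
  by (rule derivative_of_ident[OF cimg_open[OF assms(1)] cmap_in[OF assms(2)] _ tchange_has_derivative])
    (use assms cmap_cinv in auto)

lemma tchange_compose:
  assumes ijk: "i \<in> ind M" "j \<in> ind M" "k \<in> ind M" and p: "p \<in> cdom M i" "p \<in> cdom M j" "p \<in> cdom M k"
  shows "tchange M j k p (tchange M i j p v) = tchange M i k p v"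
proof -
  let ?A = "cmap M i ` (cdom M i \<inter> cdom M j \<inter> cdom M k)"
  have A: "open ?A" by (rule open_image_chart) (auto intro: cdom_open ijk)
  have pA: "cmap M i p \<in> ?A" using p by auto
  have d: "((\<lambda>x. cmap M j (cinv M i x)) has_derivative tchange M i j p) (at (cmap M i p))"
    by (rule tchange_has_derivative) (use ijk p in auto)
  have d': "((\<lambda>x. cmap M k (cinv M j x)) has_derivative tchange M j k p) (at (cmap M j (cinv M i (cmap M i p))))"
    using tchange_has_derivative[of j k p] ijk p by (simp add: cinv_cmap)
  have "((\<lambda>x. cmap M k (cinv M i x)) has_derivative (\<lambda>v. tchange M j k p (tchange M i j p v))) (at (cmap M i p))"
    by (rule has_derivative_transform_within_open[OF has_derivative_compose[OF d d'] A pA])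
      (use ijk in \<open>auto simp: cinv_cmap\<close>)
  moreover have "((\<lambda>x. cmap M k (cinv M i x)) has_derivative tchange M i k p) (at (cmap M i p))"
    by (rule tchange_has_derivative) (use ijk p in auto)
  ultimately show ?thesis using has_derivative_unique by metis
qed

lemma cimg_submanifold: "cimg (open_submanifold M U) i = cmap M i ` (cdom M i \<inter> U)"
  by (simp add: cimg_def open_submanifold_def)

lemma cinv_submanifold:
  assumes "i \<in> ind M" "x \<in> cmap M i ` (cdom M i \<inter> U)"
  shows "cinv (open_submanifold M U) i x = cinv M i x"
proof -
  obtain p where p: "x = cmap M i p" "p \<in> cdom M i \<inter> U" using assms(2) by blast
  have "inj_on (cmap M i) (cdom M i \<inter> U)" using cmap_inj[OF assms(1)] by (rule inj_on_subset) auto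
  with p have "cinv (open_submanifold M U) i x = p"
    by (simp add: cinv_def open_submanifold_def)
  then show ?thesis using p cinv_cmap[OF assms(1)] by simp
qed

lemma tchange_submanifold:
  assumes i: "i \<in> ind M" and U: "openin (mtop M) U" and p: "p \<in> cdom M i" "p \<in> U"
  shows "tchange (open_submanifold M U) i j p = tchange M i j p"
proof -
  have "open (cmap M i ` (cdom M i \<inter> U))"
    by (rule open_image_chart[OF i]) (auto intro: cdom_open[OF i] U)
  then have "fder (cmap M j \<circ> cinv (open_submanifold M U) i) (cmap M i p) = fder (cmap M j \<circ> cinv M i) (cmap M i p)"
    by (rule fder_cong_open) (use p cinv_submanifold[OF i] in auto)
  then show ?thesis by (simp add: tchange_def open_submanifold_def)
qed

text \<open>The differential conditions speak of vector fields on open subsets. A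
  coordinate-constant field on the domain of one chart provides test fields with prescribed value
  and no derivative; its expression in another chart is forced by the transition map, and the
  cocycle rule makes it consistent.\<close>

lemma constant_vector_field:
  assumes i: "i \<in> ind M"
  obtains X where "vector_field (open_submanifold M (cdom M i)) X" "X i = (\<lambda>_. v)"
proof -
  \<comment> \<open>In the chart \<open>i\<close> itself the representative is constant as a
    function on the whole model space, so it may be differentiated without any restriction to the
    chart image.\<close>
  define X where "X = (\<lambda>j x. if j = i then v else tchange M i j (cinv M j x) v)"
  have Xi: "X i = (\<lambda>_. v)" by (simp add: X_def)
  have X: "X j (cmap M j p) = tchange M i j p v" if "j \<in> ind M" "p \<in> cdom M j" "p \<in> cdom M i" for j p
    using that tchange_self[OF i] by (simp add: X_def cinv_cmap)
  have "vector_field (open_submanifold M (cdom M i)) X"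
    unfolding vector_field_def
  proof (intro conjI ballI)
    fix j assume "j \<in> ind (open_submanifold M (cdom M i))"
    then have j: "j \<in> ind M" by (simp add: open_submanifold_def)
    let ?A = "cmap M j ` (cdom M j \<inter> cdom M i)" and ?B = "cmap M i ` (cdom M i \<inter> cdom M j)"
    have sm: "smooth_on ?A (\<lambda>x. fder (cmap M j \<circ> cinv M i) ((cmap M i \<circ> cinv M j) x) v)"
      by (rule smooth_on_compose[OF open_overlap open_overlap smooth_on_fder[OF transition_smooth] transition_smooth])
        (use i j in \<open>auto simp: cinv_cmap\<close>)
    have eq: "fder (cmap M j \<circ> cinv M i) ((cmap M i \<circ> cinv M j) x) v = X j x" if "x \<in> ?A" for x
    proof -
      obtain p where p: "x = cmap M j p" "p \<in> cdom M j" "p \<in> cdom M i" using \<open>x \<in> ?A\<close> by blast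
      then show ?thesis using X[OF j p(2,3)] cinv_cmap[OF j] by (simp add: tchange_def)
    qed
    show "smooth_on (cimg (open_submanifold M (cdom M i)) j) (X j)"
      unfolding cimg_submanifold by (rule smooth_on_cong[OF open_overlap[OF j i] eq sm])
  next
    fix j k p
    assume "j \<in> ind (open_submanifold M (cdom M i))" "k \<in> ind (open_submanifold M (cdom M i))"
      "p \<in> cdom (open_submanifold M (cdom M i)) j \<inter> cdom (open_submanifold M (cdom M i)) k"
    then have jk: "j \<in> ind M" "k \<in> ind M" and p: "p \<in> cdom M i" "p \<in> cdom M j" "p \<in> cdom M k"
      by (auto simp: open_submanifold_def)
    have "X k (cmap M k p) = tchange M j k p (X j (cmap M j p))"
      by (simp add: X jk p tchange_compose i)
    then show "X k (cmap (open_submanifold M (cdom M i)) k p)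
        = tchange (open_submanifold M (cdom M i)) j k p (X j (cmap (open_submanifold M (cdom M i)) j p))"
      by (simp add: tchange_submanifold[OF jk(1) cdom_open[OF i] p(2,1)]) (simp add: open_submanifold_def)
  qed
  then show ?thesis using Xi by (rule that)
qed

end

subsection \<open>Tensor identities on constant vectors\<close>

text \<open>All derivatives of the fields \<open>X\<close> and \<open>Y\<close> cancel, which leaves
  an expression in their values at \<open>x\<close>. It serves both to read off the pointwise
  condition and to verify it for arbitrary fields.\<close>

lemma nijenhuis_tensorial:
  fixes \<phi> :: "('i, 'e::euclidean_space) endo"
  assumes S: "open S" "x \<in> S" and \<phi>: "\<And>x. x \<in> S \<Longrightarrow> linear (\<phi> i x)" "\<And>v. smooth_on S (\<lambda>x. \<phi> i x v)"
    and X: "smooth_on S (X i)" and Y: "smooth_on S (Y i)"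
  shows "nijenhuis \<phi> X Y i x = fder (\<lambda>y. \<phi> i y (Y i x)) x (\<phi> i x (X i x)) - fder (\<lambda>y. \<phi> i y (X i x)) x (\<phi> i x (Y i x))
    + \<phi> i x (fder (\<lambda>y. \<phi> i y (X i x)) x (Y i x)) - \<phi> i x (fder (\<lambda>y. \<phi> i y (Y i x)) x (X i x))"
proof -
  have d: "fder (\<lambda>y. \<phi> i y (Z i y)) x = (\<lambda>w. fder (\<lambda>y. \<phi> i y (Z i x)) x w + \<phi> i x (fder (Z i) x w))"
    if "smooth_on S (Z i)" for Z
    by (intro fder_eqI has_derivative_apply[OF S \<phi>(1) smooth_on_differentiable[OF \<phi>(2) S(2)] smooth_on_has_derivative[OF that S(2)]])
  note l = linear_diff[OF \<phi>(1)[OF S(2)]] linear_add[OF \<phi>(1)[OF S(2)]]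
  show ?thesis
    unfolding nijenhuis_def bracket_def app_def d[of X, OF X] d[of Y, OF Y] by (simp add: l)
qed

text \<open>The derivatives of the fields produced by the Leibniz rule cancel, by skewness, against
  the bracket terms.\<close>

lemma ext_d2_tensorial:
  fixes \<omega> :: "('i, 'e::euclidean_space) cov2"
  assumes S: "open S" "x \<in> S" and \<omega>: "\<And>x. x \<in> S \<Longrightarrow> bilinear (\<omega> i x)" "\<And>u v. smooth_on S (\<lambda>x. \<omega> i x u v)"
    and skew: "\<And>u v. \<omega> i x v u = - \<omega> i x u v"
    and X: "smooth_on S (X i)" and Y: "smooth_on S (Y i)" and Z: "smooth_on S (Z i)"
  shows "ext_d2 \<omega> X Y Z i x = (fder (\<lambda>y. \<omega> i y (Y i x) (Z i x)) x (X i x)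
    + fder (\<lambda>y. \<omega> i y (Z i x) (X i x)) x (Y i x) + fder (\<lambda>y. \<omega> i y (X i x) (Y i x)) x (Z i x)) / 3"
proof -
  have d: "fder (\<lambda>y. \<omega> i y (A i y) (B i y)) x = (\<lambda>w. fder (\<lambda>y. \<omega> i y (A i x) (B i x)) x w
      + \<omega> i x (fder (A i) x w) (B i x) + \<omega> i x (A i x) (fder (B i) x w))"
    if "smooth_on S (A i)" "smooth_on S (B i)" for A B
    by (intro fder_eqI has_derivative_apply2[OF S \<omega>(1) smooth_on_differentiable[OF \<omega>(2) S(2)]]
        smooth_on_has_derivative[OF _ S(2)] that)
  have l: "\<omega> i x (a - b) c = \<omega> i x a c - \<omega> i x b c" for a b c
    using bilinear_lsub[OF \<omega>(1)[OF S(2)]] by simp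
  show ?thesis
    unfolding ext_d2_def vdir_def ev2_def d[of Y Z, OF Y Z] d[of Z X, OF Z X] d[of X Y, OF X Y]
    using skew[of "X i x" "fder (Y i) x (Z i x)"] skew[of "Y i x" "fder (Z i) x (X i x)"] skew[of "Z i x" "fder (X i) x (Y i x)"]
    by (simp add: bracket_def l)
qed

text \<open>Skewness identifies the six permutations in pairs, giving twice the cyclic sum; division
  by 3! leaves the factor 1/3.\<close>

lemma wedge_1_2:
  assumes skew: "\<And>u v. \<omega> v u = - \<omega> u v"
  shows "wedge 1 2 (kform1 \<alpha>) (kform2 \<omega>) (\<lambda>k. [u, v, w] ! k) = (\<alpha> u * \<omega> v w + \<alpha> v * \<omega> w u + \<alpha> w * \<omega> u v) / 3"
proof -
  have set3: "{..<1 + 2 :: nat} = {0, 1, 2}" by auto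
  have f12: "finite {2 :: nat}" "1 \<notin> {2 :: nat}" by auto
  have f012: "finite {1, 2 :: nat}" "0 \<notin> {1, 2 :: nat}" by auto
  have "(\<Sum>\<sigma> | \<sigma> permutes {0, 1, 2 :: nat}. real_of_int (sign \<sigma>) * \<alpha> ([u, v, w] ! \<sigma> 0) * \<omega> ([u, v, w] ! \<sigma> 1) ([u, v, w] ! \<sigma> 2))
     = 2 * (\<alpha> u * \<omega> v w + \<alpha> v * \<omega> w u + \<alpha> w * \<omega> u v)"
    unfolding sum_over_permutations_insert[OF f012] sum_over_permutations_insert[OF f12] permutes_sing
    using skew[of u v] skew[of v w] skew[of u w]
    by (simp add: sign_swap_id sign_compose permutation_swap_id sign_id swap_id_eq Transposition.transpose_def algebra_simps)
  then show ?thesis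
    unfolding wedge_def set3 by (simp add: kform1_def kform2_def fact_numeral numeral_2_eq_2 numeral_3_eq_3)
qed

text \<open>Each global identity is tested on fields that are constant in the chart
  \<open>i\<close>, on the domain of that chart. The pointwise conditions come straight from the
  definition.\<close>

theorem generalized_Kenmotsu_local:
  fixes M :: "('i, 'a, 'e::euclidean_space) manifold" and \<eta> :: "'s::finite \<Rightarrow> ('i, 'e) form1"
  assumes K: "generalized_Kenmotsu n M \<phi> \<eta> \<xi> g" and i: "i \<in> ind M"
  shows "local_kenmotsu (cimg M i) (\<phi> i) (\<lambda>a. \<eta> a i) (\<lambda>a. \<xi> a i) (g i)"
proof -
  have K1: "metric_f_manifold n M \<phi> \<eta> \<xi> g" and closed: "\<And>a. closed_1form M (\<eta> a)"
    and dPhi: "\<And>U X Y Z i x. openin (mtop M) U \<Longrightarrow> vector_field (open_submanifold M U) X \<Longrightarrow>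
      vector_field (open_submanifold M U) Y \<Longrightarrow> vector_field (open_submanifold M U) Z \<Longrightarrow> i \<in> ind M \<Longrightarrow>
      x \<in> cimg (open_submanifold M U) i \<Longrightarrow> ext_d2 (fundamental_form \<phi> g) X Y Z i x
           = 2 * (\<Sum>a\<in>UNIV. wedge12 (\<eta> a) (fundamental_form \<phi> g) X Y Z i x)"
    and normal: "normal_f_structure M \<phi> \<eta> \<xi>"
    using K unfolding generalized_Kenmotsu_def generalized_almost_Kenmotsu_def almost_s_contact_metric_manifold_def by blast+
  have M: "smooth_manifold M" and \<phi>: "endo_field M \<phi>" and \<eta>: "\<And>a. one_form M (\<eta> a)" and \<xi>: "\<And>a. vector_field M (\<xi> a)"
    and g: "riemannian_metric M g" and Phi: "two_form M (fundamental_form \<phi> g)"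
    using K1 unfolding metric_f_manifold_def by blast+
  let ?U = "cdom M i" and ?S = "cimg M i"
  have S: "open ?S" by (rule cimg_open[OF M i])
  have U: "openin (mtop M) ?U" by (rule cdom_open[OF M i])
  have SU: "cimg (open_submanifold M ?U) i = ?S" unfolding cimg_submanifold[OF M] by (simp add: cimg_def)
  have phi: "linear (\<phi> i x)" "smooth_on ?S (\<lambda>x. \<phi> i x v)" if "x \<in> ?S" for x v
    using \<phi> i that unfolding endo_field_def by blast+
  have phi_s: "smooth_on ?S (\<lambda>x. \<phi> i x v)" for v
    using \<phi> i unfolding endo_field_def by blast
  have eta: "linear (\<eta> a i x)" if "x \<in> ?S" for a x
    using \<eta> i that unfolding one_form_def by blast
  have eta_s: "smooth_on ?S (\<lambda>x. \<eta> a i x v)" for a v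
    using \<eta> i unfolding one_form_def by blast
  have Phi_b: "bilinear (fundamental_form \<phi> g i x)" if "x \<in> ?S" for x
    using Phi i that unfolding two_form_def covariant2_def by blast
  have Phi_s: "smooth_on ?S (\<lambda>x. fundamental_form \<phi> g i x u v)" for u v
    using Phi i unfolding two_form_def covariant2_def by blast
  have Phi_skew: "fundamental_form \<phi> g i x v u = - fundamental_form \<phi> g i x u v" if "x \<in> ?S" for x u v
    using Phi i that unfolding two_form_def by blast
  have d1: "ext_d1 (\<eta> a) X Y i x = 0"
    if "vector_field (open_submanifold M ?U) X" "vector_field (open_submanifold M ?U) Y" "x \<in> ?S" for a X Y x
    using closed[of a] U i that SU unfolding closed_1form_def by blast
  have nij: "nijenhuis \<phi> X Y i x = 0"
    if "vector_field (open_submanifold M ?U) X" "vector_field (open_submanifold M ?U) Y" "x \<in> ?S" for X Y x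
  proof -
    have "nijenhuis \<phi> X Y i x + 2 *\<^sub>R (\<Sum>a\<in>UNIV. ext_d1 (\<eta> a) X Y i x *\<^sub>R \<xi> a i x) = 0"
      using normal U i that SU unfolding normal_f_structure_def by blast
    then show ?thesis by (simp add: d1[OF that])
  qed
  show ?thesis
  proof (rule local_kenmotsu.intro)
    fix x assume x: "x \<in> ?S"
    show "linear (\<phi> i x)" by (rule phi[OF x])
    show "linear (\<eta> a i x)" for a by (rule eta[OF x])
    show "bilinear (g i x)" "g i x u v = g i x v u" "u \<noteq> 0 \<Longrightarrow> g i x u u > 0" for u v
      using g i x unfolding riemannian_metric_def covariant2_def by blast+
    show "\<phi> i x (\<phi> i x u) = - u + (\<Sum>a\<in>UNIV. \<eta> a i x u *\<^sub>R \<xi> a i x)"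
      "\<eta> a i x (\<xi> b i x) = (if a = b then 1 else 0)"
      "g i x (\<phi> i x u) (\<phi> i x v) = g i x u v - (\<Sum>a\<in>UNIV. \<eta> a i x u * \<eta> a i x v)" for u v a b
      using K1 i x unfolding metric_f_manifold_def by blast+
    show "g i x v (\<phi> i x u) = - g i x u (\<phi> i x v)" for u v
      by (rule Phi_skew[OF x, unfolded fundamental_form_def])
    fix u v w
    obtain X where X: "vector_field (open_submanifold M ?U) X" "X i = (\<lambda>_. u)" by (rule constant_vector_field[OF M i])
    obtain Y where Y: "vector_field (open_submanifold M ?U) Y" "Y i = (\<lambda>_. v)" by (rule constant_vector_field[OF M i])
    obtain Z where Z: "vector_field (open_submanifold M ?U) Z" "Z i = (\<lambda>_. w)" by (rule constant_vector_field[OF M i])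
    show "fder (\<lambda>y. \<eta> a i y v) x u = fder (\<lambda>y. \<eta> a i y u) x v" for a
      using d1[OF X(1) Y(1) x, of a] linear_0[OF eta[OF x]]
      by (simp add: ext_d1_def vdir_def ev1_def bracket_def X(2) Y(2))
    have s: "smooth_on ?S (X i)" "smooth_on ?S (Y i)" "smooth_on ?S (Z i)"
      by (simp_all add: X Y Z smooth_on_const[OF S])
    show "fder (\<lambda>y. \<phi> i y v) x (\<phi> i x u) - fder (\<lambda>y. \<phi> i y u) x (\<phi> i x v)
      + \<phi> i x (fder (\<lambda>y. \<phi> i y u) x v) - \<phi> i x (fder (\<lambda>y. \<phi> i y v) x u) = 0"
      using nij[OF X(1) Y(1) x] nijenhuis_tensorial[where \<phi> = \<phi> and i = i and X = X and Y = Y, OF S x phi(1) phi_s s(1,2)] by (simp add: X(2) Y(2))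
    let ?P = "fundamental_form \<phi> g i"
    have "ext_d2 (fundamental_form \<phi> g) X Y Z i x = 2 * (\<Sum>a\<in>UNIV. wedge12 (\<eta> a) (fundamental_form \<phi> g) X Y Z i x)"
      using x SU by (intro dPhi[OF U X(1) Y(1) Z(1) i]) simp
    moreover have "ext_d2 (fundamental_form \<phi> g) X Y Z i x
        = (fder (\<lambda>y. ?P y v w) x u + fder (\<lambda>y. ?P y w u) x v + fder (\<lambda>y. ?P y u v) x w) / 3"
      using ext_d2_tensorial[where \<omega> = "fundamental_form \<phi> g" and i = i and X = X and Y = Y and Z = Z,
          OF S x Phi_b Phi_s Phi_skew[OF x] s] by (simp add: X(2) Y(2) Z(2))
    moreover have "wedge12 (\<eta> a) (fundamental_form \<phi> g) X Y Z i x
        = (\<eta> a i x u * ?P x v w + \<eta> a i x v * ?P x w u + \<eta> a i x w * ?P x u v) / 3" for a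
      unfolding wedge12_def X(2) Y(2) Z(2) by (rule wedge_1_2[OF Phi_skew[OF x]])
    \<comment> \<open>The exterior derivative and the wedge product both carry the factor 1/3, which
      cancels and leaves the coefficient 2.\<close>
    ultimately have "fder (\<lambda>y. ?P y v w) x u + fder (\<lambda>y. ?P y w u) x v + fder (\<lambda>y. ?P y u v) x w
        = 2 * (\<Sum>a\<in>UNIV. \<eta> a i x u * ?P x v w + \<eta> a i x v * ?P x w u + \<eta> a i x w * ?P x u v)"
      by (simp add: sum_divide_distrib[symmetric])
    then show "fder (\<lambda>y. g i y v (\<phi> i y w)) x u + fder (\<lambda>y. g i y w (\<phi> i y u)) x v + fder (\<lambda>y. g i y u (\<phi> i y v)) x w
       = 2 * (\<Sum>a\<in>UNIV. \<eta> a i x u * g i x v (\<phi> i x w) + \<eta> a i x v * g i x w (\<phi> i x u) + \<eta> a i x w * g i x u (\<phi> i x v))"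
      by (simp add: fundamental_form_def)
  next
    show "smooth_on ?S (\<lambda>x. g i x u v)" for u v
      using g i unfolding riemannian_metric_def covariant2_def by blast
    show "smooth_on ?S (\<xi> a i)" for a using \<xi> i unfolding vector_field_def by blast
  qed (use S phi_s eta_s in auto)
qed

subsection \<open>Open subsets of Euclidean space as manifolds\<close>

definition domain_manifold :: "'e::euclidean_space set \<Rightarrow> (nat, 'e, 'e) manifold" where
  "domain_manifold W = \<lparr> mtop = top_of_set W, ind = {0}, cdom = (\<lambda>_. W), cmap = (\<lambda>_ x. x) \<rparr>"

lemma domain_manifold_simps [simp]:
  "mtop (domain_manifold W) = top_of_set W" "ind (domain_manifold W) = {0}"
  "cdom (domain_manifold W) i = W" "cmap (domain_manifold W) i = (\<lambda>x. x)" "cimg (domain_manifold W) i = W"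
  by (simp_all add: domain_manifold_def cimg_def)

lemma cinv_domain [simp]: "x \<in> W \<Longrightarrow> cinv (domain_manifold W) i x = x"
  using inv_into_f_f[of "\<lambda>x. x" W x] by (simp add: cinv_def domain_manifold_def)

lemma second_countable_euclidean: "second_countable (euclidean :: 'a::second_countable_topology topology)"
proof -
  obtain B :: "'a set set" where B: "countable B" "topological_basis B" using ex_countable_basis by blast
  then show ?thesis
    unfolding second_countable_def using topological_basis_open[OF B(2)] topological_basisE[OF B(2)]
    by (intro exI[of _ B]) (metis open_openin)
qed

lemma smooth_manifold_domain: assumes W: "open W" shows "smooth_manifold (domain_manifold W)"
  unfolding smooth_manifold_def
proof (intro conjI ballI)
  show "Hausdorff_space (mtop (domain_manifold W))" by (simp add: Hausdorff_space_subtopology)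
  show "second_countable (mtop (domain_manifold W))"
    by (simp add: second_countable_subtopology second_countable_euclidean)
  fix i j assume "i \<in> ind (domain_manifold W)" "j \<in> ind (domain_manifold W)"
  show "smooth_on (cmap (domain_manifold W) i ` (cdom (domain_manifold W) i \<inter> cdom (domain_manifold W) j))
     (cmap (domain_manifold W) j \<circ> cinv (domain_manifold W) i)"
    by (rule smooth_on_cong[OF _ _ smooth_on_subset[OF smooth_on_id[OF W]]]) (use W in auto)
next
  fix i
  have "homeomorphic_map (top_of_set W) (top_of_set W) (\<lambda>x. x)" using homeomorphic_map_id[of "top_of_set W" "top_of_set W"] by (simp add: id_def)
  then show "homeomorphic_map (subtopology (mtop (domain_manifold W)) (cdom (domain_manifold W) i))
     (top_of_set (cimg (domain_manifold W) i)) (cmap (domain_manifold W) i)"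
    by (simp add: domain_manifold_def cimg_def subtopology_subtopology)
qed (use W in auto)

lemma tchange_domain: assumes "open W" "p \<in> W" shows "tchange (domain_manifold W) i j p v = v"
proof -
  have "fder (cmap (domain_manifold W) j \<circ> cinv (domain_manifold W) i) p = fder (\<lambda>x. x) p"
    by (rule fder_cong_open[OF assms]) simp
  then show ?thesis by (simp add: tchange_def)
qed

lemma covariant2_domain:
  assumes "open W" "\<And>x. x \<in> W \<Longrightarrow> bilinear (\<omega> 0 x)" "\<And>u v. smooth_on W (\<lambda>x. \<omega> 0 x u v)"
  shows "covariant2 (domain_manifold W) \<omega>"
  using assms by (simp add: covariant2_def tchange_domain)

lemma endo_field_domain:
  assumes "open W" "\<And>x. x \<in> W \<Longrightarrow> linear (\<omega> 0 x)" "\<And>v. smooth_on W (\<lambda>x. \<omega> 0 x v)"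
  shows "endo_field (domain_manifold W) \<omega>"
  using assms by (simp add: endo_field_def tchange_domain)

lemma vector_field_domain:
  assumes "vector_field (open_submanifold (domain_manifold W) U) X" shows "smooth_on (W \<inter> U) (X 0)"
proof -
  have "smooth_on (cimg (open_submanifold (domain_manifold W) U) 0) (X 0)"
    using assms by (simp add: vector_field_def open_submanifold_def)
  then show ?thesis by (simp add: cimg_def open_submanifold_def)
qed

text \<open>Integrability and closedness are required for arbitrary fields on arbitrary open subsets
  of the slice; tensoriality reduces both to the identities already proved for constant
  vectors.\<close>

lemma (in adapted_kenmotsu) kaehler_slice: "kaehler_manifold (domain_manifold V) (\<lambda>_. J) (\<lambda>_. G)"
  unfolding kaehler_manifold_def closed_2form_def
proof (intro conjI allI impI ballI)
  show "smooth_manifold (domain_manifold V)" by (rule smooth_manifold_domain[OF open_ball])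
  show "endo_field (domain_manifold V) (\<lambda>_. J)"
    by (rule endo_field_domain[OF open_ball]) (use J_linear J_smooth in auto)
  have "covariant2 (domain_manifold V) (\<lambda>_. G)"
    by (rule covariant2_domain[OF open_ball]) (use G_bilinear G_smooth in auto)
  then show "riemannian_metric (domain_manifold V) (\<lambda>_. G)"
    unfolding riemannian_metric_def using G_sym G_pos by auto
next
  fix i x u assume "x \<in> cimg (domain_manifold V) i"
  then show "J x (J x u) = - u" using J_J by simp
next
  fix i x u v assume "x \<in> cimg (domain_manifold V) i"
  then show "G x (J x u) (J x v) = G x u v" using G_J by simp
next
  fix U' X' Y and i :: nat and x
  assume U': "openin (mtop (domain_manifold V)) U'" and X': "vector_field (open_submanifold (domain_manifold V) U') X'"
    and Y: "vector_field (open_submanifold (domain_manifold V) U') Y" and i: "i \<in> ind (domain_manifold V)"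
    and x: "x \<in> cimg (open_submanifold (domain_manifold V) U') i"
  have o: "open (V \<inter> U')" using U' open_ball[of y0 \<epsilon>] by (simp add: openin_open_eq open_Int)
  have x: "x \<in> V \<inter> U'" using x by (simp add: cimg_def open_submanifold_def)
  have "nijenhuis (\<lambda>_. J) X' Y 0 x = 0"
    using nijenhuis_tensorial[where \<phi> = "\<lambda>_::nat. J" and i = 0 and X = X' and Y = Y, OF o x]
      J_linear smooth_on_subset[OF J_smooth] vector_field_domain[OF X'] vector_field_domain[OF Y] J_integrable x
    by auto
  then show "nijenhuis (\<lambda>_. J) X' Y i x = 0" using i by simp
next
  fix U' X' Y Z' and i :: nat and x
  assume U': "openin (mtop (domain_manifold V)) U'" and X': "vector_field (open_submanifold (domain_manifold V) U') X'"
    and Y: "vector_field (open_submanifold (domain_manifold V) U') Y"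
    and Z': "vector_field (open_submanifold (domain_manifold V) U') Z'" and i: "i \<in> ind (domain_manifold V)"
    and x: "x \<in> cimg (open_submanifold (domain_manifold V) U') i"
  have o: "open (V \<inter> U')" using U' open_ball[of y0 \<epsilon>] by (simp add: openin_open_eq open_Int)
  have x: "x \<in> V \<inter> U'" using x by (simp add: cimg_def open_submanifold_def)
  then have xV: "x \<in> V" by simp
  let ?\<omega> = "fundamental_form (\<lambda>_::nat. J) (\<lambda>_. G)"
  have b: "bilinear (?\<omega> 0 y)" if "y \<in> V \<inter> U'" for y
    using that G_bilinear[of y] linear_compose[OF J_linear[of y], of "G y u" for u]
    by (auto simp: bilinear_def fundamental_form_def o_def)
  have s: "smooth_on (V \<inter> U') (\<lambda>y. ?\<omega> 0 y u v)" for u v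
    unfolding fundamental_form_def
    by (rule smooth_on_apply2[OF o, of G]) (use G_bilinear smooth_on_subset[OF G_smooth] smooth_on_subset[OF J_smooth] o
        in \<open>auto intro!: smooth_on_const\<close>)
  \<comment> \<open>Skewness follows from invariance of the metric under \<open>J\<close>, applied
    to \<open>v\<close> and \<open>J x u\<close>, and from \<open>J_J\<close>.\<close>
  have sk: "?\<omega> 0 x v u = - ?\<omega> 0 x u v" for u v
    using G_J[OF xV, of v "J x u"] G_sym[OF xV, of u "J x v"] linear_neg[OF J_linear[OF xV]] bilinear_rneg[OF G_bilinear[OF xV]]
    by (simp add: fundamental_form_def J_J[OF xV])
  have "ext_d2 ?\<omega> X' Y Z' 0 x = 0"
    using ext_d2_tensorial[where \<omega> = ?\<omega> and i = 0 and X = X' and Y = Y and Z = Z', OF o x b s sk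
        vector_field_domain[OF X'] vector_field_domain[OF Y] vector_field_domain[OF Z']] G_J_closed[OF xV]
    by (simp add: fundamental_form_def)
  then show "ext_d2 ?\<omega> X' Y Z' i x = 0" using i by simp
qed

section \<open>The flat factor\<close>

lemma flat_metric_domain:
  assumes W: "open W" "x \<in> W"
  shows "flat_metric (domain_manifold W) (\<lambda>x. x) i x u v = (\<Sum>a\<in>UNIV. u $ a * v $ a)"
proof -
  have "differential (domain_manifold W) (\<lambda>p. p $ a) i x = (\<lambda>u. u $ a)" for a
  proof -
    have "fder ((\<lambda>p. p $ a) \<circ> cinv (domain_manifold W) i) x = fder (\<lambda>p. p $ a) x"
      by (rule fder_cong_open[OF W]) simp
    also have "\<dots> = (\<lambda>u. u $ a)"
      by (rule fder_eqI[OF bounded_linear_imp_has_derivative[OF bounded_linear_vec_nth]])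
    finally show ?thesis by (simp add: differential_def)
  qed
  then show ?thesis by (simp add: flat_metric_def)
qed

lemma coordinates_on_domain:
  fixes W :: "(real ^ 's::finite) set"
  assumes W: "open W" shows "coordinates_on (domain_manifold W) (\<lambda>x. x)"
proof -
  let ?E = "open_submanifold euclidean_manifold W"
  have E: "mtop ?E = top_of_set W" "ind ?E = UNIV" "\<And>i. cdom ?E i = W" "\<And>i. cmap ?E i = (\<lambda>x. x)"
    by (simp_all add: open_submanifold_def euclidean_manifold_def)
  have cinv_E: "cinv ?E i x = x" if "x \<in> W" for i x
    using that inv_into_f_f[of "\<lambda>x. x" W x] by (simp add: cinv_def E)
  have "diffeomorphism (domain_manifold W) ?E (\<lambda>x. x)"
    unfolding diffeomorphism_def smooth_map_def
  proof (intro exI[of _ "\<lambda>x. x"] conjI ballI)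
    show "homeomorphic_maps (mtop (domain_manifold W)) (mtop ?E) (\<lambda>x. x) (\<lambda>x. x)"
      "continuous_map (mtop (domain_manifold W)) (mtop ?E) (\<lambda>x. x)" "continuous_map (mtop ?E) (mtop (domain_manifold W)) (\<lambda>x. x)"
      by (simp_all add: E homeomorphic_maps_def)
  next
    fix i j
    show "smooth_on (cmap (domain_manifold W) i ` (cdom (domain_manifold W) i \<inter> (\<lambda>x. x) -` cdom ?E j))
       (cmap ?E j \<circ> (\<lambda>x. x) \<circ> cinv (domain_manifold W) i)"
      by (rule smooth_on_cong[OF _ _ smooth_on_subset[OF smooth_on_id[OF W]]]) (use W in \<open>auto simp: E\<close>)
    show "smooth_on (cmap ?E j ` (cdom ?E j \<inter> (\<lambda>x. x) -` cdom (domain_manifold W) i))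
       (cmap (domain_manifold W) i \<circ> (\<lambda>x. x) \<circ> cinv ?E j)"
      by (rule smooth_on_cong[OF _ _ smooth_on_subset[OF smooth_on_id[OF W]]]) (use W in \<open>auto simp: E cinv_E\<close>)
  qed
  with W show ?thesis unfolding coordinates_on_def by blast
qed

lemma flat_manifold_domain:
  assumes W: "open W"
  shows "flat_manifold (domain_manifold W) (\<lambda>x. x) (flat_metric (domain_manifold W) (\<lambda>x. x))"
proof -
  let ?h = "flat_metric (domain_manifold W) (\<lambda>x. x)"
  note h = flat_metric_domain[OF W]
  have "covariant2 (domain_manifold W) ?h"
  proof (rule covariant2_domain[OF W])
    show "bilinear (?h 0 x)" if "x \<in> W" for x
      unfolding bilinear_def
      by (auto intro!: linearI simp: h[OF that] algebra_simps sum.distrib sum_distrib_left)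
    show "smooth_on W (\<lambda>x. ?h 0 x u v)" for u v
      by (rule smooth_on_cong[OF W _ smooth_on_const[OF W]]) (rule h[symmetric])
  qed
  moreover have "?h 0 x v u = ?h 0 x u v" "u \<noteq> 0 \<Longrightarrow> ?h 0 x u u > 0" if "x \<in> W" for x u v
  proof -
    show "?h 0 x v u = ?h 0 x u v" by (simp add: h[OF that] mult.commute)
    have "(\<Sum>a\<in>UNIV. u $ a * u $ a) = u \<bullet> u" by (simp add: inner_vec_def)
    then show "u \<noteq> 0 \<Longrightarrow> ?h 0 x u u > 0" by (simp add: h[OF that])
  qed
  ultimately have "riemannian_metric (domain_manifold W) ?h" by (simp add: riemannian_metric_def)
  then show ?thesis
    using smooth_manifold_domain[OF W] coordinates_on_domain[OF W] by (simp add: flat_manifold_def)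
qed

section \<open>The product manifold and isometries onto it\<close>

lemma product_domain_simps:
  "mtop (product_manifold (domain_manifold W) (domain_manifold V)) = top_of_set (W \<times> V)"
  "ind (product_manifold (domain_manifold W) (domain_manifold V)) = {(0, 0)}"
  "cdom (product_manifold (domain_manifold W) (domain_manifold V)) k = W \<times> V"
  "cmap (product_manifold (domain_manifold W) (domain_manifold V)) k = (\<lambda>x. x)"
  "z \<in> W \<times> V \<Longrightarrow> cinv (product_manifold (domain_manifold W) (domain_manifold V)) k z = z"
proof -
  let ?N = "product_manifold (domain_manifold W) (domain_manifold V)"
  show "mtop ?N = top_of_set (W \<times> V)" "ind ?N = {(0, 0)}" and d: "cdom ?N k = W \<times> V" for k
    by (simp_all add: product_manifold_def case_prod_beta)
  show c: "cmap ?N k = (\<lambda>x. x)" for k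
    by (simp add: product_manifold_def case_prod_beta domain_manifold_def)
  show "cinv ?N k z = z" if "z \<in> W \<times> V"
    using that inv_into_f_f[of "\<lambda>x. x" "W \<times> V" z] by (simp add: cinv_def c d)
qed

text \<open>A coordinate change inside one chart becomes an isometry of manifolds. Smoothness and
  the metric condition have to hold in every chart of \<open>M\<close>; both reduce to the chart
  \<open>i\<close> by composing with transition maps.\<close>

lemma chart_isometry:
  fixes M :: "('i, 'a, 'e::euclidean_space) manifold"
    and W :: "'b::euclidean_space set" and V :: "'v::euclidean_space set"
  assumes M: "smooth_manifold M" and i: "i \<in> ind M" and g: "covariant2 M g"
    and U: "open U" "U \<subseteq> cimg M i" and WV: "open W" "open V"
    and C: "smooth_on U C" "\<And>x. x \<in> U \<Longrightarrow> C x \<in> W \<times> V" "\<And>x. x \<in> U \<Longrightarrow> H (C x) = x"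
    and H: "smooth_on (W \<times> V) H" "\<And>z. z \<in> W \<times> V \<Longrightarrow> H z \<in> U" "\<And>z. z \<in> W \<times> V \<Longrightarrow> C (H z) = z"
    and metric: "\<And>x u v. x \<in> U \<Longrightarrow> gN (0, 0) (C x) (fder C x u) (fder C x v) = g i x u v"
  shows "isometry (open_submanifold M {p \<in> cdom M i. cmap M i p \<in> U}) g
    (product_manifold (domain_manifold W) (domain_manifold V)) gN (C \<circ> cmap M i)"
proof -
  define UM where "UM = {p \<in> cdom M i. cmap M i p \<in> U}"
  let ?M = "open_submanifold M UM" and ?N = "product_manifold (domain_manifold W) (domain_manifold V)"
  let ?F = "C \<circ> cmap M i" and ?F' = "cinv M i \<circ> H"
  have UM: "openin (mtop M) UM" unfolding UM_def by (rule open_preimage_chart[OF M i U(1)])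
  have UMi: "UM \<subseteq> cdom M i" by (auto simp: UM_def)
  have M': "mtop ?M = subtopology (mtop M) UM" "ind ?M = ind M" "\<And>j. cdom ?M j = cdom M j \<inter> UM" "\<And>j. cmap ?M j = cmap M j"
    by (simp_all add: open_submanifold_def)
  note N = product_domain_simps
  have o: "open (W \<times> V)" using WV by (rule open_Times)
  have tUM: "topspace (subtopology (mtop M) UM) = UM" using openin_subset[OF UM] by auto
  have F_in: "?F p \<in> W \<times> V" if "p \<in> UM" for p using that C(2) by (auto simp: UM_def)
  have F'_in: "?F' z \<in> UM" if "z \<in> W \<times> V" for z
  proof -
    have "H z \<in> U" by (rule H(2)[OF that])
    then show ?thesis using U(2) cinv_in[OF M] cmap_cinv[OF M] by (auto simp: UM_def)
  qed
  have F'F: "?F' (?F p) = p" if "p \<in> UM" for p using that C(3) cinv_cmap[OF M i] by (auto simp: UM_def)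
  have FF': "?F (?F' z) = z" if "z \<in> W \<times> V" for z using H(2,3)[OF that] U(2) cmap_cinv[OF M] by auto
  have Fc: "continuous_map (subtopology (mtop M) UM) (top_of_set (W \<times> V)) ?F"
  proof (rule continuous_map_compose[where X' = "top_of_set U"])
    have "continuous_map (subtopology (mtop M) UM) (top_of_set (cimg M i)) (cmap M i)"
      by (rule continuous_map_from_subtopology_mono[OF chart_continuous[OF M i] UMi])
    then show "continuous_map (subtopology (mtop M) UM) (top_of_set U) (cmap M i)"
      by (auto simp: continuous_map_in_subtopology UM_def)
    show "continuous_map (top_of_set U) (top_of_set (W \<times> V)) C"
      using C(2) smooth_on_continuous[OF C(1)] by auto
  qed
  have F'c: "continuous_map (top_of_set (W \<times> V)) (subtopology (mtop M) UM) ?F'"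
  proof (rule continuous_map_into_subtopology)
    have "continuous_map (top_of_set (W \<times> V)) (top_of_set (cimg M i)) H"
      using H(2) U(2) smooth_on_continuous[OF H(1)] by auto
    from continuous_map_compose[OF this cinv_continuous[OF M i]]
    show "continuous_map (top_of_set (W \<times> V)) (mtop M) ?F'" by (simp add: continuous_map_in_subtopology)
    show "?F' \<in> topspace (top_of_set (W \<times> V)) \<rightarrow> UM" using F'_in by auto
  qed
  have loc: "smooth_on (cmap M j ` (cdom M j \<inter> UM)) (\<lambda>x. C ((cmap M i \<circ> cinv M j) x))" 
    and oj: "open (cmap M j ` (cdom M j \<inter> UM))" if j: "j \<in> ind M" for j
  proof -
    show oj: "open (cmap M j ` (cdom M j \<inter> UM))"
      by (rule open_image_chart[OF M j]) (auto intro: cdom_open[OF M j] UM)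
    show "smooth_on (cmap M j ` (cdom M j \<inter> UM)) (\<lambda>x. C ((cmap M i \<circ> cinv M j) x))"
    proof (rule smooth_on_compose[OF oj U(1) C(1)])
      show "smooth_on (cmap M j ` (cdom M j \<inter> UM)) (cmap M i \<circ> cinv M j)"
        by (rule smooth_on_subset[OF transition_smooth[OF M j i]]) (use UMi in auto)
    qed (auto simp: cinv_cmap[OF M j] UM_def)
  qed
  have eq_loc: "(cmap ?N k \<circ> ?F \<circ> cinv ?M j) x = C ((cmap M i \<circ> cinv M j) x)"
    if "j \<in> ind M" "x \<in> cmap M j ` (cdom M j \<inter> UM)" for j k x
    by (simp add: N cinv_submanifold[OF M that])
  have "smooth_map ?M ?N ?F"
    unfolding smooth_map_def
  proof (intro conjI ballI)
    show "continuous_map (mtop ?M) (mtop ?N) ?F" using Fc by (simp add: M' N)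
    fix j k assume "j \<in> ind ?M" "k \<in> ind ?N"
    then have j: "j \<in> ind M" by (simp add: M')
    have A: "cmap ?M j ` (cdom ?M j \<inter> ?F -` cdom ?N k) = cmap M j ` (cdom M j \<inter> UM)"
      using F_in by (auto simp: M' N)
    show "smooth_on (cmap ?M j ` (cdom ?M j \<inter> ?F -` cdom ?N k)) (cmap ?N k \<circ> ?F \<circ> cinv ?M j)"
      unfolding A by (rule smooth_on_cong[OF oj[OF j] eq_loc[OF j, symmetric] loc[OF j]])
  qed
  moreover have "smooth_map ?N ?M ?F'"
    unfolding smooth_map_def
  proof (intro conjI ballI)
    show "continuous_map (mtop ?N) (mtop ?M) ?F'" using F'c by (simp add: M' N)
    fix k j assume "k \<in> ind ?N" "j \<in> ind ?M"
    then have j: "j \<in> ind M" by (simp add: M')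
    let ?A = "{z \<in> W \<times> V. H z \<in> cmap M i ` (cdom M i \<inter> cdom M j)}"
    have A: "cmap ?N k ` (cdom ?N k \<inter> ?F' -` cdom ?M j) = ?A"
    proof -
      have iff: "?F' z \<in> cdom M j \<inter> UM \<longleftrightarrow> H z \<in> cmap M i ` (cdom M i \<inter> cdom M j)" if "z \<in> W \<times> V" for z
      proof -
        have Hz: "H z \<in> cimg M i" using H(2)[OF that] U(2) by blast
        have "?F' z \<in> UM" by (rule F'_in[OF that])
        then show ?thesis
          using cmap_cinv[OF M Hz] cinv_in[OF M Hz] cinv_cmap[OF M i] by (auto intro!: image_eqI)
      qed
      have "cmap ?N k ` (cdom ?N k \<inter> ?F' -` cdom ?M j) = {z \<in> W \<times> V. ?F' z \<in> cdom M j \<inter> UM}"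
        by (auto simp: M' N)
      also have "\<dots> = ?A" by (intro Collect_cong conj_cong refl iff)
      finally show ?thesis .
    qed
    have oA: "open ?A"
      using continuous_open_preimage[OF smooth_on_continuous[OF H(1)] o open_overlap[OF M i j]]
      by (simp add: vimage_def Int_def)
    have "smooth_on ?A (\<lambda>z. (cmap M j \<circ> cinv M i) (H z))"
      by (rule smooth_on_compose[OF oA open_overlap[OF M i j] transition_smooth[OF M i j] smooth_on_subset[OF H(1)]]) auto
    then show "smooth_on (cmap ?N k ` (cdom ?N k \<inter> ?F' -` cdom ?M j)) (cmap ?M j \<circ> ?F' \<circ> cinv ?N k)"
      unfolding A by (rule smooth_on_cong[OF oA, rotated]) (simp add: M' N)
  qed
  ultimately have "diffeomorphism ?M ?N ?F"
    unfolding diffeomorphism_def homeomorphic_maps_def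
    using Fc F'c F'F FF' by (intro exI[of _ ?F']) (simp add: M' N tUM)
  moreover have "gN k (cmap ?N k (?F p)) (fder (cmap ?N k \<circ> ?F \<circ> cinv ?M j) (cmap ?M j p) u)
      (fder (cmap ?N k \<circ> ?F \<circ> cinv ?M j) (cmap ?M j p) v) = g j (cmap ?M j p) u v"
    if "j \<in> ind ?M" "k \<in> ind ?N" "p \<in> cdom ?M j \<inter> ?F -` cdom ?N k" for j k p u v
  proof -
    have j: "j \<in> ind M" and k: "k = (0, 0)" and pj: "p \<in> cdom M j" "p \<in> UM"
      using that by (auto simp: M' N)
    then have p: "p \<in> cdom M j" "p \<in> UM" "p \<in> cdom M i" "cmap M i p \<in> U" by (auto simp: UM_def)
    have "fder (cmap ?N k \<circ> ?F \<circ> cinv ?M j) (cmap M j p) = fder (\<lambda>x. C (cmap M i (cinv M j x))) (cmap M j p)"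
      by (rule fder_cong_open[OF oj[OF j]]) (use p eq_loc[OF j] in auto)
    also have "\<dots> = (\<lambda>v. fder C (cmap M i (cinv M j (cmap M j p))) (tchange M j i p v))"
      by (rule fder_eqI[OF smooth_on_chain[OF C(1) tchange_has_derivative[OF M j i]]])
        (use p cinv_cmap[OF M j] in auto)
    also have "\<dots> = (\<lambda>v. fder C (cmap M i p) (tchange M j i p v))" by (simp add: cinv_cmap[OF M j p(1)])
    finally have D: "fder (cmap ?N k \<circ> ?F \<circ> cinv ?M j) (cmap M j p) = (\<lambda>v. fder C (cmap M i p) (tchange M j i p v))" .
    \<comment> \<open>The transformation law of \<open>g\<close> returns the value from the chart
      \<open>i\<close> to the chart \<open>j\<close>.\<close>
    have "g i (cmap M i p) (tchange M j i p u) (tchange M j i p v) = g j (cmap M j p) u v"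
      using g i j p unfolding covariant2_def by blast
    then show ?thesis by (simp add: M' D) (simp add: k N metric[OF p(4)])
  qed
  ultimately show ?thesis unfolding isometry_def Let_def UM_def by blast
qed

section \<open>The local warped product decomposition\<close>

theorem theorem2p11:
  fixes n :: nat
    and M :: "('i, 'a, 'e::euclidean_space) manifold"
    and \<phi> :: "('i, 'e) endo"
    and \<eta> :: "'s::finite \<Rightarrow> ('i, 'e) form1"
    and \<xi> :: "'s \<Rightarrow> ('i, 'e) vfield"
    and g :: "('i, 'e) cov2"
  assumes "n \<ge> 1"
    and "DIM('v::euclidean_space) = 2 * n"
    and "generalized_Kenmotsu n M \<phi> \<eta> \<xi> g"
  shows "\<forall>p \<in> topspace (mtop M).
    \<exists>U (L :: (nat, real ^ 's, real ^ 's) manifold) (t :: real ^ 's \<Rightarrow> real ^ 's) h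
       (V :: (nat, 'v, 'v) manifold) J G k F.
      openin (mtop M) U \<and> p \<in> U \<and>
      flat_manifold L t h \<and> kaehler_manifold V J G \<and> k > 0 \<and>
      isometry (open_submanifold M U) g (product_manifold L V)
        (warped_metric L h (\<lambda>q. k * exp (\<Sum>a\<in>UNIV. t q $ a)) G) F"
proof
  fix p assume p: "p \<in> topspace (mtop M)"
  have "metric_f_manifold n M \<phi> \<eta> \<xi> g"
    using assms(3) unfolding generalized_Kenmotsu_def generalized_almost_Kenmotsu_def almost_s_contact_metric_manifold_def
    by blast
  then have M: "smooth_manifold M" and dim: "DIM('e) = DIM('v) + CARD('s)" and g: "covariant2 M g"
    unfolding metric_f_manifold_def riemannian_metric_def using assms(2) by simp_all
  obtain i where i: "i \<in> ind M" "p \<in> cdom M i" using p charts_cover[OF M] by blast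
  interpret local_kenmotsu "cimg M i" "\<phi> i" "\<lambda>a. \<eta> a i" "\<lambda>a. \<xi> a i" "g i"
    by (rule generalized_Kenmotsu_local[OF assms(3) i(1)])
  obtain U C H \<epsilon> and y0 :: 'v where U: "open U" "cmap M i p \<in> U" "U \<subseteq> cimg M i" and eps: "\<epsilon> > 0"
    and C: "smooth_on U C" and H: "smooth_on (ball (0 :: real ^ 's) \<epsilon> \<times> ball y0 \<epsilon>) H"
    and HC: "\<forall>x\<in>U. C x \<in> ball 0 \<epsilon> \<times> ball y0 \<epsilon> \<and> H (C x) = x"
    and CH: "\<forall>z\<in>ball 0 \<epsilon> \<times> ball y0 \<epsilon>. H z \<in> U \<and> C (H z) = z"
    and dC: "\<forall>x\<in>U. \<forall>v. fst (fder C x v) = (\<chi> a. \<eta> a i x v)"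
    and dC_xi: "\<forall>x\<in>U. \<forall>a. fder C x (\<xi> a i x) = (axis a 1, 0)"
    by (rule adapted_chart[where \<xi> = "\<lambda>a. \<xi> a i" and \<eta> = "\<lambda>a. \<eta> a i", OF S cmap_in[OF M i(2)]
          xi_smooth xi_commute eta_linear eta_smooth eta_closed eta_xi dim])
  interpret A: adapted_kenmotsu "cimg M i" "\<phi> i" "\<lambda>a. \<eta> a i" "\<lambda>a. \<xi> a i" "g i" U C H \<epsilon> y0
    by (rule adapted_kenmotsu.intro[OF local_kenmotsu_axioms adapted_kenmotsu_axioms.intro])
      (use U eps C H HC CH dC dC_xi in auto)
  let ?W = "ball (0 :: real ^ 's) \<epsilon>" and ?V = "ball y0 \<epsilon>"
  let ?L = "domain_manifold ?W"
  \<comment> \<open>The constant is 1 because \<open>A.G\<close> is the metric induced on the slice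
    \<open>t = 0\<close>, where the exponential equals 1.\<close>
  let ?h = "flat_metric ?L (\<lambda>x. x)" and ?f = "\<lambda>q. 1 * exp (\<Sum>a\<in>UNIV. q $ a)"
  have metric: "warped_metric ?L ?h ?f (\<lambda>_. A.G) (0 :: nat, 0 :: nat) (C x) (fder C x u) (fder C x v) = g i x u v"
    if x: "x \<in> U" for x u v
  proof -
    obtain t y where z: "C x = (t, y)" by (cases "C x")
    have Z: "(t, y) \<in> A.Z" using HC x z by (auto simp: A.Z_def)
    then have t: "t \<in> ?W" by (simp add: A.Z_def)
    have "H (t, y) = x" using HC x z by auto
    then have "g i x u v = (\<Sum>a\<in>UNIV. fst (fder C x u) $ a * fst (fder C x v) $ a)
        + (exp (\<Sum>a\<in>UNIV. t $ a))\<^sup>2 * A.G y (snd (fder C x u)) (snd (fder C x v))"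
      using A.warped[OF Z, of "fder C x u" "fder C x v"] A.dH_dC[OF x] by (simp add: z)
    then show ?thesis
      using t by (simp add: warped_metric_def case_prod_beta z flat_metric_domain)
  qed
  have iso: "isometry (open_submanifold M {q \<in> cdom M i. cmap M i q \<in> U}) g
      (product_manifold ?L (domain_manifold ?V)) (warped_metric ?L ?h ?f (\<lambda>_. A.G)) (C \<circ> cmap M i)"
    by (rule chart_isometry[where gN = "warped_metric ?L ?h ?f (\<lambda>_. A.G)" and H = H, OF M i(1) g U(1,3) open_ball open_ball C _ _ H _ _ metric]) (use HC CH in auto)
  show "\<exists>U (L :: (nat, real ^ 's, real ^ 's) manifold) (t :: real ^ 's \<Rightarrow> real ^ 's) h
       (V :: (nat, 'v, 'v) manifold) J G k F.
      openin (mtop M) U \<and> p \<in> U \<and> flat_manifold L t h \<and> kaehler_manifold V J G \<and> k > 0 \<and>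
      isometry (open_submanifold M U) g (product_manifold L V)
        (warped_metric L h (\<lambda>q. k * exp (\<Sum>a\<in>UNIV. t q $ a)) G) F"
  proof (intro exI conjI)
    show "openin (mtop M) {q \<in> cdom M i. cmap M i q \<in> U}" by (rule open_preimage_chart[OF M i(1) U(1)])
    show "p \<in> {q \<in> cdom M i. cmap M i q \<in> U}" using i(2) U(2) by simp
    show "flat_manifold ?L (\<lambda>x. x) ?h" by (rule flat_manifold_domain[OF open_ball])
    show "kaehler_manifold (domain_manifold ?V) (\<lambda>_. A.J) (\<lambda>_. A.G)" by (rule A.kaehler_slice)
    show "(1 :: real) > 0" by simp
    show "isometry (open_submanifold M {q \<in> cdom M i. cmap M i q \<in> U}) g
      (product_manifold ?L (domain_manifold ?V)) (warped_metric ?L ?h ?f (\<lambda>_. A.G)) (C \<circ> cmap M i)"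
      by (rule iso)
  qed
qed

end
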